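(* Let $\{\mathcal T_h\}$ be a family of triangulations of $\Omega$ (not required to fit the interface $\Gamma$) satisfying the shape-regularity and interface-intersection assumptions of the context. Let $R_h:V_h\to V_h\times V_h$ be the unfitted polynomial preserving recovery operator and let $I_h^{*}u$ be the interpolation of $u$ into $V_h$. If $u\in H^3(\Omega_1\cup\Omega_2)$, then $$\|\tilde\nabla u-R_hI_h^{*}u\|_{0,\Omega_1\cup\Omega_2}\le Ch^2|u|_{3,\Omega_1\cup\Omega_2},$$ where $\tilde\nabla u=(\nabla u_1,\nabla u_2)$, $u_i=u|_{\Omega_i}$, and $C>0$ is a constant independent of the mesh size $h$ and of the location of the interface relative to the mesh (and of $u$).
   Context: **Domain.** $\Omega\subset\mathbb R^2$ is a bounded polygonal domain with Lipschitz boundary. A $C^2$-curve $\Gamma$ divides $\Omega$ into two disjoint subdomains $\Omega_1,\Omega_2$. **Norms.** $\|\cdot\|_{k,D}$, $|\cdot|_{k,D}$ are the norm and seminorm of $H^{k}(D)$. $H^{k}(\Omega_1\cup\Omega_2)$ is the space of functions with $w|_{\Omega_i}\in H^{k}(\Omega_i)$, $i=1,2$, with norm $(\|w\|_{k,\Omega_1}^2+\|w\|_{k,\Omega_2}^2)^{1/2}$ and seminorm $(|w|_{k,\Omega_1}^2+|w|_{k,\Omega_2}^2)^{1/2}$. For a pair $(w_1,w_2)$ with $w_i$ defined on a set containing $\Omega_i$, $\|(w_1,w_2)\|_{0,\Omega_1\cup\Omega_2}^2=\|w_1\|_{0,\Omega_1}^2+\|w_2\|_{0,\Omega_2}^2$.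 **Mesh.** $\mathcal T_h$ is a triangulation of $\Omega$ independent of $\Gamma$, with mesh size $h=\max_T h_T$, where $h_T$ is the diameter of $T$ and $\rho_T$ the diameter of its inscribed circle. Shape regularity: there is a constant $\sigma_0$ with $h_T/\rho_T\le\sigma_0$ for all $T\in\mathcal T_h$. Interface intersection: $\Gamma$ intersects the boundary $\partial T$ of each interface element (element with $\Gamma\cap\overline T\neq\emptyset$) exactly twice, and each open edge at most once. Let $\mathcal T_{i,h}=\{T\in\mathcal T_h:\overline{\Omega_i}\cap\overline T\neq\emptyset\}$, $\Omega_{i,h}=\bigcup_{T\in\mathcal T_{i,h}}T$ (the $i$-th fictitious domain). **Finite element space.** $V_{i,h}=\{v\in C^0(\Omega_{i,h}): v|_T\in\mathbb P_1(T)\ \forall T\in\mathcal T_{i,h}\}$; $V_h=\{(v_{1,h},v_{2,h}):v_{i,h}\in V_{i,h}\}$. **Interpolation.** $E_i$ ($i=1,2$) is an extension operator from $H^3(\Omega_i)$ to $H^3(\Omega)$ with $(E_iw)|_{\Omega_i}=w$ and $\|E_iw\|_{s,\Omega}\le C\|w\|_{s,\Omega_i}$ for all $w\in H^s(\Omega_i)$, $s=0,1,2,3$. $I_{i,h}$ is the standard nodal interpolation from $C(\overline\Omega)$ to $V_{i,h}$. Then $I_h^{*}u=(I_{1,h}^{*}u_1,I_{2,h}^{*}u_2)$ with $I_{i,h}^{*}u_i=I_{i,h}E_iu_i$. **Recovery operator.** $G_h^i:V_{i,h}\to V_{i,h}\times V_{i,h}$ is the (linear) polynomial preserving recovery (PPR)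 gradient recovery operator on $\Omega_{i,h}$: for each vertex $z$ of $\mathcal T_{i,h}$ one selects a local patch of elements of $\mathcal T_{i,h}$ around $z$ whose vertices (all in $\Omega_{i,h}$) serve as sampling points and determine a unique quadratic least-squares fit $p_z\in\mathbb P_2$ of the nodal values of $v_{i,h}$; then $(G_h^iv_{i,h})(z)=\nabla p_z(z)$, and $G_h^iv_{i,h}$ is the continuous piecewise linear function with these nodal values. Standing properties of $G_h^i$ (known results on PPR used by the paper): $\|G_h^iv_{i,h}\|_{0,\Omega_{i,h}}\le C|v_{i,h}|_{1,\Omega_{i,h}}$ for $v_{i,h}\in V_{i,h}$, and $\|\nabla v_i-G_h^iI_{i,h}v_i\|_{0,\Omega_{i,h}}\le Ch^2\|v_i\|_{3,\Omega_{i,h}}$ for $v_i\in H^3(\Omega_{i,h})$. The unfitted polynomial preserving recovery operator is $R_hv_h=(G_h^1v_{1,h},G_h^2v_{2,h})$ for $v_h=(v_{1,h},v_{2,h})\in V_h$.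
   Formalization: The extension operators E_i in I_h^* are not arbitrary: the theorem asserts that some E_1, E_2 with all listed properties, fixed before the meshes and u, give the estimate; with the seminorm it fails for arbitrary such E_i. *)

theory Defs
  imports "HOL-Analysis.Analysis"
begin

section \<open>Sobolev spaces on open subsets of the plane\<close>

text \<open>
  Elements of \<open>H\<^sup>k(D)\<close> are represented by functions on the whole plane, of which only the values
  on \<open>D\<close> matter, and these only up to null sets.  So \<open>w|\<^sub>D \<in> H\<^sup>k(D)\<close> is \<open>w \<in> sobolev k D\<close>.
\<close>

definition partial :: "2 \<Rightarrow> (real^2 \<Rightarrow> real) \<Rightarrow> real^2 \<Rightarrow> real" where
  "partial j f = (\<lambda>x. frechet_derivative f (at x) (axis j 1))"

definition multi_partial :: "nat \<times> nat \<Rightarrow> (real^2 \<Rightarrow> real) \<Rightarrow> real^2 \<Rightarrow> real" where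
  "multi_partial \<alpha> f = (partial 1 ^^ fst \<alpha>) ((partial 2 ^^ snd \<alpha>) f)"

definition multi_order :: "nat \<times> nat \<Rightarrow> nat" where
  "multi_order \<alpha> = fst \<alpha> + snd \<alpha>"

text \<open>If all iterated partial derivatives are (Frechet) differentiable, they are all continuous and
  the order of differentiation is irrelevant, so the first condition below says that \<open>\<phi>\<close> is
  infinitely often differentiable.\<close>

definition test_function :: "(real^2) set \<Rightarrow> (real^2 \<Rightarrow> real) \<Rightarrow> bool" where
  "test_function D \<phi> \<longleftrightarrow>
     (\<forall>\<alpha>. multi_partial \<alpha> \<phi> differentiable_on UNIV) \<and>
     compact (closure {x. \<phi> x \<noteq> 0}) \<and> closure {x. \<phi> x \<noteq> 0} \<subseteq> D"

definition square_integrable :: "(real^2) set \<Rightarrow> (real^2 \<Rightarrow> real) \<Rightarrow> bool" where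
  "square_integrable D w \<longleftrightarrow>
     w \<in> borel_measurable (lebesgue_on D) \<and> integrable (lebesgue_on D) (\<lambda>x. (w x)\<^sup>2)"

definition L2_norm_on :: "(real^2) set \<Rightarrow> (real^2 \<Rightarrow> 'b::real_normed_vector) \<Rightarrow> real" where
  "L2_norm_on D w = sqrt (LINT x|lebesgue_on D. (norm (w x))\<^sup>2)"

definition has_weak_partial ::
    "(real^2) set \<Rightarrow> nat \<times> nat \<Rightarrow> (real^2 \<Rightarrow> real) \<Rightarrow> (real^2 \<Rightarrow> real) \<Rightarrow> bool" where
  "has_weak_partial D \<alpha> w g \<longleftrightarrow>
     square_integrable D g \<and>
     (\<forall>\<phi>. test_function D \<phi> \<longrightarrow>
        (LINT x|lebesgue_on D. w x * multi_partial \<alpha> \<phi> x) =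
        (-1) ^ multi_order \<alpha> * (LINT x|lebesgue_on D. g x * \<phi> x))"

definition weak_partial ::
    "(real^2) set \<Rightarrow> nat \<times> nat \<Rightarrow> (real^2 \<Rightarrow> real) \<Rightarrow> real^2 \<Rightarrow> real" where
  "weak_partial D \<alpha> w = (SOME g. has_weak_partial D \<alpha> w g)"

definition sobolev :: "nat \<Rightarrow> (real^2) set \<Rightarrow> (real^2 \<Rightarrow> real) set" where
  "sobolev k D = {w. square_integrable D w \<and>
                     (\<forall>\<alpha>. multi_order \<alpha> \<le> k \<longrightarrow> (\<exists>g. has_weak_partial D \<alpha> w g))}"

definition sobolev_norm :: "nat \<Rightarrow> (real^2) set \<Rightarrow> (real^2 \<Rightarrow> real) \<Rightarrow> real" where
  "sobolev_norm k D w =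
     sqrt (\<Sum>\<alpha> | multi_order \<alpha> \<le> k. (L2_norm_on D (weak_partial D \<alpha> w))\<^sup>2)"

definition sobolev_seminorm :: "nat \<Rightarrow> (real^2) set \<Rightarrow> (real^2 \<Rightarrow> real) \<Rightarrow> real" where
  "sobolev_seminorm k D w =
     sqrt (\<Sum>\<alpha> | multi_order \<alpha> = k. (L2_norm_on D (weak_partial D \<alpha> w))\<^sup>2)"

definition weak_grad :: "(real^2) set \<Rightarrow> (real^2 \<Rightarrow> real) \<Rightarrow> real^2 \<Rightarrow> real^2" where
  "weak_grad D w = (\<lambda>x. vector [weak_partial D (1,0) w x, weak_partial D (0,1) w x])"

definition broken_sobolev :: "nat \<Rightarrow> (real^2) set \<Rightarrow> (real^2) set \<Rightarrow> (real^2 \<Rightarrow> real) set" where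
  "broken_sobolev k \<Omega>1 \<Omega>2 = sobolev k \<Omega>1 \<inter> sobolev k \<Omega>2"

definition broken_seminorm ::
    "nat \<Rightarrow> (real^2) set \<Rightarrow> (real^2) set \<Rightarrow> (real^2 \<Rightarrow> real) \<Rightarrow> real" where
  "broken_seminorm k \<Omega>1 \<Omega>2 w =
     sqrt ((sobolev_seminorm k \<Omega>1 w)\<^sup>2 + (sobolev_seminorm k \<Omega>2 w)\<^sup>2)"

definition broken_grad ::
    "(real^2) set \<Rightarrow> (real^2) set \<Rightarrow> (real^2 \<Rightarrow> real)
       \<Rightarrow> (real^2 \<Rightarrow> real^2) \<times> (real^2 \<Rightarrow> real^2)" where
  "broken_grad \<Omega>1 \<Omega>2 u = (weak_grad \<Omega>1 u, weak_grad \<Omega>2 u)"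

text \<open>The \<open>L\<^sup>2\<close> distance of two pairs of functions, that is, the norm of their difference.\<close>

definition L2_pair_dist ::
    "(real^2) set \<Rightarrow> (real^2) set
       \<Rightarrow> (real^2 \<Rightarrow> 'b::real_normed_vector) \<times> (real^2 \<Rightarrow> 'b)
       \<Rightarrow> (real^2 \<Rightarrow> 'b) \<times> (real^2 \<Rightarrow> 'b) \<Rightarrow> real" where
  "L2_pair_dist \<Omega>1 \<Omega>2 v w =
     sqrt ((L2_norm_on \<Omega>1 (\<lambda>x. fst v x - fst w x))\<^sup>2 +
           (L2_norm_on \<Omega>2 (\<lambda>x. snd v x - snd w x))\<^sup>2)"


section \<open>The domain and the interface\<close>

definition lipschitz_boundary :: "(real^2) set \<Rightarrow> bool" where
  "lipschitz_boundary \<Omega> \<longleftrightarrow>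
     (\<forall>x \<in> frontier \<Omega>. \<exists>a b \<gamma> L r.
        norm a = 1 \<and> norm b = 1 \<and> a \<bullet> b = 0 \<and> r > 0 \<and> L-lipschitz_on UNIV (\<gamma> :: real \<Rightarrow> real) \<and>
        \<Omega> \<inter> ball x r = {y \<in> ball x r. \<gamma> (y \<bullet> a) < y \<bullet> b})"

definition polygonal_lipschitz_domain :: "(real^2) set \<Rightarrow> bool" where
  "polygonal_lipschitz_domain \<Omega> \<longleftrightarrow>
     open \<Omega> \<and> connected \<Omega> \<and> \<Omega> \<noteq> {} \<and> bounded \<Omega> \<and>
     (\<exists>S :: ((real^2) \<times> (real^2)) set.
        finite S \<and> frontier \<Omega> = (\<Union>(a, b) \<in> S. closed_segment a b)) \<and>
     lipschitz_boundary \<Omega>"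

text \<open>A regular simple \<open>C\<^sup>2\<close> curve, either an arc (containing its end points) or a closed curve; in
  the latter case the parametrization is to be \<open>C\<^sup>2\<close> also across the base point.\<close>

definition C2_curve :: "(real^2) set \<Rightarrow> bool" where
  "C2_curve \<Gamma> \<longleftrightarrow>
     (\<exists>g g' g''.
        simple_path g \<and> path_image g = \<Gamma> \<and>
        (\<forall>t \<in> {0..1}. (g has_vector_derivative g' t) (at t within {0..1}) \<and>
                      (g' has_vector_derivative g'' t) (at t within {0..1}) \<and> g' t \<noteq> 0) \<and>
        continuous_on {0..1} g'' \<and>
        (g 0 = g 1 \<longrightarrow> g' 0 = g' 1 \<and> g'' 0 = g'' 1))"

definition interface :: "(real^2) set \<Rightarrow> (real^2) set \<Rightarrow> (real^2) set \<Rightarrow> (real^2) set \<Rightarrow> bool" where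
  "interface \<Omega> \<Gamma> \<Omega>1 \<Omega>2 \<longleftrightarrow>
     C2_curve \<Gamma> \<and> \<Gamma> \<subseteq> closure \<Omega> \<and>
     open \<Omega>1 \<and> connected \<Omega>1 \<and> \<Omega>1 \<noteq> {} \<and>
     open \<Omega>2 \<and> connected \<Omega>2 \<and> \<Omega>2 \<noteq> {} \<and>
     \<Omega>1 \<inter> \<Omega>2 = {} \<and> \<Omega> - \<Gamma> = \<Omega>1 \<union> \<Omega>2"


section \<open>Meshes\<close>

text \<open>Mesh elements are closed triangles.\<close>

definition triangulation_of :: "(real^2) set \<Rightarrow> (real^2) set set \<Rightarrow> bool" where
  "triangulation_of \<Omega> \<T> \<longleftrightarrow>
     triangulation \<T> \<and> (\<forall>T \<in> \<T>. 2 simplex T) \<and> \<Union>\<T> = closure \<Omega>"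

definition mesh_size :: "(real^2) set set \<Rightarrow> real" where
  "mesh_size \<T> = Max (diameter ` \<T>)"

definition inscribed_diameter :: "(real^2) set \<Rightarrow> real" where
  "inscribed_diameter T = 2 * Sup {r. r \<ge> 0 \<and> (\<exists>c. cball c r \<subseteq> T)}"

definition shape_regular :: "real \<Rightarrow> (real^2) set set \<Rightarrow> bool" where
  "shape_regular \<sigma> \<T> \<longleftrightarrow> (\<forall>T \<in> \<T>. diameter T / inscribed_diameter T \<le> \<sigma>)"

text \<open>The open edges of a triangle are the relative interiors of its edges.  A cardinality of \<open>2\<close>
  includes finiteness, so that the second cardinality is that of a finite set as well.\<close>

definition interface_intersection :: "(real^2) set \<Rightarrow> (real^2) set set \<Rightarrow> bool" where
  "interface_intersection \<Gamma> \<T> \<longleftrightarrow>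
     (\<forall>T \<in> \<T>. \<Gamma> \<inter> T \<noteq> {} \<longrightarrow>
        card (\<Gamma> \<inter> frontier T) = 2 \<and>
        (\<forall>e. e edge_of T \<longrightarrow> card (\<Gamma> \<inter> rel_interior e) \<le> 1))"

definition submesh :: "(real^2) set \<Rightarrow> (real^2) set set \<Rightarrow> (real^2) set set" where
  "submesh \<Omega>i \<T> = {T \<in> \<T>. closure \<Omega>i \<inter> T \<noteq> {}}"

definition mesh_vertices :: "(real^2) set set \<Rightarrow> (real^2) set" where
  "mesh_vertices \<T> = {z. \<exists>T \<in> \<T>. z extreme_point_of T}"


section \<open>Finite elements and interpolation\<close>

text \<open>
  In this and the following section \<open>M\<close> is a mesh of a region \<open>\<Union>M\<close> and stands for a submesh
  belonging to one of the two subdomains.  Finite element functions are continued by zero outside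
  \<open>\<Union>M\<close>, so that they are determined by their nodal values.
\<close>

definition fe_space :: "(real^2) set set \<Rightarrow> (real^2 \<Rightarrow> real) set" where
  "fe_space M = {v. continuous_on (\<Union>M) v \<and>
                    (\<forall>T \<in> M. \<exists>a b. \<forall>x \<in> T. v x = a + b \<bullet> x) \<and>
                    (\<forall>x. x \<notin> \<Union>M \<longrightarrow> v x = 0)}"

definition nodal_interp :: "(real^2) set set \<Rightarrow> (real^2 \<Rightarrow> real) \<Rightarrow> real^2 \<Rightarrow> real" where
  "nodal_interp M f = (THE v. v \<in> fe_space M \<and> (\<forall>z \<in> mesh_vertices M. v z = f z))"

text \<open>
  A bounded linear extension operator on \<open>H\<^sup>s(\<Omega>i)\<close> for \<open>s = 0,1,2,3\<close>.  Linearity and the extension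
  property hold in the sense of \<open>L\<^sup>2\<close>; linearity together with the bound for \<open>s = 0\<close> makes \<open>E\<close>
  compatible with equality almost everywhere.  Since nodal interpolation evaluates \<open>E w\<close> at points,
  \<open>E w\<close> denotes for \<open>w \<in> H\<^sup>3(\<Omega>i)\<close> the continuous representative on the closure of \<open>\<Omega>\<close>, which exists
  by Sobolev embedding.

  The error estimate, whose right-hand side is a seminorm, vanishing if \<open>u\<close> is quadratic on each
  subdomain, cannot hold for every such \<open>E\<close>: an operator need not extend a quadratic polynomial by
  itself, whereas the recovered gradient depends on values of \<open>E u\<close> outside the subdomain.  Hence
  the operators have to be chosen, once for all meshes and all \<open>u\<close>.
\<close>

definition extension_operator ::
    "(real^2) set \<Rightarrow> (real^2) set \<Rightarrow> ((real^2 \<Rightarrow> real) \<Rightarrow> real^2 \<Rightarrow> real) \<Rightarrow> bool" where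
  "extension_operator \<Omega> \<Omega>i E \<longleftrightarrow>
     (\<forall>a b. \<forall>v \<in> sobolev 0 \<Omega>i. \<forall>w \<in> sobolev 0 \<Omega>i.
        AE x in lebesgue_on \<Omega>. E (\<lambda>y. a * v y + b * w y) x = a * E v x + b * E w x) \<and>
     (\<forall>w \<in> sobolev 0 \<Omega>i. AE x in lebesgue_on \<Omega>i. E w x = w x) \<and>
     (\<exists>C. \<forall>s \<le> 3. \<forall>w \<in> sobolev s \<Omega>i.
        E w \<in> sobolev s \<Omega> \<and> sobolev_norm s \<Omega> (E w) \<le> C * sobolev_norm s \<Omega>i w) \<and>
     (\<forall>w \<in> sobolev 3 \<Omega>i. continuous_on (closure \<Omega>) (E w))"

text \<open>The interpolation \<open>I\<^sub>h\<^sup>*\<close> into the unfitted space: \<open>(I\<^sub>1\<^sub>,\<^sub>h E1 u\<^sub>1, I\<^sub>2\<^sub>,\<^sub>h E2 u\<^sub>2)\<close>.\<close>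

definition unfitted_interp ::
    "(real^2) set \<Rightarrow> (real^2) set \<Rightarrow> (real^2) set set
       \<Rightarrow> ((real^2 \<Rightarrow> real) \<Rightarrow> real^2 \<Rightarrow> real) \<Rightarrow> ((real^2 \<Rightarrow> real) \<Rightarrow> real^2 \<Rightarrow> real)
       \<Rightarrow> (real^2 \<Rightarrow> real) \<Rightarrow> (real^2 \<Rightarrow> real) \<times> (real^2 \<Rightarrow> real)" where
  "unfitted_interp \<Omega>1 \<Omega>2 \<T> E1 E2 u =
     (nodal_interp (submesh \<Omega>1 \<T>) (E1 u), nodal_interp (submesh \<Omega>2 \<T>) (E2 u))"


section \<open>Polynomial preserving recovery\<close>

definition quadratics :: "(real^2 \<Rightarrow> real) set" where
  "quadratics = {p. \<exists>a b c d e f. \<forall>x.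
     p x = a + b * x$1 + c * x$2 + d * (x$1)\<^sup>2 + e * (x$1 * x$2) + f * (x$2)\<^sup>2}"

definition is_quadratic_fit ::
    "(real^2) set \<Rightarrow> (real^2 \<Rightarrow> real) \<Rightarrow> (real^2 \<Rightarrow> real) \<Rightarrow> bool" where
  "is_quadratic_fit S f p \<longleftrightarrow>
     p \<in> quadratics \<and> (\<forall>q \<in> quadratics. (\<Sum>x\<in>S. (p x - f x)\<^sup>2) \<le> (\<Sum>x\<in>S. (q x - f x)\<^sup>2))"

definition quadratic_fit :: "(real^2) set \<Rightarrow> (real^2 \<Rightarrow> real) \<Rightarrow> real^2 \<Rightarrow> real" where
  "quadratic_fit S f = (THE p. is_quadratic_fit S f p)"

text \<open>\<open>P z\<close> is the patch of elements selected for the vertex \<open>z\<close>; its vertices are the sampling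
  points.  The rule by which the patches are chosen, and how large they may be, is left open.\<close>

definition ppr_patches :: "(real^2) set set \<Rightarrow> (real^2 \<Rightarrow> (real^2) set set) \<Rightarrow> bool" where
  "ppr_patches M P \<longleftrightarrow>
     (\<forall>z \<in> mesh_vertices M.
        P z \<subseteq> M \<and> z \<in> mesh_vertices (P z) \<and>
        (\<forall>f. \<exists>!p. is_quadratic_fit (mesh_vertices (P z)) f p))"

definition ppr_gradient ::
    "(real^2) set set \<Rightarrow> (real^2 \<Rightarrow> (real^2) set set) \<Rightarrow> (real^2 \<Rightarrow> real) \<Rightarrow> real^2 \<Rightarrow> real^2" where
  "ppr_gradient M P v =
     (\<lambda>x. \<chi> j. nodal_interp M (\<lambda>z. partial j (quadratic_fit (mesh_vertices (P z)) v) z) x)"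

text \<open>
  The two standing properties of the recovery operator: boundedness and superconvergence for smooth
  functions.  Norms on the closed polygonal region \<open>\<Union>M\<close> are those on its interior.
\<close>

definition ppr_estimates ::
    "real \<Rightarrow> real \<Rightarrow> (real^2) set set \<Rightarrow> (real^2 \<Rightarrow> (real^2) set set) \<Rightarrow> bool" where
  "ppr_estimates C h M P \<longleftrightarrow>
     (\<forall>v \<in> fe_space M.
        L2_norm_on (interior (\<Union>M)) (ppr_gradient M P v)
          \<le> C * sobolev_seminorm 1 (interior (\<Union>M)) v) \<and>
     (\<forall>v \<in> sobolev 3 (interior (\<Union>M)). continuous_on (\<Union>M) v \<longrightarrow>
        L2_norm_on (interior (\<Union>M))
            (\<lambda>x. weak_grad (interior (\<Union>M)) v x - ppr_gradient M P (nodal_interp M v) x)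
          \<le> C * h\<^sup>2 * sobolev_norm 3 (interior (\<Union>M)) v)"

definition unfitted_ppr ::
    "(real^2) set \<Rightarrow> (real^2) set \<Rightarrow> (real^2) set set
       \<Rightarrow> (real^2 \<Rightarrow> (real^2) set set) \<Rightarrow> (real^2 \<Rightarrow> (real^2) set set)
       \<Rightarrow> (real^2 \<Rightarrow> real) \<times> (real^2 \<Rightarrow> real)
       \<Rightarrow> (real^2 \<Rightarrow> real^2) \<times> (real^2 \<Rightarrow> real^2)" where
  "unfitted_ppr \<Omega>1 \<Omega>2 \<T> P1 P2 v =
     (ppr_gradient (submesh \<Omega>1 \<T>) P1 (fst v), ppr_gradient (submesh \<Omega>2 \<T>) P2 (snd v))"

text \<open>A mesh with selected patches satisfying all assumptions, with shape regularity constant \<open>\<sigma>\<close>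
  and constant \<open>K\<close> in the standing properties of the recovery operators.\<close>

definition admissible_mesh ::
    "(real^2) set \<Rightarrow> (real^2) set \<Rightarrow> (real^2) set \<Rightarrow> (real^2) set \<Rightarrow> real \<Rightarrow> real
       \<Rightarrow> (real^2) set set \<Rightarrow> (real^2 \<Rightarrow> (real^2) set set) \<Rightarrow> (real^2 \<Rightarrow> (real^2) set set)
       \<Rightarrow> bool" where
  "admissible_mesh \<Omega> \<Gamma> \<Omega>1 \<Omega>2 \<sigma> K \<T> P1 P2 \<longleftrightarrow>
     triangulation_of \<Omega> \<T> \<and> shape_regular \<sigma> \<T> \<and> interface_intersection \<Gamma> \<T> \<and>
     ppr_patches (submesh \<Omega>1 \<T>) P1 \<and> ppr_estimates K (mesh_size \<T>) (submesh \<Omega>1 \<T>) P1 \<and>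
     ppr_patches (submesh \<Omega>2 \<T>) P2 \<and> ppr_estimates K (mesh_size \<T>) (submesh \<Omega>2 \<T>) P2"

end

theory Submission
  imports Defs
begin

text \<open>
  The recovery operator composed with nodal interpolation reproduces gradients of quadratics, so on
  each subdomain \<open>D\<close> a quadratic may be split off before the superconvergence estimate, which has
  the full \<open>H\<^sup>3\<close> norm on its right-hand side, is applied.  Given any extension operator \<open>E\<^sub>0\<close>, let
  \<open>E w = E\<^sub>0 (w - \<Pi> w) + \<Pi> w\<close>, where \<open>\<Pi> w\<close> is the averaged Taylor polynomial of degree two.  Since
  \<open>\<Pi>\<close> is \<open>L\<^sup>2\<close>-bounded, \<open>E\<close> is again an extension operator, and it remains to bound the \<open>H\<^sup>3\<close> norm of
  \<open>w - \<Pi> w\<close> by the seminorm of \<open>w\<close>.  The derivatives of \<open>w - \<Pi> w\<close> of order at most two have vanishing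
  weighted mean, so this follows by applying a Poincare inequality on \<open>D\<close> three times.

  The subdomain need not be Lipschitz, but it is connected and has an extension operator for \<open>H\<^sup>1\<close>
  into a domain that is a finite union of triangles.  On a compact part of \<open>D\<close> the Poincare inequality
  follows from that on balls, along chains of balls.  The remainder has small measure, and the
  extended function cannot concentrate there: by the Poincare inequality on small convex pieces of
  the triangles, bounded sets of \<open>H\<^sup>1\<close> are uniformly square integrable.
\<close>


text \<open>The operators are fixed before the mesh, the patches and \<open>K\<close>, so one
  quadratic per function, taken over a single ball of the subdomain, must serve all meshes. Since
  \<open>extension_operator\<close> demands bounds from s = 0 on, this quadratic may depend only on
  the L2 class of the function.

  The obstacle is the Poincare inequality: of the boundary of the subdomain the proof uses only that
  the given operator extends functions across it, and no compact embedding is invoked. On a set of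
  small measure the extended function carries at most \<eta> times its squared H1 norm on the whole
  domain. The extension bound turns this into \<eta> * E times the squared H1 norm on the subdomain,
  and for \<eta> * E at most 1/2 the L2 part is absorbed on the left. Hence smallness must be
  available with an arbitrarily small factor in front of the gradient term. The triangles that
  provide it come from any one mesh; if the domain has none, the error estimate is vacuous.\<close>

section \<open>Test functions\<close>

text \<open>The second difference is symmetric in \<open>u\<close> and \<open>v\<close>, so mixed derivatives commute as soon as both first
  derivatives are differentiable at the point (Young).\<close>

lemma second_difference_tendsto:
  fixes f :: "'a::real_normed_vector \<Rightarrow> real"
  assumes d: "\<And>y. (f has_derivative f' y) (at y)"
    and A: "((\<lambda>y. f' y u) has_derivative A) (at x)"
  shows "((\<lambda>h. (f (x + h *\<^sub>R u + h *\<^sub>R v) - f (x + h *\<^sub>R u) - f (x + h *\<^sub>R v) + f x) / h\<^sup>2)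
           \<longlongrightarrow> A v) (at_right 0)"
proof (rule tendstoI)
  fix e :: real assume e: "e > 0"
  define N where "N = norm u + norm v + 1"
  have N: "N > 0" "norm u \<le> N" "norm v \<le> N"
    unfolding N_def by (auto simp: add_nonneg_pos)
  \<comment> \<open>Each of the two linearization errors is at most \<open>e' * (h * N)\<close>;
    after division by h they sum to 2 * e' * N = e / 2.\<close>
  define e' where "e' = e / (4 * N)"
  have e': "e' > 0" using e N by (simp add: e'_def)
  from A have lin: "bounded_linear A"
    and "\<exists>d>0. \<forall>y. norm (y - x) < d \<longrightarrow> norm (f' y u - f' x u - A (y - x)) \<le> e' * norm (y - x)"
    using e' by (auto simp: has_derivative_at_alt)
  then obtain d0 where d0: "d0 > 0"
    "\<And>y. norm (y - x) < d0 \<Longrightarrow> norm (f' y u - f' x u - A (y - x)) \<le> e' * norm (y - x)"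
    by blast
  interpret A: bounded_linear A by fact
  have "dist ((f (x + h *\<^sub>R u + h *\<^sub>R v) - f (x + h *\<^sub>R u) - f (x + h *\<^sub>R v) + f x) / h\<^sup>2) (A v) < e"
    if h: "0 < h" "h < d0 / N" for h
  proof -
    \<comment> \<open>The second difference is the increment \<open>g h - g 0\<close>. The mean
      value theorem reduces it to first derivatives along u at two points near x, both of which
      \<open>A\<close> linearizes.\<close>
    define g where "g = (\<lambda>s. f (x + s *\<^sub>R u + h *\<^sub>R v) - f (x + s *\<^sub>R u))"
    define g' where "g' = (\<lambda>s. f' (x + s *\<^sub>R u + h *\<^sub>R v) u - f' (x + s *\<^sub>R u) u)"
    have der: "DERIV g s :> g' s" for s
    proof -
      have 1: "((\<lambda>s. f (x + s *\<^sub>R u + w)) has_derivative (\<lambda>t. f' (x + s *\<^sub>R u + w) (t *\<^sub>R u))) (at s)" for w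
        by (rule has_derivative_compose[OF _ d, where f="\<lambda>s. x + s *\<^sub>R u + w"])
           (auto intro!: derivative_eq_intros)
      have 2: "f' y (t *\<^sub>R u) = f' y u * t" for y t
        using linear_cmul[OF has_derivative_linear[OF d[of y]], of t u] by simp
      have "(g has_derivative (\<lambda>t. f' (x + s *\<^sub>R u + h *\<^sub>R v) (t *\<^sub>R u) - f' (x + s *\<^sub>R u) (t *\<^sub>R u))) (at s)"
        unfolding g_def using has_derivative_diff[OF 1[of "h *\<^sub>R v"] 1[of 0]] by simp
      then show ?thesis
        unfolding has_field_derivative_def g'_def 2
        by (rule has_derivative_eq_rhs) (auto simp: algebra_simps)
    qed
    obtain s where s: "0 < s" "s < h" "g h - g 0 = (h - 0) * g' s"
      using MVT2[of 0 h g g'] h der by auto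
    have hN: "h * N < d0" using h N by (simp add: pos_less_divide_eq)
    have n1: "norm (s *\<^sub>R u + h *\<^sub>R v) \<le> h * N"
    proof -
      have "norm (s *\<^sub>R u + h *\<^sub>R v) \<le> s * norm u + h * norm v"
        using norm_triangle_ineq[of "s *\<^sub>R u" "h *\<^sub>R v"] s h by simp
      also have "\<dots> \<le> h * norm u + h * norm v" using s by (auto intro!: mult_right_mono)
      also have "\<dots> \<le> h * N" using h by (simp add: N_def algebra_simps)
      finally show ?thesis .
    qed
    have n2: "norm (s *\<^sub>R u) \<le> h * N"
      using s h N by (auto intro!: mult_mono)
    have b1: "\<bar>f' (x + s *\<^sub>R u + h *\<^sub>R v) u - f' x u - A (s *\<^sub>R u + h *\<^sub>R v)\<bar> \<le> e' * (h * N)"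
    proof -
      have "norm (x + s *\<^sub>R u + h *\<^sub>R v - x) < d0" using n1 hN by (simp add: add.assoc)
      from d0(2)[OF this] have "\<bar>f' (x + s *\<^sub>R u + h *\<^sub>R v) u - f' x u - A (s *\<^sub>R u + h *\<^sub>R v)\<bar>
          \<le> e' * norm (s *\<^sub>R u + h *\<^sub>R v)"
        by (simp add: add.assoc)
      also have "\<dots> \<le> e' * (h * N)" using n1 e' by (intro mult_left_mono) auto
      finally show ?thesis .
    qed
    have b2: "\<bar>f' (x + s *\<^sub>R u) u - f' x u - A (s *\<^sub>R u)\<bar> \<le> e' * (h * N)"
    proof -
      have "norm (x + s *\<^sub>R u - x) < d0" using n2 hN by simp
      from d0(2)[OF this] have "\<bar>f' (x + s *\<^sub>R u) u - f' x u - A (s *\<^sub>R u)\<bar> \<le> e' * norm (s *\<^sub>R u)"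
        by simp
      also have "\<dots> \<le> e' * (h * N)" using n2 e' by (intro mult_left_mono) auto
      finally show ?thesis .
    qed
    have b3: "\<bar>g' s - h * A v\<bar> \<le> 2 * (e' * (h * N))"
      using b1 b2 unfolding g'_def A.add A.scaleR by (simp add: abs_if split: if_splits)
    have "(f (x + h *\<^sub>R u + h *\<^sub>R v) - f (x + h *\<^sub>R u) - f (x + h *\<^sub>R v) + f x) / h\<^sup>2 = g' s / h"
    proof -
      have "f (x + h *\<^sub>R u + h *\<^sub>R v) - f (x + h *\<^sub>R u) - f (x + h *\<^sub>R v) + f x = h * g' s"
        using s(3) by (simp add: g_def)
      then show ?thesis using h by (simp add: power2_eq_square)
    qed
    moreover have "\<bar>g' s / h - A v\<bar> = \<bar>g' s - h * A v\<bar> / h"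
      using h by (simp add: field_simps abs_divide)
    moreover have "\<bar>g' s - h * A v\<bar> / h \<le> e / 2"
      using b3 h N by (simp add: e'_def field_simps)
    ultimately have "\<bar>(f (x + h *\<^sub>R u + h *\<^sub>R v) - f (x + h *\<^sub>R u) - f (x + h *\<^sub>R v) + f x) / h\<^sup>2 - A v\<bar> \<le> e / 2"
      by metis
    with e show ?thesis unfolding dist_real_def by linarith
  qed
  then show "\<forall>\<^sub>F h in at_right 0. dist ((f (x + h *\<^sub>R u + h *\<^sub>R v) - f (x + h *\<^sub>R u) - f (x + h *\<^sub>R v) + f x) / h\<^sup>2) (A v) < e"
    unfolding eventually_at_right_field using d0(1) N by (intro exI[of _ "d0 / N"]) auto
qed

lemma has_derivative_partial:
  assumes "f differentiable_on UNIV"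
  shows "(f has_derivative frechet_derivative f (at x)) (at x)"
  using assms by (simp add: differentiable_on_def frechet_derivative_works)

lemma partial_commute:
  assumes "f differentiable_on UNIV" "partial i f differentiable_on UNIV"
    "partial j f differentiable_on UNIV"
  shows "partial i (partial j f) = partial j (partial i f)"
proof
  fix x :: "real^2"
  let ?D = "\<lambda>g. frechet_derivative g (at x)"
  have 1: "((\<lambda>h. (f (x + h *\<^sub>R axis k 1 + h *\<^sub>R axis l 1) - f (x + h *\<^sub>R axis k 1)
            - f (x + h *\<^sub>R axis l 1) + f x) / h\<^sup>2) \<longlongrightarrow> ?D (partial k f) (axis l 1)) (at_right 0)"
    if "partial k f differentiable_on UNIV" for k l
    by (rule second_difference_tendsto[where f'="\<lambda>y. frechet_derivative f (at y)"])
       (use has_derivative_partial[OF that] has_derivative_partial[OF assms(1)] in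
          \<open>simp_all add: partial_def[abs_def]\<close>)
  have "(\<lambda>h. (f (x + h *\<^sub>R axis j 1 + h *\<^sub>R axis i 1) - f (x + h *\<^sub>R axis j 1)
            - f (x + h *\<^sub>R axis i 1) + f x) / h\<^sup>2) =
        (\<lambda>h. (f (x + h *\<^sub>R axis i 1 + h *\<^sub>R axis j 1) - f (x + h *\<^sub>R axis i 1)
            - f (x + h *\<^sub>R axis j 1) + f x) / h\<^sup>2)"
    by (simp add: algebra_simps)
  with 1[OF assms(2), of j] 1[OF assms(3), of i]
  have "?D (partial i f) (axis j 1) = ?D (partial j f) (axis i 1)"
    by (metis (no_types, lifting) tendsto_unique[OF trivial_limit_at_right_real])
  then show "partial i (partial j f) x = partial j (partial i f) x"
    by (simp add: partial_def)
qed

section \<open>Smooth functions and the calculus of multi-indices\<close>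

definition smooth :: "(real^2 \<Rightarrow> real) \<Rightarrow> bool" where
  "smooth f \<longleftrightarrow> (\<forall>\<alpha>. multi_partial \<alpha> f differentiable_on UNIV)"

lemma multi_partial_0 [simp]: "multi_partial (0, 0) f = f"
  by (simp add: multi_partial_def)

lemma multi_partial_Suc_left: "multi_partial (Suc a, b) f = partial 1 (multi_partial (a, b) f)"
  by (simp add: multi_partial_def)

lemma multi_partial_partial_2: "multi_partial (a, b) (partial 2 f) = multi_partial (a, Suc b) f"
  by (simp add: multi_partial_def funpow_swap1)

text \<open>\<open>multi_partial\<close> differentiates in direction 2 first, so an inner
  \<open>partial 1\<close> has to be moved past every \<open>partial 2\<close>; each exchange is an
  instance of \<open>partial_commute\<close>.\<close>

lemma multi_partial_partial_1:
  assumes "smooth f"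
  shows "multi_partial (a, b) (partial 1 f) = multi_partial (Suc a, b) f"
proof -
  have d: "multi_partial (a, b) f differentiable_on UNIV" for a b
    using assms by (auto simp: smooth_def)
  have "(partial 2 ^^ b) (partial 1 f) = partial 1 ((partial 2 ^^ b) f)"
  proof (induction b)
    case (Suc b)
    have "partial 2 (partial 1 ((partial 2 ^^ b) f)) = partial 1 (partial 2 ((partial 2 ^^ b) f))"
      by (rule partial_commute) (use d[of 0 b] d[of 0 "Suc b"] d[of 1 b] in \<open>simp_all add: multi_partial_def\<close>)
    with Suc show ?case by simp
  qed simp
  then show ?thesis by (simp add: multi_partial_def funpow_swap1)
qed

text \<open>The multi-index \<open>\<alpha> + e\<^sub>j\<close>.\<close>

definition shift :: "2 \<Rightarrow> nat \<times> nat \<Rightarrow> nat \<times> nat" where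
  "shift j \<alpha> = (if j = 1 then (Suc (fst \<alpha>), snd \<alpha>) else (fst \<alpha>, Suc (snd \<alpha>)))"

lemma multi_order_shift [simp]: "multi_order (shift j \<alpha>) = Suc (multi_order \<alpha>)"
  by (simp add: shift_def multi_order_def)

lemma multi_partial_partial:
  assumes "smooth f"
  shows "multi_partial \<alpha> (partial j f) = multi_partial (shift j \<alpha>) f"
proof (cases "j = 1")
  case True
  then show ?thesis
    using multi_partial_partial_1[OF assms, of "fst \<alpha>" "snd \<alpha>"] by (simp add: shift_def)
next
  case False
  then have "j = 2" using exhaust_2 by auto
  then show ?thesis
    using multi_partial_partial_2[of "fst \<alpha>" "snd \<alpha>" f] by (simp add: shift_def)
qed

lemma smooth_partial:
  assumes "smooth f"
  shows "smooth (partial j f)"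
  unfolding smooth_def[of "partial j f"]
proof
  fix \<alpha>
  show "multi_partial \<alpha> (partial j f) differentiable_on UNIV"
    unfolding multi_partial_partial[OF assms] using assms unfolding smooth_def by blast
qed

lemma smooth_funpow_partial: "smooth f \<Longrightarrow> smooth ((partial j ^^ n) f)"
  by (induction n) (auto intro: smooth_partial)

lemma smooth_multi_partial: "smooth f \<Longrightarrow> smooth (multi_partial \<alpha> f)"
  by (simp add: multi_partial_def smooth_funpow_partial)

lemma smooth_differentiable: "smooth f \<Longrightarrow> f differentiable_on UNIV"
  using multi_partial_0[of f] by (metis smooth_def)

lemma smooth_continuous: "smooth f \<Longrightarrow> continuous_on A f"
  by (meson continuous_on_subset differentiable_imp_continuous_on smooth_differentiable top_greatest)

text \<open>Together with \<open>multi_partial_partial\<close> this lets a further derivative enter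
  at either end of \<open>multi_partial\<close>; inductions over multi-indices and the composition
  of weak derivatives rely on both.\<close>

lemma partial_multi_partial:
  assumes "smooth f"
  shows "partial j (multi_partial \<alpha> f) = multi_partial (shift j \<alpha>) f"
proof (cases "j = 1")
  case True
  then show ?thesis by (cases \<alpha>) (simp add: shift_def multi_partial_Suc_left)
next
  case False
  then have j: "j = 2" using exhaust_2 by auto
  obtain a b where \<alpha>: "\<alpha> = (a, b)" by force
  have "partial 2 (multi_partial (a, b) f) = multi_partial (a, Suc b) f" for b
  proof (induction a)
    case 0
    then show ?case by (simp add: multi_partial_def)
  next
    case (Suc a)
    have "partial 2 (partial 1 (multi_partial (a, b) f)) = partial 1 (partial 2 (multi_partial (a, b) f))"
      by (rule partial_commute) (intro smooth_differentiable smooth_partial smooth_multi_partial assms)+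
    then show ?case by (simp add: multi_partial_Suc_left Suc)
  qed
  with j \<alpha> show ?thesis by (simp add: shift_def)
qed

text \<open>Induction on the order that treats both coordinate directions alike.\<close>

lemma shift_induct [case_names 0 shift]:
  assumes "P (0, 0)" and "\<And>j \<alpha>. P \<alpha> \<Longrightarrow> P (shift j \<alpha>)"
  shows "P \<alpha>"
proof -
  have "P (a, b)" for a b
  proof (induction a)
    case 0
    show ?case
    proof (induction b)
      case (Suc b)
      from assms(2)[OF this, of 2] show ?case by (simp add: shift_def)
    qed (rule assms(1))
  next
    case (Suc a)
    from assms(2)[OF this, of 1] show ?case by (simp add: shift_def)
  qed
  then show ?thesis by (cases \<alpha>) simp
qed

section \<open>Supports and test functions\<close>

definition supp :: "(real^2 \<Rightarrow> real) \<Rightarrow> (real^2) set" where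
  "supp f = closure {x. f x \<noteq> 0}"

lemma test_function_iff:
  "test_function D \<phi> \<longleftrightarrow> smooth \<phi> \<and> compact (supp \<phi>) \<and> supp \<phi> \<subseteq> D"
  by (auto simp: test_function_def smooth_def supp_def)

lemma not_in_supp: "x \<notin> supp f \<Longrightarrow> f x = 0"
  unfolding supp_def using closure_subset[of "{x. f x \<noteq> 0}"] by auto

lemma supp_subset_closed:
  assumes "closed K" "\<And>x. x \<notin> K \<Longrightarrow> f x = 0"
  shows "supp f \<subseteq> K"
  unfolding supp_def by (rule closure_minimal[OF _ assms(1)]) (use assms(2) in blast)

lemma compact_supp:
  assumes "compact K" "\<And>x. x \<notin> K \<Longrightarrow> f x = 0"
  shows "compact (supp f)"
proof -
  have "compact (K \<inter> supp f)" using assms(1) unfolding supp_def by (intro compact_Int_closed) auto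
  then show ?thesis
    using supp_subset_closed[OF compact_imp_closed[OF assms(1)] assms(2)] by (simp add: inf.absorb2)
qed

lemma supp_partial_subset: "supp (partial j f) \<subseteq> supp f"
proof -
  have "partial j f x = 0" if "x \<notin> supp f" for x
  proof -
    have "(f has_derivative (\<lambda>x. 0)) (at x)"
    proof (rule has_derivative_transform_within_open[OF has_derivative_const[of 0]])
      show "open (- supp f)" unfolding supp_def by (intro open_Compl closed_closure)
      show "x \<in> - supp f" using that by simp
      show "0 = f y" if "y \<in> - supp f" for y using that not_in_supp[of y f] by simp
    qed
    from frechet_derivative_at[OF this, symmetric] have "frechet_derivative f (at x) = (\<lambda>x. 0)" .
    then show ?thesis by (simp add: partial_def)
  qed
  then show ?thesis by (intro supp_subset_closed) (simp_all add: supp_def)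
qed

lemma test_function_partial:
  assumes "test_function D \<phi>"
  shows "test_function D (partial j \<phi>)"
proof -
  have "compact (supp (partial j \<phi>))"
  proof (rule compact_supp)
    show "compact (supp \<phi>)" using assms by (simp add: test_function_iff)
    show "partial j \<phi> x = 0" if "x \<notin> supp \<phi>" for x
      using that not_in_supp[of x "partial j \<phi>"] supp_partial_subset[of j \<phi>] by blast
  qed
  then show ?thesis
    using assms smooth_partial supp_partial_subset[of j \<phi>] unfolding test_function_iff by blast
qed

lemma test_function_multi_partial: "test_function D \<phi> \<Longrightarrow> test_function D (multi_partial \<alpha> \<phi>)"
proof (induction \<alpha> rule: shift_induct)
  case (shift j \<alpha>)
  then have "test_function D (partial j (multi_partial \<alpha> \<phi>))"
    by (intro test_function_partial)
  then show ?case
    using partial_multi_partial[of \<phi> j \<alpha>] shift.prems by (simp add: test_function_iff)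
qed simp

lemma test_function_mono: "test_function D \<phi> \<Longrightarrow> D \<subseteq> D' \<Longrightarrow> test_function D' \<phi>"
  by (auto simp: test_function_def)

lemma test_function_zero: "test_function D \<phi> \<Longrightarrow> x \<notin> D \<Longrightarrow> \<phi> x = 0"
  using not_in_supp by (auto simp: test_function_iff)

lemma test_function_continuous: "test_function D \<phi> \<Longrightarrow> continuous_on A \<phi>"
  by (simp add: smooth_continuous test_function_iff)

lemma test_function_bounded:
  assumes "test_function D \<phi>"
  obtains B where "B \<ge> 0" "\<And>x. \<bar>\<phi> x\<bar> \<le> B"
proof -
  have "bounded (\<phi> ` supp \<phi>)"
    using assms compact_continuous_image compact_imp_bounded test_function_continuous
    by (metis test_function_iff)
  then obtain B where B: "\<And>x. x \<in> supp \<phi> \<Longrightarrow> \<bar>\<phi> x\<bar> \<le> B"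
    by (auto simp: bounded_iff)
  have "\<bar>\<phi> x\<bar> \<le> max B 0" for x
    using B[of x] not_in_supp[of x \<phi>] by (cases "x \<in> supp \<phi>") auto
  then show ?thesis using that[of "max B 0"] by auto
qed

section \<open>Smooth bump functions\<close>

lemma partial_eqI:
  assumes "\<And>x. (f has_derivative f' x) (at x)"
  shows "partial j f = (\<lambda>x. f' x (axis j 1))"
  unfolding partial_def using frechet_derivative_at[OF assms, symmetric] by simp

text \<open>\<open>F a b\<close> is the candidate for the derivative of order (a, b). Since
  \<open>multi_partial\<close> differentiates in direction 2 first, the rule for that direction is
  asked for only in the row a = 0.\<close>

lemma smoothI:
  assumes "F 0 0 = f" and "\<And>a b. F a b differentiable_on UNIV"
    and "\<And>a b. partial 1 (F a b) = F (Suc a) b" and "\<And>b. partial 2 (F 0 b) = F 0 (Suc b)"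
  shows "smooth f" "multi_partial (a, b) f = F a b"
proof -
  have b: "(partial 2 ^^ b) f = F 0 b" for b
    by (induction b) (simp_all add: assms(1,4))
  have m: "multi_partial (a, b) f = F a b" for a b
  proof (induction a)
    case 0
    show ?case by (simp add: multi_partial_def b)
  next
    case (Suc a)
    then show ?case by (simp add: multi_partial_Suc_left assms(3))
  qed
  then show "multi_partial (a, b) f = F a b" .
  show "smooth f"
    unfolding smooth_def using m assms(2) by auto
qed

lemma axis_1_nth [simp]: "axis (1::2) (1::real) $ 1 = 1" "axis (1::2) (1::real) $ 2 = 0"
  "axis (2::2) (1::real) $ 1 = 0" "axis (2::2) (1::real) $ 2 = 1"
  by (auto simp: axis_def)

text \<open>A sequence in which each member is the derivative of the preceding one encodes a smooth
  function of one variable. This form is preserved by products, see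
  \<open>Leibniz_derivative_sequence\<close>.\<close>

lemma smooth_tensor:
  fixes F G :: "nat \<Rightarrow> real \<Rightarrow> real"
  assumes F: "\<And>n t. (F n has_real_derivative F (Suc n) t) (at t)"
    and G: "\<And>n t. (G n has_real_derivative G (Suc n) t) (at t)"
  shows "smooth (\<lambda>x. F 0 (x $ 1) * G 0 (x $ 2))"
proof -
  have c: "((\<lambda>x. H n (x $ i)) has_derivative (\<lambda>h. H (Suc n) (x $ i) * h $ i)) (at x)"
    if H: "\<And>n t. (H n has_real_derivative H (Suc n) t) (at t)"
    for H :: "nat \<Rightarrow> real \<Rightarrow> real" and n and i :: 2 and x :: "real^2"
  proof -
    have "((\<lambda>x. x $ i) has_derivative (\<lambda>h. h $ i)) (at x)"
      by (rule bounded_linear.has_derivative[OF bounded_linear_vec_nth has_derivative_ident])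
    from has_derivative_compose[OF this H[of n "x $ i", unfolded has_field_derivative_def]]
    show ?thesis by simp
  qed
  have d: "((\<lambda>x. F a (x $ 1) * G b (x $ 2)) has_derivative
      (\<lambda>h. F a (x $ 1) * (G (Suc b) (x $ 2) * h $ 2) + F (Suc a) (x $ 1) * h $ 1 * G b (x $ 2))) (at x)"
    for a b and x :: "real^2"
    by (rule has_derivative_mult[OF c[of F, OF F] c[of G, OF G]])
  show ?thesis
  proof (rule smoothI(1)[where F="\<lambda>a b x. F a (x $ 1) * G b (x $ 2)"])
    show "(\<lambda>x::real^2. F a (x $ 1) * G b (x $ 2)) differentiable_on UNIV" for a b
      unfolding differentiable_on_def differentiable_def using d by fast
  qed (simp_all add: partial_eqI[OF d])
qed

text \<open>Pascal's rule merges the two shifted sums, so the Leibniz sums form a derivative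
  sequence again.\<close>

lemma Leibniz_derivative_sequence:
  fixes F G :: "nat \<Rightarrow> real \<Rightarrow> real"
  assumes F: "\<And>n t. (F n has_real_derivative F (Suc n) t) (at t)"
    and G: "\<And>n t. (G n has_real_derivative G (Suc n) t) (at t)"
  shows "((\<lambda>t. \<Sum>k\<le>n. of_nat (n choose k) * F k t * G (n - k) t) has_real_derivative
          (\<Sum>k\<le>Suc n. of_nat (Suc n choose k) * F k t * G (Suc n - k) t)) (at t)"
proof -
  have "((\<lambda>t. \<Sum>k\<le>n. of_nat (n choose k) * F k t * G (n - k) t) has_real_derivative
      (\<Sum>k\<le>n. of_nat (n choose k) * (F (Suc k) t * G (n - k) t + F k t * G (Suc n - k) t))) (at t)"
    by (rule DERIV_sum) (auto intro!: derivative_eq_intros F G simp: Suc_diff_le algebra_simps)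
  also have "(\<Sum>k\<le>n. of_nat (n choose k) * (F (Suc k) t * G (n - k) t + F k t * G (Suc n - k) t))
      = (\<Sum>k\<le>n. of_nat (n choose k) * F (Suc k) t * G (n - k) t)
        + (\<Sum>k\<le>n. of_nat (n choose k) * F k t * G (Suc n - k) t)"
    by (simp add: sum.distrib algebra_simps)
  also have "(\<Sum>k\<le>n. of_nat (n choose k) * F k t * G (Suc n - k) t)
      = F 0 t * G (Suc n) t + (\<Sum>k\<le>n. of_nat (n choose Suc k) * F (Suc k) t * G (n - k) t)"
  proof -
    have "(\<Sum>k\<le>n. of_nat (n choose k) * F k t * G (Suc n - k) t)
      = (\<Sum>k\<le>Suc n. of_nat (n choose k) * F k t * G (Suc n - k) t)" by simp
    also have "\<dots> = F 0 t * G (Suc n) t + (\<Sum>k\<le>n. of_nat (n choose Suc k) * F (Suc k) t * G (n - k) t)"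
      unfolding sum.atMost_Suc_shift by simp
    finally show ?thesis .
  qed
  also have "(\<Sum>k\<le>n. of_nat (n choose k) * F (Suc k) t * G (n - k) t)
        + (F 0 t * G (Suc n) t + (\<Sum>k\<le>n. of_nat (n choose Suc k) * F (Suc k) t * G (n - k) t))
      = (\<Sum>k\<le>Suc n. of_nat (Suc n choose k) * F k t * G (Suc n - k) t)"
    unfolding sum.atMost_Suc_shift by (simp add: sum.distrib algebra_simps)
  finally show ?thesis .
qed

text \<open>These functions form a class that is closed under differentiation and contains \<open>exp (- 1 / s)\<close>,
  continued by \<open>0\<close> to \<open>s \<le> 0\<close>.\<close>

definition flat :: "real poly \<Rightarrow> real \<Rightarrow> real" where
  "flat p s = (if s > 0 then poly p (inverse s) * exp (- inverse s) else 0)"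

lemma poly_times_exp_tendsto_0: "((\<lambda>u::real. poly p u * exp (- u)) \<longlongrightarrow> 0) at_top"
proof (induction p)
  case 0
  then show ?case by simp
next
  case (pCons a p)
  have *: "((\<lambda>u::real. (\<Sum>i\<le>degree q. coeff q i * (u ^ i / exp u))) \<longlongrightarrow> 0) at_top" for q
    by (intro tendsto_null_sum tendsto_mult_right_zero tendsto_power_div_exp_0)
  show ?case
    using *[of "pCons a p"]
    by (simp add: poly_altdef exp_minus sum_distrib_right divide_inverse mult.assoc)
qed

text \<open>With u = 1/s one has d/ds = - u^2 d/du, and the u-derivative of p(u) exp(-u) is (p' -
  p)(u) exp(-u).\<close>

definition flat_deriv :: "real poly \<Rightarrow> real poly" where
  "flat_deriv p = [:0, 0, 1:] * (p - pderiv p)"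

lemma flat_tendsto_0: "(flat p \<longlongrightarrow> 0) (at_right 0)"
proof -
  have "((\<lambda>s. poly p (inverse s) * exp (- inverse s)) \<longlongrightarrow> 0) (at_right 0)"
    by (rule filterlim_compose[OF poly_times_exp_tendsto_0 filterlim_inverse_at_top_right])
  then show ?thesis
    by (rule Lim_transform_eventually)
       (auto simp: flat_def eventually_at_right_field intro: exI[of _ 1])
qed

lemma has_real_derivative_flat: "(flat p has_real_derivative flat (flat_deriv p) s) (at s)"
proof -
  consider "s > 0" | "s < 0" | "s = 0" by linarith
  then show ?thesis
  proof cases
    case 1
    have "((\<lambda>s. poly p (inverse s) * exp (- inverse s)) has_real_derivative flat (flat_deriv p) s) (at s)"
      using 1 by (auto intro!: derivative_eq_intros DERIV_chain2[OF poly_DERIV]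
          simp: flat_def flat_deriv_def power2_eq_square algebra_simps)
    then show ?thesis
      by (rule has_field_derivative_transform_within_open[where S="{0<..}"])
         (use 1 in \<open>auto simp: flat_def\<close>)
  next
    case 2
    have "((\<lambda>s. 0) has_real_derivative flat (flat_deriv p) s) (at s)"
      using 2 by (simp add: flat_def)
    then show ?thesis
      by (rule has_field_derivative_transform_within_open[where S="{..<0}"])
         (use 2 in \<open>auto simp: flat_def\<close>)
  next
    case 3
    \<comment> \<open>Division by h multiplies the polynomial by its variable 1/h, so the right
      difference quotient at 0 belongs to the same class and tends to 0.\<close>
    have "((\<lambda>h. flat p h / h) \<longlongrightarrow> 0) (at_right 0)"
      by (rule Lim_transform_eventually[OF flat_tendsto_0[of "pCons 0 p"]])
         (auto simp: flat_def eventually_at_right_field divide_inverse mult_ac intro: exI[of _ 1])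
    moreover have "((\<lambda>h. flat p h / h) \<longlongrightarrow> 0) (at_left 0)"
      by (rule tendsto_eventually)
         (auto simp: flat_def eventually_at_left_field intro: exI[of _ "-1"])
    ultimately have "((\<lambda>h. flat p h / h) \<longlongrightarrow> 0) (at 0)"
      by (simp add: filterlim_split_at)
    moreover have "flat p 0 = 0" "flat (flat_deriv p) 0 = 0" by (simp_all add: flat_def)
    ultimately show ?thesis
      using 3 by (simp add: DERIV_def)
  qed
qed

text \<open>Tensor product of the function flat 1 (1 - t) * flat 1 (1 + t), which is positive
  exactly for |t| < 1. The l1 norm dominates the Euclidean one, so outside the ball of radius 2 one
  coordinate has modulus at least 1.\<close>

lemma smooth_bump:
  obtains \<eta> :: "real^2 \<Rightarrow> real" where "smooth \<eta>" "\<And>x. 0 \<le> \<eta> x" "\<eta> 0 > 0"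
    "\<And>x. 2 \<le> norm x \<Longrightarrow> \<eta> x = 0"
proof -
  define A where "A n = flat ((flat_deriv ^^ n) 1)" for n
  have A: "(A n has_real_derivative A (Suc n) t) (at t)" for n t
    unfolding A_def using has_real_derivative_flat by simp
  define F where "F n t = (-1) ^ n * A n (1 - t)" for n t
  define G where "G n t = A n (1 + t)" for n t
  have F: "(F n has_real_derivative F (Suc n) t) (at t)" for n t
    unfolding F_def by (auto intro!: derivative_eq_intros DERIV_chain2[OF A])
  have G: "(G n has_real_derivative G (Suc n) t) (at t)" for n t
    unfolding G_def using DERIV_shift[of "A n" "A (Suc n) (1 + t)" t 1] A[of n "1 + t"]
    by (simp add: add.commute)
  define \<Psi> where "\<Psi> n t = (\<Sum>k\<le>n. of_nat (n choose k) * F k t * G (n - k) t)" for n t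
  have \<Psi>: "(\<Psi> n has_real_derivative \<Psi> (Suc n) t) (at t)" for n t
    unfolding \<Psi>_def using Leibniz_derivative_sequence[of F G, OF F G] by simp
  have \<Psi>0: "\<Psi> 0 t = flat 1 (1 - t) * flat 1 (1 + t)" for t
    by (simp add: \<Psi>_def F_def G_def A_def)
  have pos: "0 \<le> \<Psi> 0 t" "0 < \<Psi> 0 0" "1 \<le> \<bar>t\<bar> \<Longrightarrow> \<Psi> 0 t = 0" for t
    by (auto simp: \<Psi>0 flat_def)
  show ?thesis
  proof (rule that[of "\<lambda>x. \<Psi> 0 (x $ 1) * \<Psi> 0 (x $ 2)"])
    show "smooth (\<lambda>x. \<Psi> 0 (x $ 1) * \<Psi> 0 (x $ 2))"
      by (rule smooth_tensor[of \<Psi> \<Psi>, OF \<Psi> \<Psi>])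
    show "\<Psi> 0 (x $ 1) * \<Psi> 0 (x $ 2) = 0" if "2 \<le> norm x" for x :: "real^2"
    proof -
      have "norm x \<le> \<bar>x $ 1\<bar> + \<bar>x $ 2\<bar>"
        using norm_le_l1_cart[of x] by (simp add: sum_2)
      with that have "1 \<le> \<bar>x $ 1\<bar> \<or> 1 \<le> \<bar>x $ 2\<bar>" by linarith
      then show ?thesis using pos by auto
    qed
  qed (use pos in \<open>auto intro: mult_nonneg_nonneg mult_pos_pos\<close>)
qed

section \<open>Smoothness under affine substitution and scaling\<close>

lemma partial_affine:
  assumes "f differentiable_on UNIV"
  shows "partial j (\<lambda>x. f (c + k *\<^sub>R x)) = (\<lambda>x. k * partial j f (c + k *\<^sub>R x))"
    and "(\<lambda>x. f (c + k *\<^sub>R x)) differentiable_on UNIV"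
proof -
  have d: "((\<lambda>x. f (c + k *\<^sub>R x)) has_derivative
      (\<lambda>h. frechet_derivative f (at (c + k *\<^sub>R x)) (k *\<^sub>R h))) (at x)" for x
    by (rule has_derivative_compose[OF _ has_derivative_partial[OF assms]])
       (auto intro!: derivative_eq_intros)
  show "partial j (\<lambda>x. f (c + k *\<^sub>R x)) = (\<lambda>x. k * partial j f (c + k *\<^sub>R x))"
    unfolding partial_eqI[OF d]
    using linear_cmul[OF has_derivative_linear[OF has_derivative_partial[OF assms]]]
    by (simp add: partial_def)
  show "(\<lambda>x. f (c + k *\<^sub>R x)) differentiable_on UNIV"
    unfolding differentiable_on_def differentiable_def using d by fast
qed

lemma partial_cmult:
  assumes "f differentiable_on UNIV"
  shows "partial j (\<lambda>x. k * f x) = (\<lambda>x. k * partial j f x)"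
    and "(\<lambda>x. k * f x) differentiable_on UNIV"
proof -
  have d: "((\<lambda>x. k * f x) has_derivative
      (\<lambda>h. k * frechet_derivative f (at x) h)) (at x)" for x
    by (intro has_derivative_mult_right has_derivative_partial[OF assms])
  show "partial j (\<lambda>x. k * f x) = (\<lambda>x. k * partial j f x)"
    unfolding partial_eqI[OF d] by (simp add: partial_def)
  show "(\<lambda>x. k * f x) differentiable_on UNIV"
    unfolding differentiable_on_def differentiable_def using d by fast
qed

lemma smooth_affine:
  assumes "smooth f"
  shows "smooth (\<lambda>x. f (c + k *\<^sub>R x))"
proof (rule smoothI(1)[where F="\<lambda>a b x. k ^ (a + b) * multi_partial (a, b) f (c + k *\<^sub>R x)"])
  have d: "(\<lambda>x. multi_partial \<alpha> f (c + k *\<^sub>R x)) differentiable_on UNIV" for \<alpha>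
    by (intro partial_affine(2) smooth_differentiable smooth_multi_partial assms)
  show "(\<lambda>x. k ^ (a + b) * multi_partial (a, b) f (c + k *\<^sub>R x)) differentiable_on UNIV" for a b
    by (rule partial_cmult(2)[OF d])
  have "partial j (\<lambda>x. k ^ (a + b) * multi_partial (a, b) f (c + k *\<^sub>R x))
      = (\<lambda>x. k ^ (Suc (a + b)) * multi_partial (shift j (a, b)) f (c + k *\<^sub>R x))" for j a b
    unfolding partial_cmult(1)[OF d]
    using partial_affine(1)[OF smooth_differentiable[OF smooth_multi_partial[OF assms]], of j "(a, b)" c k]
    by (simp add: partial_multi_partial[OF assms] mult_ac)
  from this[of 1] this[of 2 0] show
    "partial 1 (\<lambda>x. k ^ (a + b) * multi_partial (a, b) f (c + k *\<^sub>R x))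
       = (\<lambda>x. k ^ (Suc a + b) * multi_partial (Suc a, b) f (c + k *\<^sub>R x))"
    "partial 2 (\<lambda>x. k ^ (0 + b) * multi_partial (0, b) f (c + k *\<^sub>R x))
       = (\<lambda>x. k ^ (0 + Suc b) * multi_partial (0, Suc b) f (c + k *\<^sub>R x))" for a b
    by (simp_all add: shift_def)
qed simp

lemma smooth_cmult:
  assumes "smooth f"
  shows "smooth (\<lambda>x. k * f x)"
proof (rule smoothI(1)[where F="\<lambda>a b x. k * multi_partial (a, b) f x"])
  have d: "multi_partial \<alpha> f differentiable_on UNIV" for \<alpha>
    using assms unfolding smooth_def by blast
  show "(\<lambda>x. k * multi_partial (a, b) f x) differentiable_on UNIV" for a b
    by (rule partial_cmult(2)[OF d])
  have "partial j (\<lambda>x. k * multi_partial (a, b) f x) = (\<lambda>x. k * multi_partial (shift j (a, b)) f x)"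
    for j a b
    unfolding partial_cmult(1)[OF d] partial_multi_partial[OF assms] ..
  from this[of 1] this[of 2 0] show
    "partial 1 (\<lambda>x. k * multi_partial (a, b) f x) = (\<lambda>x. k * multi_partial (Suc a, b) f x)"
    "partial 2 (\<lambda>x. k * multi_partial (0, b) f x) = (\<lambda>x. k * multi_partial (0, Suc b) f x)" for a b
    by (simp_all add: shift_def)
qed simp

section \<open>Integration by parts and approximation in the mean\<close>

lemma vanish_outside_compact:
  fixes h :: "'a::euclidean_space \<Rightarrow> real"
  assumes "continuous_on UNIV h" "\<And>x. R < norm x \<Longrightarrow> h x = 0"
  obtains B where "B \<ge> 0" "\<And>x. \<bar>h x\<bar> \<le> B * indicator (cball 0 R) x"
proof -
  have "bounded (h ` cball 0 R)"
    using assms(1) by (meson compact_cball compact_continuous_image compact_imp_bounded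
        continuous_on_subset top_greatest)
  then obtain B where B: "\<And>x. x \<in> cball 0 R \<Longrightarrow> \<bar>h x\<bar> \<le> B"
    by (metis bounded_iff image_eqI real_norm_def)
  have "\<bar>h x\<bar> \<le> max B 0 * indicator (cball 0 R) x" for x
    using B[of x] assms(2)[of x] by (cases "x \<in> cball 0 R") auto
  then show ?thesis using that[of "max B 0"] by auto
qed

lemma integrable_vanish_outside_compact:
  fixes h :: "'a::euclidean_space \<Rightarrow> real"
  assumes "continuous_on UNIV h" "\<And>x. R < norm x \<Longrightarrow> h x = 0"
  shows "integrable lborel h"
proof -
  have "integrable lborel (\<lambda>x. indicator (cball 0 R) x *\<^sub>R h x)"
    using assms(1) by (intro borel_integrable_compact) (auto intro: continuous_on_subset)
  also have "(\<lambda>x. indicator (cball 0 R) x *\<^sub>R h x) = h"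
    using assms(2) by (auto simp: indicator_def fun_eq_iff)
  finally show ?thesis .
qed

lemma supp_bounded:
  assumes "compact (supp h)"
  obtains R where "R \<ge> 0" "\<And>x. R < norm x \<Longrightarrow> h x = 0" "\<And>x. R < norm x \<Longrightarrow> partial j h x = 0"
proof -
  obtain R where R: "\<And>x. x \<in> supp h \<Longrightarrow> norm x \<le> R"
    using compact_imp_bounded[OF assms] by (auto simp: bounded_iff)
  show ?thesis
  proof (rule that[of "max R 0"])
    fix x :: "real^2" assume "max R 0 < norm x"
    then have "x \<notin> supp h" using R[of x] by auto
    then show "h x = 0" "partial j h x = 0"
      using not_in_supp supp_partial_subset[of j h] by blast+
  qed simp
qed

lemma emeasure_cball_finite [simp]: "emeasure lborel (cball c r :: 'a::euclidean_space set) < top"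
  using emeasure_bounded_finite[OF bounded_cball, of c r] by simp

lemma lborel_translation:
  fixes f :: "'a::euclidean_space \<Rightarrow> real"
  assumes "f \<in> borel_measurable borel"
  shows "(LINT x|lborel. f (x + c)) = (LINT x|lborel. f x)"
  using integral_distr[of "(+) c" lborel borel f] assms
  by (simp add: lborel_distr_plus add.commute)

lemma partial_line:
  assumes "h differentiable_on UNIV"
  shows "((\<lambda>t. h (x + t *\<^sub>R axis j 1)) has_real_derivative partial j h (x + t *\<^sub>R axis j 1)) (at t)"
proof -
  have "((\<lambda>t. h (x + t *\<^sub>R axis j 1)) has_derivative
      (\<lambda>s. frechet_derivative h (at (x + t *\<^sub>R axis j 1)) (s *\<^sub>R axis j 1))) (at t)"
    by (rule has_derivative_compose[OF _ has_derivative_partial[OF assms], where f="\<lambda>t. x + t *\<^sub>R axis j 1"])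
       (auto intro!: derivative_eq_intros)
  then show ?thesis
    unfolding has_field_derivative_def partial_def
    by (rule has_derivative_eq_rhs)
       (use linear_cmul[OF has_derivative_linear[OF has_derivative_partial[OF assms]]] in
         \<open>simp add: fun_eq_iff\<close>)
qed

text \<open>Each difference quotient has integral 0 by translation invariance. The quotients
  converge to the derivative, and by the mean value theorem they are dominated by a constant on a
  ball, enlarged by 1 to make room for the shift.\<close>

lemma integral_partial_eq_0:
  assumes d: "h differentiable_on UNIV" and c: "continuous_on UNIV (partial j h)"
    and supp: "compact (supp h)"
  shows "(LINT x|lborel. partial j h x) = 0"
proof -
  obtain R where R: "R \<ge> 0" "\<And>x. R < norm x \<Longrightarrow> h x = 0" "\<And>x. R < norm x \<Longrightarrow> partial j h x = 0"
    using supp_bounded[OF supp] by blast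
  obtain B where B: "B \<ge> 0" "\<And>x. \<bar>partial j h x\<bar> \<le> B * indicator (cball 0 R) x"
    using vanish_outside_compact[OF c R(3)] by blast
  have B': "\<bar>partial j h x\<bar> \<le> B" for x
    using B(1) B(2)[of x] by (cases "norm x \<le> R") auto
  have hc: "continuous_on UNIV h" using d by (rule differentiable_imp_continuous_on)
  have hi: "integrable lborel h" by (rule integrable_vanish_outside_compact[OF hc R(2)])
  have hm [measurable]: "h \<in> borel_measurable borel"
    using hc by (rule borel_measurable_continuous_onI)
  define t :: "nat \<Rightarrow> real" where "t n = 1 / Suc n" for n
  have t: "t n > 0" "t n \<le> 1" for n by (auto simp: t_def)
  define q where "q n x = (h (x + t n *\<^sub>R axis j 1) - h x) / t n" for n x
  have "(LINT x|lborel. q n x) = 0" for n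
  proof -
    have "integrable lborel (\<lambda>x. h (x + t n *\<^sub>R axis j 1))"
    proof (rule integrable_vanish_outside_compact)
      show "continuous_on UNIV (\<lambda>x. h (x + t n *\<^sub>R axis j 1))"
        by (intro continuous_on_compose2[OF hc] continuous_intros) auto
      show "h (x + t n *\<^sub>R axis j 1) = 0" if "R + 1 < norm x" for x
      proof (rule R(2))
        have "norm (t n *\<^sub>R (axis j 1 :: real^2)) \<le> 1" using t[of n] by simp
        with that norm_triangle_ineq4[of "x + t n *\<^sub>R axis j 1" "t n *\<^sub>R axis j 1"]
        show "R < norm (x + t n *\<^sub>R axis j 1)" by simp
      qed
    qed
    then show ?thesis
      using hi lborel_translation[OF hm, of "t n *\<^sub>R axis j 1"] by (simp add: q_def)
  qed
  moreover have "(\<lambda>n. LINT x|lborel. q n x) \<longlonglongrightarrow> (LINT x|lborel. partial j h x)"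
  proof (rule integral_dominated_convergence[where w="\<lambda>x. B * indicator (cball 0 (R + 1)) x"])
    show "partial j h \<in> borel_measurable lborel"
      using c by (simp add: borel_measurable_continuous_onI)
    show "q n \<in> borel_measurable lborel" for n
      unfolding q_def by measurable
    show "AE x in lborel. (\<lambda>n. q n x) \<longlonglongrightarrow> partial j h x"
    proof (rule AE_I2)
      fix x
      have "((\<lambda>s. (h (x + s *\<^sub>R axis j 1) - h x) / s) \<longlongrightarrow> partial j h x) (at 0)"
        using partial_line[OF d, of x j 0] by (simp add: DERIV_def)
      moreover have "filterlim t (at 0) sequentially"
        unfolding filterlim_at using t(1) LIMSEQ_inverse_real_of_nat
        by (auto simp: t_def[abs_def] inverse_eq_divide less_imp_neq[symmetric])
      ultimately show "(\<lambda>n. q n x) \<longlonglongrightarrow> partial j h x"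
        unfolding q_def by (rule filterlim_compose)
    qed
    show "AE x in lborel. norm (q n x) \<le> B * indicator (cball 0 (R + 1)) x" for n
    proof (rule AE_I2)
      fix x
      have "\<exists>s>0. s < t n \<and> h (x + t n *\<^sub>R axis j 1) - h (x + 0 *\<^sub>R axis j 1)
          = (t n - 0) * partial j h (x + s *\<^sub>R axis j 1)"
        by (rule MVT2[OF t(1)]) (rule partial_line[OF d])
      then obtain s where s: "0 < s" "s < t n" and eq: "h (x + t n *\<^sub>R axis j 1) - h (x + 0 *\<^sub>R axis j 1)
          = (t n - 0) * partial j h (x + s *\<^sub>R axis j 1)" by blast
      have "q n x = partial j h (x + s *\<^sub>R axis j 1)"
        using eq t(1)[of n] by (simp add: q_def)
      moreover have "partial j h (x + s *\<^sub>R axis j 1) = 0" if "norm x > R + 1"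
      proof (rule R(3))
        have "norm (s *\<^sub>R (axis j 1 :: real^2)) \<le> 1" using s t[of n] by simp
        with that norm_triangle_ineq4[of "x + s *\<^sub>R axis j 1" "s *\<^sub>R axis j 1"]
        show "R < norm (x + s *\<^sub>R axis j 1)" by simp
      qed
      ultimately show "norm (q n x) \<le> B * indicator (cball 0 (R + 1)) x"
        using B'[of "x + s *\<^sub>R axis j 1"] by (auto simp: indicator_def)
    qed
    show "integrable lborel (\<lambda>x. B * indicator (cball 0 (R + 1)) x)"
      by (intro integrable_mult_right integrable_real_indicator) auto
  qed
  ultimately show ?thesis by (simp add: LIMSEQ_const_iff)
qed

lemma partial_mult:
  assumes "f differentiable_on UNIV" "g differentiable_on UNIV"
  shows "partial j (\<lambda>x. f x * g x) = (\<lambda>x. f x * partial j g x + partial j f x * g x)"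
    and "(\<lambda>x. f x * g x) differentiable_on UNIV"
proof -
  have d: "((\<lambda>x. f x * g x) has_derivative
      (\<lambda>h. f x * frechet_derivative g (at x) h + frechet_derivative f (at x) h * g x)) (at x)" for x
    by (intro has_derivative_mult has_derivative_partial assms)
  show "partial j (\<lambda>x. f x * g x) = (\<lambda>x. f x * partial j g x + partial j f x * g x)"
    unfolding partial_eqI[OF d] by (simp add: partial_def)
  show "(\<lambda>x. f x * g x) differentiable_on UNIV"
    unfolding differentiable_on_def differentiable_def using d by fast
qed

lemma integrable_mult_test_function:
  assumes "continuous_on UNIV f" "test_function D \<phi>"
  shows "integrable lborel (\<lambda>x. f x * \<phi> x)"
proof -
  obtain R where "\<And>x. R < norm x \<Longrightarrow> \<phi> x = 0"
    using supp_bounded assms(2) unfolding test_function_iff by metis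
  then show ?thesis
    by (intro integrable_vanish_outside_compact[where R=R] continuous_intros assms(1)
          test_function_continuous[OF assms(2)]) auto
qed

lemma integration_by_parts:
  assumes f: "f differentiable_on UNIV" "continuous_on UNIV (partial j f)" and \<phi>: "test_function D \<phi>"
  shows "(LINT x|lborel. f x * partial j \<phi> x) = - (LINT x|lborel. partial j f x * \<phi> x)"
proof -
  have d: "\<phi> differentiable_on UNIV" and c: "continuous_on UNIV (partial j \<phi>)"
    using \<phi> test_function_partial[OF \<phi>, of j] smooth_differentiable test_function_continuous
    by (auto simp: test_function_iff)
  have fc: "continuous_on UNIV f" using f(1) by (rule differentiable_imp_continuous_on)
  have pc: "continuous_on UNIV \<phi>" using d by (rule differentiable_imp_continuous_on)
  have s: "compact (supp (\<lambda>x. f x * \<phi> x))"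
  proof (rule compact_supp)
    show "compact (supp \<phi>)" using \<phi> by (simp add: test_function_iff)
    show "f x * \<phi> x = 0" if "x \<notin> supp \<phi>" for x using not_in_supp[OF that] by simp
  qed
  have "(LINT x|lborel. f x * partial j \<phi> x + partial j f x * \<phi> x) = 0"
    using integral_partial_eq_0[OF partial_mult(2)[OF f(1) d] _ s, of j] f(2) c fc pc
    unfolding partial_mult(1)[OF f(1) d] by (simp add: continuous_intros)
  then show ?thesis
    using integrable_mult_test_function[OF fc test_function_partial[OF \<phi>]]
      integrable_mult_test_function[OF f(2) \<phi>] by simp
qed

text \<open>Two dominated limits: truncations approximate f, and continuous functions with almost
  everywhere convergence approximate a truncation once they are cut off by the same bound.\<close>

lemma L1_dense_continuous:
  fixes f :: "real^2 \<Rightarrow> real"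
  assumes f: "integrable lborel f" and e: "e > 0"
  obtains g R where "continuous_on UNIV g" "\<And>x. R < norm x \<Longrightarrow> g x = 0"
    "(LINT x|lborel. \<bar>f x - g x\<bar>) < e"
proof -
  have fm [measurable]: "f \<in> borel_measurable borel" using f by auto
  define F where "F m x = indicator (cball 0 (real m)) x * max (- real m) (min (real m) (f x))" for m x
  have Fm [measurable]: "F m \<in> borel_measurable borel" for m
    unfolding F_def by (intro borel_measurable_times borel_measurable_indicator borel_measurable_max
        borel_measurable_min) auto
  have "(\<lambda>m. LINT x|lborel. \<bar>f x - F m x\<bar>) \<longlonglongrightarrow> (LINT x|(lborel :: (real^2) measure). 0)"
  proof (rule integral_dominated_convergence[where w="\<lambda>x. \<bar>f x\<bar>"])
    show "AE x in lborel. (\<lambda>m. \<bar>f x - F m x\<bar>) \<longlonglongrightarrow> 0"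
    proof (rule AE_I2)
      fix x
      obtain M where M: "norm x \<le> real M" "\<bar>f x\<bar> \<le> real M"
        using real_arch_simple[of "max (norm x) \<bar>f x\<bar>"] by auto
      have "\<forall>\<^sub>F m in sequentially. 0 = \<bar>f x - F m x\<bar>"
        unfolding eventually_sequentially
      proof (intro exI[of _ M] allI impI)
        fix m assume "M \<le> m"
        with M have "norm x \<le> real m" "\<bar>f x\<bar> \<le> real m" by linarith+
        then show "0 = \<bar>f x - F m x\<bar>" unfolding F_def by (auto simp: indicator_def min_def max_def)
      qed
      then show "(\<lambda>m. \<bar>f x - F m x\<bar>) \<longlonglongrightarrow> 0"
        by (rule Lim_transform_eventually[OF tendsto_const])
    qed
    show "AE x in lborel. norm \<bar>f x - F m x\<bar> \<le> \<bar>f x\<bar>" for m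
      by (rule AE_I2) (auto simp: F_def indicator_def max_def min_def)
  qed (use f in auto)
  then have "\<forall>\<^sub>F m in sequentially. (LINT x|lborel. \<bar>f x - F m x\<bar>) < e / 2"
    using e by (intro order_tendstoD(2)) auto
  then obtain m where m: "(LINT x|lborel. \<bar>f x - F m x\<bar>) < e / 2"
    using eventually_happens'[OF sequentially_bot] by blast
  have Fi: "integrable lborel (F m)"
    by (rule Bochner_Integration.integrable_bound[OF f])
       (auto simp: F_def indicator_def max_def min_def)
  have "F m measurable_on UNIV"
    by (rule lebesgue_measurable_imp_measurable_on_real) (auto intro: measurable_completion)
  then obtain N g where N: "negligible N" and gc: "\<And>n. continuous_on UNIV (g n)"
    and gl: "\<And>x. x \<notin> N \<Longrightarrow> (\<lambda>n. g n x) \<longlonglongrightarrow> F m x"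
    unfolding measurable_on_def by auto
  \<comment> \<open>A continuous substitute for the indicator of the ball of radius m: it is 1 on
    that ball, where \<open>F m\<close> lives, and 0 from radius m + 1 on.\<close>
  define cut where "cut x = max 0 (min 1 (real m + 1 - norm x))" for x :: "real^2"
  define h where "h n x = max (- real m) (min (real m) (g n x)) * cut x" for n x
  have hc: "continuous_on UNIV (h n)" for n
    unfolding h_def cut_def by (intro continuous_intros gc)
  have h0: "h n x = 0" if "real m + 1 < norm x" for n x
    using that by (simp add: h_def cut_def)
  have hb: "\<bar>h n x\<bar> \<le> real m * indicator (cball 0 (real m + 1)) x" for n x
  proof (cases "norm x \<le> real m + 1")
    case True
    have "\<bar>max (- real m) (min (real m) (g n x))\<bar> \<le> real m" by auto
    moreover have "\<bar>cut x\<bar> \<le> 1" by (auto simp: cut_def)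
    ultimately have "\<bar>h n x\<bar> \<le> real m * 1"
      unfolding h_def abs_mult by (intro mult_mono) auto
    with True show ?thesis by (simp add: indicator_def)
  qed (use h0 in auto)
  have "(\<lambda>n. LINT x|lborel. \<bar>F m x - h n x\<bar>) \<longlonglongrightarrow> (LINT x|(lborel :: (real^2) measure). 0)"
  proof (rule integral_dominated_convergence[where w="\<lambda>x. \<bar>F m x\<bar> + real m * indicator (cball 0 (real m + 1)) x"])
    have "(\<lambda>n. \<bar>F m x - h n x\<bar>) \<longlonglongrightarrow> 0" if "x \<notin> N" for x
    proof -
      have "(\<lambda>n. h n x) \<longlonglongrightarrow> max (- real m) (min (real m) (F m x)) * cut x"
        unfolding h_def by (intro tendsto_intros gl that)
      also have "max (- real m) (min (real m) (F m x)) * cut x = F m x"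
        by (auto simp: F_def cut_def indicator_def max_def min_def)
      finally have "(\<lambda>n. \<bar>F m x - h n x\<bar>) \<longlonglongrightarrow> \<bar>F m x - F m x\<bar>"
        by (intro tendsto_intros)
      then show ?thesis by simp
    qed
    moreover have "AE x in lebesgue. x \<notin> N"
      using N by (simp add: negligible_iff_null_sets AE_not_in)
    ultimately have "AE x in lebesgue. (\<lambda>n. \<bar>F m x - h n x\<bar>) \<longlonglongrightarrow> 0" by auto
    then show "AE x in lborel. (\<lambda>n. \<bar>F m x - h n x\<bar>) \<longlonglongrightarrow> 0"
      by (simp add: AE_completion_iff)
    show "integrable lborel (\<lambda>x. \<bar>F m x\<bar> + real m * indicator (cball 0 (real m + 1)) x)"
      using Fi by (intro Bochner_Integration.integrable_add integrable_abs integrable_mult_right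
          integrable_real_indicator) auto
    show "AE x in lborel. norm \<bar>F m x - h n x\<bar>
        \<le> \<bar>F m x\<bar> + real m * indicator (cball 0 (real m + 1)) x" for n
      using hb[of n] by (intro AE_I2) (metis abs_abs abs_triangle_ineq4 add_left_mono order_trans real_norm_def)
    show "(\<lambda>x. \<bar>F m x - h n x\<bar>) \<in> borel_measurable lborel" for n
      using borel_measurable_continuous_onI[OF hc] by measurable
  qed auto
  then have "\<forall>\<^sub>F n in sequentially. (LINT x|lborel. \<bar>F m x - h n x\<bar>) < e / 2"
    using e by (intro order_tendstoD(2)) auto
  then obtain n where n: "(LINT x|lborel. \<bar>F m x - h n x\<bar>) < e / 2"
    using eventually_happens'[OF sequentially_bot] by blast
  have hi: "integrable lborel (h n)"
    by (rule integrable_vanish_outside_compact[OF hc h0])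
  have "(LINT x|lborel. \<bar>f x - h n x\<bar>) \<le> (LINT x|lborel. \<bar>f x - F m x\<bar> + \<bar>F m x - h n x\<bar>)"
    using f hi Fi by (intro integral_mono) auto
  also have "\<dots> = (LINT x|lborel. \<bar>f x - F m x\<bar>) + (LINT x|lborel. \<bar>F m x - h n x\<bar>)"
    using f hi Fi by (intro Bochner_Integration.integral_add) auto
  also have "\<dots> < e" using m n by linarith
  finally show ?thesis using that[OF hc h0] by blast
qed

section \<open>Mollification\<close>

text \<open>Normalization by the nonnegative integral records integrability at the same
  time.\<close>

definition mollifier_kernel :: "real^2 \<Rightarrow> real" where
  "mollifier_kernel = (SOME m. smooth m \<and> (\<forall>x. 0 \<le> m x) \<and> (\<forall>x. 2 \<le> norm x \<longrightarrow> m x = 0) \<and>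
     (\<integral>\<^sup>+x. ennreal (m x) \<partial>lborel) = 1)"

lemma mollifier_kernel:
  "smooth mollifier_kernel" "0 \<le> mollifier_kernel x" "2 \<le> norm x \<Longrightarrow> mollifier_kernel x = 0"
  "(\<integral>\<^sup>+x. ennreal (mollifier_kernel x) \<partial>lborel) = 1"
proof -
  obtain \<eta> :: "real^2 \<Rightarrow> real" where \<eta>: "smooth \<eta>" "\<And>x. 0 \<le> \<eta> x" "\<eta> 0 > 0"
    "\<And>x. 2 \<le> norm x \<Longrightarrow> \<eta> x = 0" using smooth_bump by blast
  have c: "continuous_on UNIV \<eta>" using \<eta>(1) by (rule smooth_continuous)
  have i: "integrable lborel \<eta>"
    by (rule integrable_vanish_outside_compact[OF c, of 2]) (use \<eta>(4) in auto)
  define I where "I = (LINT x|lborel. \<eta> x)"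
  have "I \<noteq> 0"
  proof
    assume "I = 0"
    then have "AE x in lborel. \<eta> x = 0"
      using integral_nonneg_eq_0_iff_AE[OF i] \<eta>(2) by (simp add: I_def)
    then have "AE x in lebesgue. \<eta> x = 0" by (rule AE_completion)
    then have "negligible {x. \<eta> x \<noteq> 0}"
      by (simp add: negligible_iff_null_sets eventually_ae_filter_negligible completion.complete2)
         (metis (mono_tags) negligible_iff_null_sets negligible_subset)
    moreover have "open {x. \<eta> x \<noteq> 0}"
      using c by (simp add: open_Collect_neq)
    ultimately show False using \<eta>(3) open_not_negligible[of "{x. \<eta> x \<noteq> 0}"] by fastforce
  qed
  moreover have "I \<ge> 0" unfolding I_def using \<eta>(2) by simp
  ultimately have I: "I > 0" by simp
  define m where "m x = inverse I * \<eta> x" for x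
  have "(\<integral>\<^sup>+x. ennreal (m x) \<partial>lborel) = ennreal (LINT x|lborel. m x)"
    by (rule nn_integral_eq_integral) (use i \<eta>(2) I in \<open>auto simp: m_def\<close>)
  also have "(LINT x|lborel. m x) = 1" using I by (simp add: m_def I_def)
  finally have "smooth m \<and> (\<forall>x. 0 \<le> m x) \<and> (\<forall>x. 2 \<le> norm x \<longrightarrow> m x = 0) \<and>
     (\<integral>\<^sup>+x. ennreal (m x) \<partial>lborel) = 1"
    using smooth_cmult[OF \<eta>(1), of "inverse I"] \<eta> I by (auto simp: m_def[abs_def])
  then have "\<exists>m. smooth m \<and> (\<forall>x. 0 \<le> m x) \<and> (\<forall>x. 2 \<le> norm x \<longrightarrow> m x = 0) \<and>
     (\<integral>\<^sup>+x. ennreal (m x) \<partial>lborel) = 1" by blast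
  from someI_ex[OF this] have *: "smooth mollifier_kernel \<and> (\<forall>x. 0 \<le> mollifier_kernel x) \<and>
     (\<forall>x. 2 \<le> norm x \<longrightarrow> mollifier_kernel x = 0) \<and> (\<integral>\<^sup>+x. ennreal (mollifier_kernel x) \<partial>lborel) = 1"
    unfolding mollifier_kernel_def .
  then show "smooth mollifier_kernel" "0 \<le> mollifier_kernel x"
    "2 \<le> norm x \<Longrightarrow> mollifier_kernel x = 0"
    "(\<integral>\<^sup>+x. ennreal (mollifier_kernel x) \<partial>lborel) = 1" by auto
qed

text \<open>Division by the square of \<epsilon> keeps unit mass in two dimensions. The support has
  radius 2 * \<epsilon>, which explains the balls of this radius in later hypotheses.\<close>

definition moll :: "real \<Rightarrow> real^2 \<Rightarrow> real" where
  "moll \<epsilon> z = mollifier_kernel (z /\<^sub>R \<epsilon>) / \<epsilon>\<^sup>2"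

lemma nn_integral_affine:
  fixes f :: "real^2 \<Rightarrow> ennreal"
  assumes [measurable]: "f \<in> borel_measurable borel" and k: "k \<noteq> 0"
  shows "(\<integral>\<^sup>+x. f (c + k *\<^sub>R x) \<partial>lborel) = ennreal (1 / k\<^sup>2) * (\<integral>\<^sup>+x. f x \<partial>lborel)"
proof -
  have "(\<integral>\<^sup>+x. f x \<partial>lborel) = ennreal (k\<^sup>2) * (\<integral>\<^sup>+x. f (c + k *\<^sub>R x) \<partial>lborel)"
    by (subst lborel_affine[OF k, of c])
       (simp add: nn_integral_density nn_integral_distr nn_integral_cmult)
  then show ?thesis
    using k by (simp add: mult.assoc[symmetric] ennreal_mult[symmetric])
qed

lemma moll_nonneg: "0 \<le> moll \<epsilon> z"
  by (simp add: moll_def mollifier_kernel)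

lemma moll_zero: "\<epsilon> > 0 \<Longrightarrow> 2 * \<epsilon> \<le> norm z \<Longrightarrow> moll \<epsilon> z = 0"
  by (simp add: moll_def mollifier_kernel field_simps)

lemma moll_affine: "moll \<epsilon> (c + k *\<^sub>R z) = (1 / \<epsilon>\<^sup>2) * mollifier_kernel (c /\<^sub>R \<epsilon> + (k / \<epsilon>) *\<^sub>R z)"
  by (simp add: moll_def scaleR_add_right divide_inverse mult.commute)

lemma smooth_moll_affine: "smooth (\<lambda>z. moll \<epsilon> (c + k *\<^sub>R z))"
  unfolding moll_affine by (intro smooth_cmult smooth_affine mollifier_kernel)

lemma smooth_moll: "smooth (moll \<epsilon>)"
  using smooth_moll_affine[of \<epsilon> 0 1] by simp

lemma borel_measurable_moll [measurable]: "moll \<epsilon> \<in> borel_measurable borel"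
  by (intro borel_measurable_continuous_onI smooth_continuous smooth_moll)

text \<open>The mass does not depend on \<epsilon>. Slopes 1 and -1 give the kernel of
  \<open>conv\<close> in either variable; other slopes arise when an end point of a segment is the
  variable of integration.\<close>

lemma nn_integral_moll_affine:
  assumes "\<epsilon> > 0" "k \<noteq> 0"
  shows "(\<integral>\<^sup>+z. ennreal (moll \<epsilon> (c + k *\<^sub>R z)) \<partial>lborel) = ennreal (1 / k\<^sup>2)"
proof -
  have [measurable]: "mollifier_kernel \<in> borel_measurable borel"
    by (intro borel_measurable_continuous_onI smooth_continuous mollifier_kernel)
  have "(\<integral>\<^sup>+z. ennreal (moll \<epsilon> (c + k *\<^sub>R z)) \<partial>lborel)
     = ennreal (1 / \<epsilon>\<^sup>2) * (\<integral>\<^sup>+z. ennreal (mollifier_kernel (c /\<^sub>R \<epsilon> + (k / \<epsilon>) *\<^sub>R z)) \<partial>lborel)"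
    unfolding moll_affine by (subst nn_integral_cmult[symmetric])
      (auto simp: ennreal_mult[symmetric] mollifier_kernel)
  also have "\<dots> = ennreal (1 / \<epsilon>\<^sup>2) * (ennreal (1 / (k / \<epsilon>)\<^sup>2) * 1)"
    using assms by (subst nn_integral_affine[where f="\<lambda>z. ennreal (mollifier_kernel z)"])
      (auto simp: mollifier_kernel(4))
  also have "\<dots> = ennreal (1 / k\<^sup>2)"
    using assms by (simp add: ennreal_mult[symmetric] power_divide)
  finally show ?thesis .
qed

lemma nn_integral_moll_diff:
  assumes "\<epsilon> > 0"
  shows "(\<integral>\<^sup>+z. ennreal (moll \<epsilon> (x - z)) \<partial>lborel) = 1" "(\<integral>\<^sup>+x. ennreal (moll \<epsilon> (x - z)) \<partial>lborel) = 1"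
  using nn_integral_moll_affine[OF assms, of "-1" x] nn_integral_moll_affine[OF assms, of 1 "- z"]
  by simp_all

lemma integral_moll_diff:
  assumes "\<epsilon> > 0"
  shows "integrable lborel (\<lambda>z. moll \<epsilon> (x - z))" "(LINT z|lborel. moll \<epsilon> (x - z)) = 1"
proof -
  have "(\<lambda>z. moll \<epsilon> (x - z)) \<in> borel_measurable lborel" by measurable
  from integrableI_nn_integral_finite[OF this _ , of 1] integral_eq_nn_integral[OF this]
  show "integrable lborel (\<lambda>z. moll \<epsilon> (x - z))" "(LINT z|lborel. moll \<epsilon> (x - z)) = 1"
    using nn_integral_moll_diff[OF assms] by (auto simp: moll_nonneg)
qed

lemma test_function_moll:
  assumes "\<epsilon> > 0" "cball x (2 * \<epsilon>) \<subseteq> D"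
  shows "test_function D (\<lambda>z. moll \<epsilon> (x - z))"
proof -
  have 0: "moll \<epsilon> (x - z) = 0" if "z \<notin> cball x (2 * \<epsilon>)" for z
    using moll_zero[OF assms(1), of "x - z"] that by (auto simp: dist_norm)
  have "compact (supp (\<lambda>z. moll \<epsilon> (x - z)))" "supp (\<lambda>z. moll \<epsilon> (x - z)) \<subseteq> cball x (2 * \<epsilon>)"
    by (rule compact_supp[OF compact_cball] supp_subset_closed[OF closed_cball], erule 0)+
  then show ?thesis
    using assms(2) smooth_moll_affine[of \<epsilon> x "-1"] unfolding test_function_iff by auto
qed

lemma moll_bounded:
  assumes "\<epsilon> > 0"
  obtains B where "B \<ge> 0" "\<And>z. moll \<epsilon> z \<le> B" "\<And>z. \<bar>partial j (moll \<epsilon>) z\<bar> \<le> B"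
proof -
  have "moll \<epsilon> z = 0" if "z \<notin> cball 0 (2 * \<epsilon>)" for z
    using moll_zero[OF assms(1), of "z"] that by auto
  then have "compact (supp (moll \<epsilon>))" by (rule compact_supp[OF compact_cball])
  then have t: "test_function UNIV (moll \<epsilon>)"
    using smooth_moll by (simp add: test_function_iff)
  obtain B where B: "B \<ge> 0" "\<And>z. \<bar>moll \<epsilon> z\<bar> \<le> B" using test_function_bounded[OF t] by blast
  obtain C where C: "C \<ge> 0" "\<And>z. \<bar>partial j (moll \<epsilon>) z\<bar> \<le> C"
    using test_function_bounded[OF test_function_partial[OF t]] by blast
  show ?thesis
    using that[of "max B C"] B C by (metis abs_le_D1 max.coboundedI1 max.coboundedI2)
qed

section \<open>Convolution with the kernel, in the mean and almost everywhere\<close>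

definition conv :: "real \<Rightarrow> (real^2 \<Rightarrow> real) \<Rightarrow> real^2 \<Rightarrow> real" where
  "conv \<epsilon> f x = (LINT z|lborel. moll \<epsilon> (x - z) * f z)"

lemma borel_measurable_conv [measurable]:
  assumes [measurable]: "f \<in> borel_measurable borel"
  shows "conv \<epsilon> f \<in> borel_measurable borel"
proof -
  have "(\<lambda>x. LINT z|lborel. moll \<epsilon> (x - z) * f z) \<in> borel_measurable borel" by measurable
  then show ?thesis by (simp add: conv_def[abs_def])
qed

lemma integrable_moll_mult:
  assumes f: "integrable lborel f" and \<epsilon>: "\<epsilon> > 0"
  shows "integrable lborel (\<lambda>z. moll \<epsilon> (x - z) * f z)"
proof -
  have [measurable]: "f \<in> borel_measurable borel" using f by auto
  obtain B where B: "B \<ge> 0" "\<And>z. moll \<epsilon> z \<le> B" using moll_bounded[OF \<epsilon>] by metis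
  show ?thesis
  proof (rule Bochner_Integration.integrable_bound)
    show "integrable lborel (\<lambda>z. B * f z)" using f by simp
    show "AE z in lborel. norm (moll \<epsilon> (x - z) * f z) \<le> norm (B * f z)"
      using B by (auto simp: abs_mult moll_nonneg intro!: mult_right_mono)
  qed measurable
qed

text \<open>By Fubini, since the kernel has unit mass also as a function of x.\<close>

lemma nn_integral_conv_le:
  assumes f: "integrable lborel f" and \<epsilon>: "\<epsilon> > 0"
  shows "(\<integral>\<^sup>+x. ennreal \<bar>conv \<epsilon> f x\<bar> \<partial>lborel) \<le> (\<integral>\<^sup>+x. ennreal \<bar>f x\<bar> \<partial>lborel)"
proof -
  have [measurable]: "f \<in> borel_measurable borel" using f by auto
  have "(\<integral>\<^sup>+x. ennreal \<bar>conv \<epsilon> f x\<bar> \<partial>lborel)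
      \<le> (\<integral>\<^sup>+x. (\<integral>\<^sup>+z. ennreal (moll \<epsilon> (x - z)) * ennreal \<bar>f z\<bar> \<partial>lborel) \<partial>lborel)"
  proof (rule nn_integral_mono)
    fix x
    show "ennreal \<bar>conv \<epsilon> f x\<bar> \<le> (\<integral>\<^sup>+z. ennreal (moll \<epsilon> (x - z)) * ennreal \<bar>f z\<bar> \<partial>lborel)"
      using integral_norm_bound_ennreal[OF integrable_moll_mult[OF f \<epsilon>, of x]]
      by (simp add: conv_def abs_mult moll_nonneg ennreal_mult)
  qed
  also have "\<dots> = (\<integral>\<^sup>+z. (\<integral>\<^sup>+x. ennreal (moll \<epsilon> (x - z)) * ennreal \<bar>f z\<bar> \<partial>lborel) \<partial>lborel)"
    by (rule lborel_pair.Fubini') measurable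
  also have "\<dots> = (\<integral>\<^sup>+z. ennreal \<bar>f z\<bar> \<partial>lborel)"
    by (simp add: nn_integral_multc nn_integral_moll_diff[OF \<epsilon>])
  finally show ?thesis .
qed

lemma integrable_conv:
  assumes f: "integrable lborel f" and \<epsilon>: "\<epsilon> > 0"
  shows "integrable lborel (conv \<epsilon> f)" "(LINT x|lborel. \<bar>conv \<epsilon> f x\<bar>) \<le> (LINT x|lborel. \<bar>f x\<bar>)"
proof -
  have [measurable]: "f \<in> borel_measurable borel" using f by auto
  have fin: "(\<integral>\<^sup>+x. ennreal \<bar>f x\<bar> \<partial>lborel) = ennreal (LINT x|lborel. \<bar>f x\<bar>)"
    using f by (intro nn_integral_eq_integral) auto
  then show i: "integrable lborel (conv \<epsilon> f)"
    using nn_integral_conv_le[OF assms]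
    by (intro integrableI_bounded) (auto simp: le_less_trans)
  have "(\<integral>\<^sup>+x. ennreal \<bar>conv \<epsilon> f x\<bar> \<partial>lborel) = ennreal (LINT x|lborel. \<bar>conv \<epsilon> f x\<bar>)"
    using i by (intro nn_integral_eq_integral) auto
  with fin nn_integral_conv_le[OF assms]
  show "(LINT x|lborel. \<bar>conv \<epsilon> f x\<bar>) \<le> (LINT x|lborel. \<bar>f x\<bar>)" by simp
qed

lemma conv_diff:
  assumes "integrable lborel f" "integrable lborel g" "\<epsilon> > 0"
  shows "conv \<epsilon> (\<lambda>x. f x - g x) x = conv \<epsilon> f x - conv \<epsilon> g x"
  unfolding conv_def using integrable_moll_mult assms by (simp add: right_diff_distrib)

lemma conv_tendsto_continuous:
  assumes c: "continuous_on UNIV g" and R: "\<And>x. R < norm x \<Longrightarrow> g x = 0" and e: "e > 0"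
  obtains d where "d > 0" "\<And>\<epsilon> x. 0 < \<epsilon> \<Longrightarrow> \<epsilon> < d \<Longrightarrow>
    \<bar>conv \<epsilon> g x - g x\<bar> \<le> e * indicator (cball 0 (R + 2)) x"
proof -
  have "uniformly_continuous_on (cball 0 (R + 3)) g"
    by (intro compact_uniformly_continuous) (auto intro: continuous_on_subset[OF c])
  then obtain d0 where d0: "d0 > 0"
    "\<And>x y. norm x \<le> R + 3 \<Longrightarrow> norm y \<le> R + 3 \<Longrightarrow> dist y x < d0 \<Longrightarrow> dist (g y) (g x) < e"
    using e unfolding uniformly_continuous_on_def by (metis mem_cball_0)
  \<comment> \<open>The kernel reaches as far as 2 * \<epsilon>. This choice keeps that distance
    below d0, for uniform continuity, and below 1, so that points up to R + 2 see values of g only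
    up to R + 3.\<close>
  show ?thesis
  proof (rule that[of "min (d0 / 2) (1 / 2)"])
    fix \<epsilon> :: real and x :: "real^2"
    assume \<epsilon>: "0 < \<epsilon>" "\<epsilon> < min (d0 / 2) (1 / 2)"
    have gi: "integrable lborel g" by (rule integrable_vanish_outside_compact[OF c R])
    have near: "norm (x - z) < 1 \<and> norm (x - z) < d0" if "moll \<epsilon> (x - z) \<noteq> 0" for z
      using moll_zero[OF \<epsilon>(1), of "x - z"] that \<epsilon>(2) by fastforce
    show "\<bar>conv \<epsilon> g x - g x\<bar> \<le> e * indicator (cball 0 (R + 2)) x"
    proof (cases "norm x \<le> R + 2")
      case True
      have "conv \<epsilon> g x - g x = (LINT z|lborel. moll \<epsilon> (x - z) * g z - moll \<epsilon> (x - z) * g x)"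
        using integral_moll_diff[OF \<epsilon>(1), of x] integrable_moll_mult[OF gi \<epsilon>(1), of x]
        by (simp add: conv_def)
      then have "\<bar>conv \<epsilon> g x - g x\<bar> \<le> (LINT z|lborel. \<bar>moll \<epsilon> (x - z) * g z - moll \<epsilon> (x - z) * g x\<bar>)"
        by simp
      also have "\<dots> \<le> (LINT z|lborel. moll \<epsilon> (x - z) * e)"
      proof (rule integral_mono)
        fix z
        show "\<bar>moll \<epsilon> (x - z) * g z - moll \<epsilon> (x - z) * g x\<bar> \<le> moll \<epsilon> (x - z) * e"
        proof (cases "moll \<epsilon> (x - z) = 0")
          case False
          from near[OF this] have n: "norm (x - z) < 1" "norm (x - z) < d0" by auto
          have "norm z \<le> R + 3"
            using True n(1) norm_triangle_ineq4[of x "x - z"] by simp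
          with d0(2)[of x z] True n have "\<bar>g z - g x\<bar> \<le> e"
            by (simp add: dist_norm norm_minus_commute)
          then show ?thesis
            by (simp add: right_diff_distrib[symmetric] abs_mult moll_nonneg mult_left_mono)
        qed simp
      qed (use integral_moll_diff[OF \<epsilon>(1), of x] integrable_moll_mult[OF gi \<epsilon>(1), of x] in auto)
      also have "\<dots> = e" using integral_moll_diff[OF \<epsilon>(1), of x] by simp
      finally show ?thesis using True by simp
    next
      case False
      have "moll \<epsilon> (x - z) * g z = 0" for z
      proof (cases "moll \<epsilon> (x - z) = 0")
        case F: False
        from near[OF this] have "norm (x - z) < 1" by auto
        with False norm_triangle_ineq2[of x "x - z"] have "R < norm z" by simp
        then show ?thesis using R by simp
      qed simp
      then have "(\<lambda>z. moll \<epsilon> (x - z) * g z) = (\<lambda>z. 0)" by blast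
      then show ?thesis using False R[of x] by (simp add: conv_def)
    qed
  qed (use d0 in auto)
qed

text \<open>\<open>conv\<close> is a contraction in L1, so it is enough to have convergence for a
  dense class of functions.\<close>

lemma conv_tendsto_L1:
  assumes f: "integrable lborel f" and e: "e > 0"
  obtains d where "d > 0" "\<And>\<epsilon>. 0 < \<epsilon> \<Longrightarrow> \<epsilon> < d \<Longrightarrow> (LINT x|lborel. \<bar>conv \<epsilon> f x - f x\<bar>) \<le> e"
proof -
  obtain g R where g: "continuous_on UNIV g" "\<And>x. R < norm x \<Longrightarrow> g x = 0"
    "(LINT x|lborel. \<bar>f x - g x\<bar>) < e / 3" using L1_dense_continuous[OF f, of "e / 3"] e by auto
  have gi: "integrable lborel g" by (rule integrable_vanish_outside_compact[OF g(1,2)])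
  define V where "V = measure lborel (cball (0 :: real^2) (R + 2))"
  define e' where "e' = e / (3 * (V + 1))"
  have V: "V \<ge> 0" by (simp add: V_def)
  then have e': "e' > 0" using e by (simp add: e'_def)
  obtain d where d: "d > 0" "\<And>\<epsilon> x. 0 < \<epsilon> \<Longrightarrow> \<epsilon> < d \<Longrightarrow>
    \<bar>conv \<epsilon> g x - g x\<bar> \<le> e' * indicator (cball 0 (R + 2)) x"
    using conv_tendsto_continuous[OF g(1,2) e'] by metis
  show ?thesis
  proof (rule that[OF d(1)])
    fix \<epsilon> assume \<epsilon>: "0 < \<epsilon>" "\<epsilon> < d"
    have fg: "integrable lborel (\<lambda>x. f x - g x)" using f gi by simp
    note I = f gi fg integrable_conv(1)[OF f \<epsilon>(1)] integrable_conv(1)[OF gi \<epsilon>(1)]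
      integrable_conv(1)[OF fg \<epsilon>(1)]
    have "(LINT x|lborel. \<bar>conv \<epsilon> f x - f x\<bar>)
      \<le> (LINT x|lborel. \<bar>conv \<epsilon> (\<lambda>x. f x - g x) x\<bar> + \<bar>conv \<epsilon> g x - g x\<bar> + \<bar>f x - g x\<bar>)"
      using I by (intro integral_mono) (auto simp: conv_diff[OF f gi \<epsilon>(1)])
    also have "\<dots> = (LINT x|lborel. \<bar>conv \<epsilon> (\<lambda>x. f x - g x) x\<bar>) + (LINT x|lborel. \<bar>conv \<epsilon> g x - g x\<bar>)
        + (LINT x|lborel. \<bar>f x - g x\<bar>)"
      using I by (simp add: Bochner_Integration.integral_add)
    also have "\<dots> \<le> e / 3 + e / 3 + e / 3"
    proof (intro add_mono)
      show "(LINT x|lborel. \<bar>f x - g x\<bar>) \<le> e / 3" using g by simp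
      then show "(LINT x|lborel. \<bar>conv \<epsilon> (\<lambda>x. f x - g x) x\<bar>) \<le> e / 3"
        using integrable_conv(2)[OF fg \<epsilon>(1)] by simp
      have "(LINT x|lborel. \<bar>conv \<epsilon> g x - g x\<bar>) \<le> (LINT x|lborel. e' * indicator (cball (0::real^2) (R + 2)) x)"
        using I d(2)[OF \<epsilon>] by (intro integral_mono integrable_mult_right integrable_real_indicator) auto
      also have "\<dots> = e' * V" by (simp add: V_def)
      also have "\<dots> \<le> e / 3" using V e by (simp add: e'_def field_simps)
      finally show "(LINT x|lborel. \<bar>conv \<epsilon> g x - g x\<bar>) \<le> e / 3" .
    qed
    finally show "(LINT x|lborel. \<bar>conv \<epsilon> f x - f x\<bar>) \<le> e" by simp
  qed
qed

text \<open>Convergence in the mean yields pointwise convergence along a subsequence. That suffices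
  below, where limits only serve to pass from mollified statements to f.\<close>

lemma conv_AE_subseq:
  assumes f: "integrable lborel f"
  obtains \<delta> :: "nat \<Rightarrow> real" where "\<And>n. \<delta> n > 0" "\<delta> \<longlonglongrightarrow> 0"
    "AE x in lborel. (\<lambda>n. conv (\<delta> n) f x) \<longlonglongrightarrow> f x"
proof -
  define t :: "nat \<Rightarrow> real" where "t n = inverse (Suc n)" for n
  have t: "t n > 0" for n by (simp add: t_def)
  have t0: "t \<longlonglongrightarrow> 0" unfolding t_def by (rule LIMSEQ_inverse_real_of_nat)
  have "(\<lambda>n. LINT x|lborel. norm (conv (t n) f x - f x)) \<longlonglongrightarrow> 0"
  proof (rule LIMSEQ_I)
    fix r :: real assume "0 < r"
    then obtain d where d: "d > 0" "\<And>\<epsilon>. 0 < \<epsilon> \<Longrightarrow> \<epsilon> < d \<Longrightarrow> (LINT x|lborel. \<bar>conv \<epsilon> f x - f x\<bar>) \<le> r / 2"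
      using conv_tendsto_L1[OF f, of "r / 2"] by (metis half_gt_zero)
    have "\<forall>\<^sub>F n in sequentially. t n < d" using t0 d(1) by (rule order_tendstoD)
    then obtain N where "\<And>n. n \<ge> N \<Longrightarrow> t n < d" by (auto simp: eventually_sequentially)
    then show "\<exists>N. \<forall>n\<ge>N. norm ((LINT x|lborel. norm (conv (t n) f x - f x)) - 0) < r"
      using d(2)[OF t] \<open>0 < r\<close> by (intro exI[of _ N]) (auto intro!: le_less_trans[OF d(2)[OF t]])
  qed
  then obtain r where r: "strict_mono r" "AE x in lborel. (\<lambda>n. conv (t (r n)) f x - f x) \<longlonglongrightarrow> 0"
    using tendsto_L1_AE_subseq[of lborel "\<lambda>n x. conv (t n) f x - f x"]
      integrable_conv(1)[OF f t] f by auto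
  show ?thesis
  proof (rule that[of "t \<circ> r"])
    show "AE x in lborel. (\<lambda>n. conv ((t \<circ> r) n) f x) \<longlonglongrightarrow> f x"
      using r(2) by eventually_elim (simp add: LIM_zero_iff)
    show "(t \<circ> r) \<longlonglongrightarrow> 0" using t0 r(1) by (rule LIMSEQ_subseq_LIMSEQ)
  qed (simp add: t)
qed

section \<open>The Poincare inequality on convex sets\<close>

text \<open>For x in D and small \<epsilon> the kernel centred at x is itself a test function on D,
  so \<open>conv\<close> vanishes at x, and f x is its limit for almost every x.\<close>

lemma fundamental_lemma_borel:
  assumes f: "integrable lborel f" and D: "open D"
    and 0: "\<And>\<phi>. test_function D \<phi> \<Longrightarrow> (LINT x|lborel. f x * \<phi> x) = 0"
  shows "AE x in lborel. x \<in> D \<longrightarrow> f x = 0"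
proof -
  obtain \<delta> where \<delta>: "\<And>n. \<delta> n > 0" "\<delta> \<longlonglongrightarrow> 0"
    "AE x in lborel. (\<lambda>n. conv (\<delta> n) f x) \<longlonglongrightarrow> f x"
    using conv_AE_subseq[OF f] by blast
  from \<delta>(3) show ?thesis
  proof eventually_elim
    case (elim x)
    show ?case
    proof
      assume "x \<in> D"
      then obtain r where r: "r > 0" "cball x r \<subseteq> D" using D open_contains_cball by blast
      have "\<forall>\<^sub>F n in sequentially. \<delta> n < r / 2"
        using \<delta>(2) r by (intro order_tendstoD) auto
      then have "\<forall>\<^sub>F n in sequentially. conv (\<delta> n) f x = 0"
      proof eventually_elim
        case (elim n)
        then have "cball x (2 * \<delta> n) \<subseteq> D" using r(2) subset_cball[of "2 * \<delta> n" r x] by fastforce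
        from 0[OF test_function_moll[OF \<delta>(1) this]] show ?case
          by (simp add: conv_def mult.commute)
      qed
      then have "(\<lambda>n. conv (\<delta> n) f x) \<longlonglongrightarrow> 0" by (simp add: tendsto_eventually)
      with elim show "f x = 0" by (rule LIMSEQ_unique)
    qed
  qed
qed

lemma abs_le_1_plus_square: "\<bar>a\<bar> \<le> 1 + a\<^sup>2" for a :: real
proof -
  have "0 \<le> (\<bar>a\<bar> - 1 / 2)\<^sup>2" by simp
  also have "\<dots> = a\<^sup>2 - \<bar>a\<bar> + 1 / 4"
    unfolding power2_diff power2_abs by (simp add: power2_eq_square)
  finally show ?thesis by linarith
qed

text \<open>The variance of G for the probability weight w is nonnegative. The right-hand side is an
  extended real so that the inequality can be applied before anything is known to be
  integrable.\<close>

lemma jensen_square: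
  fixes w G :: "'a \<Rightarrow> real"
  assumes [measurable]: "w \<in> borel_measurable M" "G \<in> borel_measurable M"
    and w: "\<And>x. 0 \<le> w x" and w1: "(\<integral>\<^sup>+x. ennreal (w x) \<partial>M) = 1"
  shows "ennreal ((LINT x|M. w x * G x)\<^sup>2) \<le> (\<integral>\<^sup>+x. ennreal (w x * (G x)\<^sup>2) \<partial>M)"
proof (cases "(\<integral>\<^sup>+x. ennreal (w x * (G x)\<^sup>2) \<partial>M) < \<infinity>")
  case True
  have iw: "integrable M w" using w w1 by (intro integrableI_bounded) auto
  have I1: "(LINT x|M. w x) = 1" using integral_eq_nn_integral[of w M] w w1 by simp
  have i2: "integrable M (\<lambda>x. w x * (G x)\<^sup>2)" using w True by (intro integrableI_bounded) auto
  have i1: "integrable M (\<lambda>x. w x * G x)"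
  proof (rule Bochner_Integration.integrable_bound)
    show "integrable M (\<lambda>x. w x + w x * (G x)\<^sup>2)" using iw i2 by simp
    have "w x * \<bar>G x\<bar> \<le> w x * (1 + (G x)\<^sup>2)" for x
      by (intro mult_left_mono w abs_le_1_plus_square)
    then show "AE x in M. norm (w x * G x) \<le> norm (w x + w x * (G x)\<^sup>2)"
      using w by (simp add: abs_mult distrib_left)
  qed measurable
  define m where "m = (LINT x|M. w x * G x)"
  have "0 \<le> (LINT x|M. w x * (G x - m)\<^sup>2)" using w by (intro Bochner_Integration.integral_nonneg) auto
  also have "(LINT x|M. w x * (G x - m)\<^sup>2) = (LINT x|M. w x * (G x)\<^sup>2 - 2 * m * (w x * G x) + m\<^sup>2 * w x)"
    by (intro Bochner_Integration.integral_cong) (auto simp: power2_eq_square algebra_simps)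
  also have "\<dots> = (LINT x|M. w x * (G x)\<^sup>2) - 2 * m * m + m\<^sup>2"
    using i1 i2 iw I1 by (simp add: m_def)
  finally have "m\<^sup>2 \<le> (LINT x|M. w x * (G x)\<^sup>2)" by (simp add: power2_eq_square)
  moreover have "(\<integral>\<^sup>+x. ennreal (w x * (G x)\<^sup>2) \<partial>M) = ennreal (LINT x|M. w x * (G x)\<^sup>2)"
    using i2 w by (intro nn_integral_eq_integral) auto
  ultimately show ?thesis by (simp add: m_def ennreal_leI)
qed (simp add: not_less top_unique)

lemma integrable_pair_mult:
  fixes h :: "'a::euclidean_space \<Rightarrow> real" and f :: "'b::euclidean_space \<Rightarrow> real"
  assumes h: "integrable lborel h" and f: "integrable lborel f"
  shows "integrable (lborel \<Otimes>\<^sub>M lborel) (\<lambda>(t, z). h t * f z)"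
proof -
  have [measurable]: "h \<in> borel_measurable borel" "f \<in> borel_measurable borel" using f h by auto
  show ?thesis
  proof (rule lborel_pair.Fubini_integrable)
    show "integrable lborel (\<lambda>t. LINT z|lborel. norm (case (t, z) of (t, z) \<Rightarrow> h t * f z))"
      using h by (simp add: abs_mult)
    show "AE t in lborel. integrable lborel (\<lambda>z. case (t, z) of (t, z) \<Rightarrow> h t * f z)"
      using f by simp
  qed measurable
qed

text \<open>Only the kernel is differentiated along the segment. After exchanging the integrals, the
  derivative of the kernel at each point of the segment is moved to f by testing with that kernel;
  \<open>seg\<close> ensures that it is a test function on D.\<close>

lemma conv_segment:
  fixes g :: "2 \<Rightarrow> real^2 \<Rightarrow> real"
  assumes f: "integrable lborel f" and g: "\<And>j. integrable lborel (g j)"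
    and weak: "\<And>j \<phi>. test_function D \<phi> \<Longrightarrow>
      (LINT z|lborel. f z * partial j \<phi> z) = - (LINT z|lborel. g j z * \<phi> z)"
    and \<epsilon>: "\<epsilon> > 0" and seg: "\<And>t. 0 \<le> t \<Longrightarrow> t \<le> 1 \<Longrightarrow> cball (x + t *\<^sub>R (y - x)) (2 * \<epsilon>) \<subseteq> D"
  shows "conv \<epsilon> f y - conv \<epsilon> f x =
    (LINT t|lborel. indicator {0..1} t *
      (LINT z|lborel. moll \<epsilon> (x + t *\<^sub>R (y - x) - z) * (\<Sum>j\<in>UNIV. (y - x) $ j * g j z)))"
proof -
  have [measurable]: "f \<in> borel_measurable borel" using f by auto
  define a where "a = y - x"
  define P where "P j = partial j (moll \<epsilon>)" for j
  have Pc: "continuous_on UNIV (P j)" for j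
    unfolding P_def by (intro smooth_continuous smooth_partial smooth_moll)
  have [measurable]: "P j \<in> borel_measurable borel" for j
    by (rule borel_measurable_continuous_onI[OF Pc])
  have d: "((\<lambda>t. moll \<epsilon> (x + t *\<^sub>R a - z)) has_real_derivative
      (\<Sum>j\<in>UNIV. a $ j * P j (x + t *\<^sub>R a - z))) (at t)" for t z
  proof -
    let ?F = "frechet_derivative (moll \<epsilon>) (at (x + t *\<^sub>R a - z))"
    have D: "(moll \<epsilon> has_derivative ?F) (at (x + t *\<^sub>R a - z))"
      by (intro has_derivative_partial smooth_differentiable smooth_moll)
    have "((\<lambda>t. moll \<epsilon> (x + t *\<^sub>R a - z)) has_derivative (\<lambda>s. ?F (s *\<^sub>R a))) (at t)"
      by (rule has_derivative_compose[where f="\<lambda>t. x + t *\<^sub>R a - z" and g="moll \<epsilon>", OF _ D])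
         (auto intro!: derivative_eq_intros)
    moreover have "?F (s *\<^sub>R a) = (\<Sum>j\<in>UNIV. a $ j * P j (x + t *\<^sub>R a - z)) * s" for s
    proof -
      have lin: "linear ?F" using D by (rule has_derivative_linear)
      have "?F a = ?F (\<Sum>j\<in>UNIV. a $ j *s axis j 1)" by (simp add: basis_expansion)
      also have "\<dots> = (\<Sum>j\<in>UNIV. a $ j * P j (x + t *\<^sub>R a - z))"
        by (simp add: linear_sum[OF lin] linear_cmul[OF lin] scalar_mult_eq_scaleR P_def partial_def)
      finally show ?thesis using linear_cmul[OF lin, of s a] by simp
    qed
    then have "(\<lambda>s. ?F (s *\<^sub>R a)) = (*) (\<Sum>j\<in>UNIV. a $ j * P j (x + t *\<^sub>R a - z))"
      by (simp add: fun_eq_iff)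
    ultimately show ?thesis unfolding has_field_derivative_def by simp
  qed
  have FTC: "moll \<epsilon> (y - z) - moll \<epsilon> (x - z)
      = (LINT t|lborel. indicator {0..1} t * (\<Sum>j\<in>UNIV. a $ j * P j (x + t *\<^sub>R a - z)))" for z
  proof -
    have "(LINT t|lborel. indicator {0..1} t *\<^sub>R (\<Sum>j\<in>UNIV. a $ j * P j (x + t *\<^sub>R a - z)))
        = moll \<epsilon> (x + 1 *\<^sub>R a - z) - moll \<epsilon> (x + 0 *\<^sub>R a - z)"
    proof (rule integral_FTC_atLeastAtMost)
      show "continuous_on {0..1} (\<lambda>t. \<Sum>j\<in>UNIV. a $ j * P j (x + t *\<^sub>R a - z))"
        by (intro continuous_intros continuous_on_compose2[OF Pc]) auto
    qed (use d in \<open>auto simp: has_real_derivative_iff_has_vector_derivative[symmetric]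
        intro: has_field_derivative_at_within\<close>)
    then show ?thesis by (simp add: a_def)
  qed
  obtain B1 where B1: "B1 \<ge> 0" "\<And>z. \<bar>P 1 z\<bar> \<le> B1" using moll_bounded[OF \<epsilon>, of 1] by (metis P_def)
  obtain B2 where B2: "B2 \<ge> 0" "\<And>z. \<bar>P 2 z\<bar> \<le> B2" using moll_bounded[OF \<epsilon>, of 2] by (metis P_def)
  define C where "C = \<bar>a $ 1\<bar> * B1 + \<bar>a $ 2\<bar> * B2"
  have C: "\<bar>\<Sum>j\<in>UNIV. a $ j * P j z\<bar> \<le> C" for z
  proof -
    have "\<bar>\<Sum>j\<in>UNIV. a $ j * P j z\<bar> \<le> \<bar>a $ 1\<bar> * \<bar>P 1 z\<bar> + \<bar>a $ 2\<bar> * \<bar>P 2 z\<bar>"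
      unfolding sum_2 abs_mult[symmetric] by (rule abs_triangle_ineq)
    also have "\<dots> \<le> C" unfolding C_def using B1 B2 by (intro add_mono mult_left_mono) auto
    finally show ?thesis .
  qed
  \<comment> \<open>The derivatives of the kernel are bounded, so a multiple of |f| over the unit
    interval dominates and Fubini applies.\<close>
  have int: "integrable (lborel \<Otimes>\<^sub>M lborel)
      (\<lambda>(t, z). indicator {0..1} t * (\<Sum>j\<in>UNIV. a $ j * P j (x + t *\<^sub>R a - z)) * f z)"
  proof (rule Bochner_Integration.integrable_bound)
    show "integrable (lborel \<Otimes>\<^sub>M lborel) (\<lambda>(t::real, z). (C * indicator {0..1} t) * f z)"
      using f by (intro integrable_pair_mult) auto
    show "AE u in lborel \<Otimes>\<^sub>M lborel.
        norm (case u of (t, z) \<Rightarrow> indicator {0..1} t * (\<Sum>j\<in>UNIV. a $ j * P j (x + t *\<^sub>R a - z)) * f z)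
          \<le> norm (case u of (t, z) \<Rightarrow> (C * indicator {0..1} t) * f z)"
    proof (rule AE_I2, clarify)
      fix t z
      have "\<bar>\<Sum>j\<in>UNIV. a $ j * P j (x + t *\<^sub>R a - z)\<bar> \<le> \<bar>C\<bar>" using C by (meson abs_ge_self order_trans)
      then show "norm (indicator {0..1} t * (\<Sum>j\<in>UNIV. a $ j * P j (x + t *\<^sub>R a - z)) * f z)
          \<le> norm ((C * indicator {0..1} t) * f z)"
        by (auto simp: abs_mult indicator_def intro!: mult_right_mono)
    qed
  qed measurable
  have "conv \<epsilon> f y - conv \<epsilon> f x = (LINT z|lborel. (moll \<epsilon> (y - z) - moll \<epsilon> (x - z)) * f z)"
    unfolding conv_def using integrable_moll_mult[OF f \<epsilon>] by (simp add: left_diff_distrib)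
  also have "\<dots> = (LINT z|lborel. (LINT t|lborel.
      indicator {0..1} t * (\<Sum>j\<in>UNIV. a $ j * P j (x + t *\<^sub>R a - z)) * f z))"
    unfolding FTC by simp
  also have "\<dots> = (LINT t|lborel. (LINT z|lborel.
      indicator {0..1} t * (\<Sum>j\<in>UNIV. a $ j * P j (x + t *\<^sub>R a - z)) * f z))"
    using lborel_pair.Fubini_integral[OF int] by simp
  also have "\<dots> = (LINT t|lborel. indicator {0..1} t *
      (LINT z|lborel. moll \<epsilon> (x + t *\<^sub>R a - z) * (\<Sum>j\<in>UNIV. a $ j * g j z)))"
  proof (intro Bochner_Integration.integral_cong refl)
    fix t :: real
    show "(LINT z|lborel. indicator {0..1} t * (\<Sum>j\<in>UNIV. a $ j * P j (x + t *\<^sub>R a - z)) * f z)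
        = indicator {0..1} t * (LINT z|lborel. moll \<epsilon> (x + t *\<^sub>R a - z) * (\<Sum>j\<in>UNIV. a $ j * g j z))"
    proof (cases "t \<in> {0..1}")
      case True
      let ?p = "x + t *\<^sub>R a"
      have tf: "test_function D (\<lambda>z. moll \<epsilon> (?p - z))"
        using True seg[of t] by (intro test_function_moll \<epsilon>) (auto simp: a_def)
      \<comment> \<open>The sign produced by the reflection of z cancels the one in the definition
        of the weak derivative.\<close>
      have p: "partial j (\<lambda>z. moll \<epsilon> (?p - z)) = (\<lambda>z. - P j (?p - z))" for j
        using partial_affine(1)[OF smooth_differentiable[OF smooth_moll], of j \<epsilon> ?p "-1"]
        by (simp add: P_def)
      have iP: "integrable lborel (\<lambda>z. P j (?p - z) * f z)" for j
      proof -
        obtain B where B: "B \<ge> 0" "\<And>z. \<bar>P j z\<bar> \<le> B" using moll_bounded[OF \<epsilon>, of j] by (metis P_def)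
        show ?thesis
        proof (rule Bochner_Integration.integrable_bound)
          show "integrable lborel (\<lambda>z. B * f z)" using f by simp
          show "AE z in lborel. norm (P j (?p - z) * f z) \<le> norm (B * f z)"
            using B by (auto simp: abs_mult intro!: mult_right_mono)
        qed measurable
      qed
      have eq: "(LINT z|lborel. P j (?p - z) * f z) = (LINT z|lborel. moll \<epsilon> (?p - z) * g j z)" for j
        using weak[OF tf, of j] by (simp add: p mult.commute)
      have "(LINT z|lborel. (\<Sum>j\<in>UNIV. a $ j * P j (?p - z)) * f z)
          = (\<Sum>j\<in>UNIV. a $ j * (LINT z|lborel. P j (?p - z) * f z))"
        using iP[of 1] iP[of 2] by (simp add: sum_2 distrib_right mult.assoc)
      also have "\<dots> = (\<Sum>j\<in>UNIV. a $ j * (LINT z|lborel. moll \<epsilon> (?p - z) * g j z))"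
        by (simp add: eq)
      also have "\<dots> = (LINT z|lborel. moll \<epsilon> (?p - z) * (\<Sum>j\<in>UNIV. a $ j * g j z))"
        using integrable_moll_mult[OF g \<epsilon>] by (simp add: sum_2 distrib_left mult.left_commute)
      finally show ?thesis using True by simp
    qed simp
  qed
  finally show ?thesis by (simp add: a_def)
qed


text \<open>The point at parameter \<open>t\<close> of the segment from \<open>x\<close> to \<open>y\<close> is an affine function with slope \<open>t\<close> of
  \<open>y\<close> and \<open>1 - t\<close> of \<open>x\<close>.  Integrating first over the end point with the larger slope costs at most
  the factor \<open>4\<close>, whatever the shape of \<open>D\<close>.\<close>

lemma poincare_mollified:
  fixes g :: "2 \<Rightarrow> real^2 \<Rightarrow> real"
  assumes f: "integrable lborel f" and g: "\<And>j. integrable lborel (g j)"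
    and weak: "\<And>j \<phi>. test_function D \<phi> \<Longrightarrow>
      (LINT z|lborel. f z * partial j \<phi> z) = - (LINT z|lborel. g j z * \<phi> z)"
    and D: "open D" "convex D" and d: "d \<ge> 0" "\<And>x y. x \<in> D \<Longrightarrow> y \<in> D \<Longrightarrow> norm (y - x) \<le> d"
    and A: "A \<in> sets borel" "A \<subseteq> D" and \<epsilon>: "\<epsilon> > 0" "\<And>x. x \<in> A \<Longrightarrow> cball x (2 * \<epsilon>) \<subseteq> D"
  shows "(\<integral>\<^sup>+x. (\<integral>\<^sup>+y. ennreal (indicator A x * indicator A y * (conv \<epsilon> f y - conv \<epsilon> f x)\<^sup>2) \<partial>lborel) \<partial>lborel)
    \<le> ennreal (4 * d\<^sup>2) * emeasure lborel D * (\<integral>\<^sup>+z. ennreal (\<Sum>j\<in>UNIV. (g j z)\<^sup>2) \<partial>lborel)"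
proof -
  have [measurable]: "f \<in> borel_measurable borel" "g j \<in> borel_measurable borel" "A \<in> sets borel"
    "D \<in> sets borel" for j
    using f g[of j] A D by auto
  define S where "S z = (\<Sum>j\<in>UNIV. (g j z)\<^sup>2)" for z
  have S0: "S z \<ge> 0" for z by (simp add: S_def sum_nonneg)
  have [measurable]: "S \<in> borel_measurable borel" unfolding S_def by measurable
  define G where "G = (\<integral>\<^sup>+z. ennreal (S z) \<partial>lborel)"
  define Q where "Q x y t = (\<integral>\<^sup>+z. ennreal (moll \<epsilon> (x + t *\<^sub>R (y - x) - z)) * ennreal (S z) \<partial>lborel)" for x y t
  \<comment> \<open>A point at offset v from the segment is the convex combination of both end
    points shifted by the same v.\<close>
  have cD: "cball (x + t *\<^sub>R (y - x)) (2 * \<epsilon>) \<subseteq> D" if "x \<in> A" "y \<in> A" "0 \<le> t" "t \<le> 1" for x y t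
  proof
    fix w assume w: "w \<in> cball (x + t *\<^sub>R (y - x)) (2 * \<epsilon>)"
    define v where "v = w - (x + t *\<^sub>R (y - x))"
    have "norm v \<le> 2 * \<epsilon>" using w by (simp add: v_def dist_norm norm_minus_commute)
    then have "x + v \<in> D" "y + v \<in> D" using \<epsilon>(2)[OF that(1)] \<epsilon>(2)[OF that(2)]
      by (auto simp: subset_iff dist_norm)
    then have "(1 - t) *\<^sub>R (x + v) + t *\<^sub>R (y + v) \<in> D"
      using D(2) that by (simp add: convex_alt)
    also have "(1 - t) *\<^sub>R (x + v) + t *\<^sub>R (y + v) = w"
      by (simp add: v_def algebra_simps)
    finally show "w \<in> D" .
  qed
  have 1: "ennreal ((conv \<epsilon> f y - conv \<epsilon> f x)\<^sup>2)
      \<le> ennreal (d\<^sup>2) * (\<integral>\<^sup>+t. indicator {0..1} t * Q x y t \<partial>lborel)" if xy: "x \<in> A" "y \<in> A" for x y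
  proof -
    define a where "a = y - x"
    have a: "norm a \<le> d" using d(2) xy A(2) by (auto simp: a_def)
    define H where "H t = (LINT z|lborel. moll \<epsilon> (x + t *\<^sub>R a - z) * (\<Sum>j\<in>UNIV. a $ j * g j z))" for t
    have [measurable]: "H \<in> borel_measurable borel" unfolding H_def by measurable
    have seg: "conv \<epsilon> f y - conv \<epsilon> f x = (LINT t|lborel. indicator {0..1} t * H t)"
      unfolding H_def a_def by (rule conv_segment[OF f g weak \<epsilon>(1)]) (use cD xy in auto)
    have pt: "(\<Sum>j\<in>UNIV. a $ j * g j z)\<^sup>2 \<le> d\<^sup>2 * S z" for z
    proof -
      have "(\<Sum>j\<in>UNIV. a $ j * g j z)\<^sup>2 \<le> (\<Sum>j\<in>UNIV. (a $ j)\<^sup>2) * S z"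
        unfolding S_def by (rule Cauchy_Schwarz_ineq_sum)
      also have "(\<Sum>j\<in>UNIV. (a $ j)\<^sup>2) = (norm a)\<^sup>2"
        by (simp add: norm_vec_def L2_set_def sum_nonneg)
      also have "(norm a)\<^sup>2 * S z \<le> d\<^sup>2 * S z"
        using a S0 by (intro mult_right_mono power_mono) auto
      finally show ?thesis .
    qed
    \<comment> \<open>Jensen is applied twice: with the uniform weight in t, then with the kernel as
      weight in z.\<close>
    have "ennreal ((LINT t|lborel. indicator {0..1} t * H t)\<^sup>2)
        \<le> (\<integral>\<^sup>+t. ennreal (indicator {0..1} t * (H t)\<^sup>2) \<partial>lborel)"
      by (rule jensen_square) (auto simp: ennreal_indicator)
    also have "\<dots> \<le> (\<integral>\<^sup>+t. ennreal (d\<^sup>2) * (indicator {0..1} t * Q x y t) \<partial>lborel)"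
    proof (rule nn_integral_mono)
      fix t :: real
      have "ennreal ((H t)\<^sup>2) \<le> (\<integral>\<^sup>+z. ennreal (moll \<epsilon> (x + t *\<^sub>R a - z) * (\<Sum>j\<in>UNIV. a $ j * g j z)\<^sup>2) \<partial>lborel)"
        unfolding H_def by (rule jensen_square) (auto simp: moll_nonneg nn_integral_moll_diff \<epsilon>)
      also have "\<dots> \<le> (\<integral>\<^sup>+z. ennreal (d\<^sup>2) * (ennreal (moll \<epsilon> (x + t *\<^sub>R a - z)) * ennreal (S z)) \<partial>lborel)"
      proof (rule nn_integral_mono)
        fix z
        have "moll \<epsilon> (x + t *\<^sub>R a - z) * (\<Sum>j\<in>UNIV. a $ j * g j z)\<^sup>2 \<le> moll \<epsilon> (x + t *\<^sub>R a - z) * (d\<^sup>2 * S z)"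
          using pt moll_nonneg by (intro mult_left_mono)
        then show "ennreal (moll \<epsilon> (x + t *\<^sub>R a - z) * (\<Sum>j\<in>UNIV. a $ j * g j z)\<^sup>2)
           \<le> ennreal (d\<^sup>2) * (ennreal (moll \<epsilon> (x + t *\<^sub>R a - z)) * ennreal (S z))"
          by (simp add: ennreal_mult[symmetric] moll_nonneg S0 mult.left_commute ennreal_leI)
      qed
      also have "\<dots> = ennreal (d\<^sup>2) * Q x y t"
        unfolding Q_def a_def by (rule nn_integral_cmult) measurable
      finally show "ennreal (indicator {0..1} t * (H t)\<^sup>2) \<le> ennreal (d\<^sup>2) * (indicator {0..1} t * Q x y t)"
        by (simp add: indicator_def)
    qed
    also have "\<dots> = ennreal (d\<^sup>2) * (\<integral>\<^sup>+t. indicator {0..1} t * Q x y t \<partial>lborel)"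
      unfolding Q_def by (rule nn_integral_cmult) measurable
    finally show ?thesis by (simp add: seg)
  qed
  have half: "(\<integral>\<^sup>+y. (\<integral>\<^sup>+z. ennreal (moll \<epsilon> (c + k *\<^sub>R y - z)) * ennreal (S z) \<partial>lborel) \<partial>lborel) \<le> 4 * G"
    if k: "k \<ge> 1 / 2" for c :: "real^2" and k :: real
  proof -
    have "(\<integral>\<^sup>+y. (\<integral>\<^sup>+z. ennreal (moll \<epsilon> (c + k *\<^sub>R y - z)) * ennreal (S z) \<partial>lborel) \<partial>lborel)
        = (\<integral>\<^sup>+z. (\<integral>\<^sup>+y. ennreal (moll \<epsilon> (c + k *\<^sub>R y - z)) * ennreal (S z) \<partial>lborel) \<partial>lborel)"
      by (rule lborel_pair.Fubini') measurable
    also have "\<dots> = (\<integral>\<^sup>+z. ennreal (1 / k\<^sup>2) * ennreal (S z) \<partial>lborel)"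
    proof (rule nn_integral_cong)
      fix z
      have "(\<integral>\<^sup>+y. ennreal (moll \<epsilon> (c + k *\<^sub>R y - z)) \<partial>lborel) = ennreal (1 / k\<^sup>2)"
        using nn_integral_moll_affine[OF \<epsilon>(1), of k "c - z"] k by (simp add: algebra_simps)
      then show "(\<integral>\<^sup>+y. ennreal (moll \<epsilon> (c + k *\<^sub>R y - z)) * ennreal (S z) \<partial>lborel)
          = ennreal (1 / k\<^sup>2) * ennreal (S z)"
        by (simp add: nn_integral_multc)
    qed
    also have "\<dots> = ennreal (1 / k\<^sup>2) * G"
      unfolding G_def by (rule nn_integral_cmult) measurable
    also have "\<dots> \<le> ennreal 4 * G"
    proof (intro mult_right_mono ennreal_leI)
      have "(1 / 2)\<^sup>2 \<le> k\<^sup>2" using k by (intro power_mono) auto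
      then show "1 / k\<^sup>2 \<le> 4" using k by (simp add: power2_eq_square field_simps)
    qed simp
    finally show ?thesis by simp
  qed
  have slice: "(\<integral>\<^sup>+x. (\<integral>\<^sup>+y. indicator A x * indicator A y * q x y \<partial>lborel) \<partial>lborel) \<le> emeasure lborel D * (4 * G)"
    if q: "\<And>x. (\<integral>\<^sup>+y. q x y \<partial>lborel) \<le> 4 * G" for q :: "real^2 \<Rightarrow> real^2 \<Rightarrow> ennreal"
  proof -
    have "(\<integral>\<^sup>+x. (\<integral>\<^sup>+y. indicator A x * indicator A y * q x y \<partial>lborel) \<partial>lborel)
       \<le> (\<integral>\<^sup>+x. (4 * G) * indicator D x \<partial>lborel)"
    proof (rule nn_integral_mono)
      fix x
      have "(\<integral>\<^sup>+y. indicator A x * indicator A y * q x y \<partial>lborel) \<le> (\<integral>\<^sup>+y. indicator D x * q x y \<partial>lborel)"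
        using A(2) by (intro nn_integral_mono) (auto simp: indicator_def)
      with q[of x] show "(\<integral>\<^sup>+y. indicator A x * indicator A y * q x y \<partial>lborel) \<le> (4 * G) * indicator D x"
        by (auto simp: indicator_def split: if_splits)
    qed
    also have "\<dots> = emeasure lborel D * (4 * G)"
      by (subst nn_integral_cmult) (auto simp: mult.commute)
    finally show ?thesis .
  qed
  have dbl: "(\<integral>\<^sup>+x. (\<integral>\<^sup>+y. indicator A x * indicator A y * Q x y t \<partial>lborel) \<partial>lborel)
      \<le> emeasure lborel D * (4 * G)" if t: "0 \<le> t" "t \<le> 1" for t
  proof (cases "t \<ge> 1 / 2")
    case True
    have "(\<integral>\<^sup>+y. Q x y t \<partial>lborel) \<le> 4 * G" for x
      using half[OF True, of "(1 - t) *\<^sub>R x"] by (simp add: Q_def algebra_simps)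
    then show ?thesis by (rule slice)
  next
    case False
    then have "1 / 2 \<le> 1 - t" by simp
    have "(\<integral>\<^sup>+x. Q x y t \<partial>lborel) \<le> 4 * G" for y
      using half[OF \<open>1 / 2 \<le> 1 - t\<close>, of "t *\<^sub>R y"] by (simp add: Q_def algebra_simps)
    then have "(\<integral>\<^sup>+y. (\<integral>\<^sup>+x. indicator A y * indicator A x * Q x y t \<partial>lborel) \<partial>lborel)
        \<le> emeasure lborel D * (4 * G)" by (rule slice)
    also have "(\<integral>\<^sup>+y. (\<integral>\<^sup>+x. indicator A y * indicator A x * Q x y t \<partial>lborel) \<partial>lborel)
        = (\<integral>\<^sup>+x. (\<integral>\<^sup>+y. indicator A y * indicator A x * Q x y t \<partial>lborel) \<partial>lborel)"
      unfolding Q_def by (rule lborel_pair.Fubini') measurable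
    finally show ?thesis by (simp add: mult.commute[of "indicator A _" "indicator A _"])
  qed
  let ?q = "\<lambda>x y t. indicator {0..1} t * (indicator A x * indicator A y * Q x y t)"
  have "(\<integral>\<^sup>+x. (\<integral>\<^sup>+y. ennreal (indicator A x * indicator A y * (conv \<epsilon> f y - conv \<epsilon> f x)\<^sup>2) \<partial>lborel) \<partial>lborel)
      \<le> (\<integral>\<^sup>+x. (\<integral>\<^sup>+y. ennreal (d\<^sup>2) * (\<integral>\<^sup>+t. ?q x y t \<partial>lborel) \<partial>lborel) \<partial>lborel)"
    by (intro nn_integral_mono) (use 1 in \<open>auto simp: indicator_def\<close>)
  also have "\<dots> = (\<integral>\<^sup>+x. ennreal (d\<^sup>2) * (\<integral>\<^sup>+y. (\<integral>\<^sup>+t. ?q x y t \<partial>lborel) \<partial>lborel) \<partial>lborel)"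
    unfolding Q_def by (intro nn_integral_cong nn_integral_cmult) measurable
  also have "\<dots> = ennreal (d\<^sup>2) * (\<integral>\<^sup>+x. (\<integral>\<^sup>+y. (\<integral>\<^sup>+t. ?q x y t \<partial>lborel) \<partial>lborel) \<partial>lborel)"
    unfolding Q_def by (intro nn_integral_cmult) measurable
  also have "(\<integral>\<^sup>+x. (\<integral>\<^sup>+y. (\<integral>\<^sup>+t. ?q x y t \<partial>lborel) \<partial>lborel) \<partial>lborel)
     = (\<integral>\<^sup>+x. (\<integral>\<^sup>+t. (\<integral>\<^sup>+y. ?q x y t \<partial>lborel) \<partial>lborel) \<partial>lborel)"
    unfolding Q_def by (intro nn_integral_cong lborel_pair.Fubini') measurable
  also have "\<dots> = (\<integral>\<^sup>+t. (\<integral>\<^sup>+x. (\<integral>\<^sup>+y. ?q x y t \<partial>lborel) \<partial>lborel) \<partial>lborel)"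
    unfolding Q_def by (intro lborel_pair.Fubini') measurable
  also have "\<dots> \<le> (\<integral>\<^sup>+t. (emeasure lborel D * (4 * G)) * indicator {0..1::real} t \<partial>lborel)"
    by (intro nn_integral_mono) (use dbl in \<open>auto simp: indicator_def\<close>)
  also have "\<dots> = emeasure lborel D * (4 * G)"
    by (subst nn_integral_cmult) auto
  finally have "(\<integral>\<^sup>+x. (\<integral>\<^sup>+y. ennreal (indicator A x * indicator A y * (conv \<epsilon> f y - conv \<epsilon> f x)\<^sup>2) \<partial>lborel) \<partial>lborel)
    \<le> ennreal (d\<^sup>2) * (emeasure lborel D * (4 * G))" by (simp add: mult_left_mono)
  also have "\<dots> = ennreal (4 * d\<^sup>2) * emeasure lborel D * G"
    by (simp add: ennreal_mult' mult_ac)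
  finally show ?thesis by (simp add: G_def S_def)
qed

text \<open>Fatou's lemma removes the mollification from the double integral over D. This integral
  is at most c times the measure of D, so the inner integral is at most c for some x, and m = f x
  will do.\<close>

lemma poincare_borel:
  fixes g :: "2 \<Rightarrow> real^2 \<Rightarrow> real"
  assumes f: "integrable lborel f" and g: "\<And>j. integrable lborel (g j)"
    and weak: "\<And>j \<phi>. test_function D \<phi> \<Longrightarrow>
      (LINT z|lborel. f z * partial j \<phi> z) = - (LINT z|lborel. g j z * \<phi> z)"
    and D: "open D" "convex D" "bounded D"
    and d: "d \<ge> 0" "\<And>x y. x \<in> D \<Longrightarrow> y \<in> D \<Longrightarrow> norm (y - x) \<le> d"
  shows "\<exists>m. (\<integral>\<^sup>+y. ennreal (indicator D y * (f y - m)\<^sup>2) \<partial>lborel)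
    \<le> ennreal (4 * d\<^sup>2) * (\<integral>\<^sup>+z. ennreal (\<Sum>j\<in>UNIV. (g j z)\<^sup>2) \<partial>lborel)"
proof -
  have [measurable]: "f \<in> borel_measurable borel" "g j \<in> borel_measurable borel" "D \<in> sets borel" for j
    using f g[of j] D by auto
  define G where "G = (\<integral>\<^sup>+z. ennreal (\<Sum>j\<in>UNIV. (g j z)\<^sup>2) \<partial>lborel)"
  define c where "c = ennreal (4 * d\<^sup>2) * G"
  define h where "h x = (\<integral>\<^sup>+y. ennreal (indicator D y * (f y - f x)\<^sup>2) \<partial>lborel)" for x
  have [measurable]: "h \<in> borel_measurable borel" unfolding h_def by measurable
  obtain \<delta> where \<delta>: "\<And>n. \<delta> n > 0" "\<delta> \<longlonglongrightarrow> 0"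
    "AE x in lborel. (\<lambda>n. conv (\<delta> n) f x) \<longlonglongrightarrow> f x"
    using conv_AE_subseq[OF f] by blast
  \<comment> \<open>The distance to the empty set is 0 by convention, so the complement of D must be
    nonempty for the sets \<open>A n\<close> to exhaust D.\<close>
  have ne: "- D \<noteq> {}" using D(3) not_bounded_UNIV by (metis double_compl Compl_empty_eq)
  define A where "A n = D \<inter> {x. 2 * \<delta> n < infdist x (- D)}" for n
  have "open (A n)" for n
    unfolding A_def by (intro open_Int D open_Collect_less continuous_intros)
  then have A [measurable]: "A n \<in> sets borel" and AD: "A n \<subseteq> D" for n by (auto simp: A_def)
  have Acb: "cball x (2 * \<delta> n) \<subseteq> D" if "x \<in> A n" for x n
  proof
    fix z assume "z \<in> cball x (2 * \<delta> n)"
    with that show "z \<in> D" using infdist_le[of z "- D" x] by (auto simp: A_def)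
  qed
  define K where "K n x y = ennreal (indicator (A n) x * indicator (A n) y * (conv (\<delta> n) f y - conv (\<delta> n) f x)\<^sup>2)"
    for n x y
  have lim: "(\<lambda>n. K n x y) \<longlonglongrightarrow> ennreal (indicator D x * indicator D y * (f y - f x)\<^sup>2)"
    if x: "(\<lambda>n. conv (\<delta> n) f x) \<longlonglongrightarrow> f x" and y: "(\<lambda>n. conv (\<delta> n) f y) \<longlonglongrightarrow> f y" for x y
  proof -
    have ev: "\<forall>\<^sub>F n in sequentially. z \<in> A n" if "z \<in> D" for z
    proof -
      have "infdist z (- D) > 0"
        using in_closed_iff_infdist_zero[of "- D" z] D(1) ne that infdist_nonneg[of z "- D"]
        by (auto simp: closed_def less_le)
      then have "\<forall>\<^sub>F n in sequentially. \<delta> n < infdist z (- D) / 2"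
        using \<delta>(2) by (intro order_tendstoD) auto
      then show ?thesis by eventually_elim (use that in \<open>auto simp: A_def\<close>)
    qed
    have i: "(\<lambda>n. indicator (A n) z :: real) \<longlonglongrightarrow> indicator D z" for z
    proof (cases "z \<in> D")
      case True
      show ?thesis by (rule tendsto_eventually, use ev[OF True] in eventually_elim) (use True in auto)
    next
      case False
      then show ?thesis using AD by (intro tendsto_eventually always_eventually) (auto simp: indicator_def)
    qed
    show ?thesis unfolding K_def by (intro tendsto_intros i x y)
  qed
  have "(\<integral>\<^sup>+x. indicator D x * h x \<partial>lborel)
      = (\<integral>\<^sup>+x. (\<integral>\<^sup>+y. ennreal (indicator D x * indicator D y * (f y - f x)\<^sup>2) \<partial>lborel) \<partial>lborel)"
    by (intro nn_integral_cong) (auto simp: h_def indicator_def)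
  also have "\<dots> = (\<integral>\<^sup>+x. (\<integral>\<^sup>+y. liminf (\<lambda>n. K n x y) \<partial>lborel) \<partial>lborel)"
  proof (rule nn_integral_cong_AE, use \<delta>(3) in eventually_elim)
    case x: (elim x)
    show ?case
    proof (rule nn_integral_cong_AE, use \<delta>(3) in eventually_elim)
      case (elim y)
      show ?case using lim_imp_Liminf[OF sequentially_bot lim[OF x elim]] by simp
    qed
  qed
  also have "\<dots> \<le> (\<integral>\<^sup>+x. liminf (\<lambda>n. \<integral>\<^sup>+y. K n x y \<partial>lborel) \<partial>lborel)"
    unfolding K_def by (intro nn_integral_mono nn_integral_liminf) measurable
  also have "\<dots> \<le> liminf (\<lambda>n. \<integral>\<^sup>+x. (\<integral>\<^sup>+y. K n x y \<partial>lborel) \<partial>lborel)"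
    unfolding K_def by (intro nn_integral_liminf) measurable
  also have "\<dots> \<le> liminf (\<lambda>n. c * emeasure lborel D)"
  proof (rule Liminf_mono, rule always_eventually, rule allI)
    fix n
    show "(\<integral>\<^sup>+x. (\<integral>\<^sup>+y. K n x y \<partial>lborel) \<partial>lborel) \<le> c * emeasure lborel D"
      using poincare_mollified[OF f g weak D(1,2) d A AD \<delta>(1) Acb, of n]
      unfolding K_def c_def G_def by (simp add: mult_ac)
  qed
  also have "\<dots> = c * emeasure lborel D" by (rule Liminf_const[OF sequentially_bot])
  finally have le: "(\<integral>\<^sup>+x. indicator D x * h x \<partial>lborel) \<le> c * emeasure lborel D" .
  have "\<exists>m. (\<integral>\<^sup>+y. ennreal (indicator D y * (f y - m)\<^sup>2) \<partial>lborel) \<le> c"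
  proof (cases "D = {}")
    case False
    \<comment> \<open>Otherwise h exceeds c on all of D, an open nonempty set, and its integral
      would exceed c times the measure of D.\<close>
    have "\<exists>x\<in>D. h x \<le> c"
    proof (rule ccontr)
      assume "\<not> (\<exists>x\<in>D. h x \<le> c)"
      then have gt: "\<And>x. x \<in> D \<Longrightarrow> c < h x" by (simp add: not_le)
      from False gt have c: "c < \<infinity>" by (metis all_not_in_conv infinity_ennreal_def le_less_trans not_le top_greatest top.not_eq_extremum)
      have fin: "emeasure lborel D < \<infinity>" using D(3) by (rule emeasure_bounded_finite)
      have eq: "(\<integral>\<^sup>+x. c * indicator D x \<partial>lborel) = c * emeasure lborel D"
        by (simp add: nn_integral_cmult)
      have "(\<integral>\<^sup>+x. c * indicator D x \<partial>lborel) < (\<integral>\<^sup>+x. indicator D x * h x \<partial>lborel)"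
      proof (rule nn_integral_less)
        show "(\<integral>\<^sup>+x. c * indicator D x \<partial>lborel) \<noteq> \<infinity>"
          unfolding eq using c fin by (auto simp: ennreal_mult_eq_top_iff)
        show "AE x in lborel. c * indicator D x \<le> indicator D x * h x"
          using gt by (auto simp: indicator_def less_imp_le)
        show "\<not> (AE x in lborel. indicator D x * h x \<le> c * indicator D x)"
        proof
          assume "AE x in lborel. indicator D x * h x \<le> c * indicator D x"
          then have "AE x in lborel. x \<notin> D"
            by eventually_elim (use gt in \<open>force simp: not_le[symmetric]\<close>)
          then have "D \<in> null_sets lborel" by (simp add: AE_iff_null_sets)
          then have "negligible D" by (simp add: negligible_iff_null_sets null_sets_completionI)
          with False D(1) show False using open_not_negligible by blast
        qed
      qed measurable
      with le eq show False by simp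
    qed
    then show ?thesis unfolding h_def by blast
  qed simp
  then show ?thesis by (simp add: c_def G_def)
qed

text \<open>Sobolev functions are only Lebesgue measurable and arbitrary outside D, while Fubini and
  translation arguments want Borel functions on the plane that vanish off D.\<close>

lemma borel_representative:
  fixes h :: "real^2 \<Rightarrow> real"
  assumes D: "open D" and h: "h \<in> borel_measurable (lebesgue_on D)"
  obtains f where "f \<in> borel_measurable borel" "\<And>x. x \<notin> D \<Longrightarrow> f x = 0"
    "AE x in lebesgue_on D. h x = f x"
proof -
  have Dl: "D \<in> sets lebesgue" using D by (simp add: borel_open)
  have "(\<lambda>x. if x \<in> D then h x else 0) \<in> borel_measurable lebesgue"
    using h Dl by (simp add: borel_measurable_if)
  then obtain f0 where f0: "f0 \<in> borel_measurable lborel" "AE x in lborel. (if x \<in> D then h x else 0) = f0 x"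
    using completion_ex_borel_measurable_real by blast
  have [measurable]: "D \<in> sets borel" "f0 \<in> borel_measurable borel" using D f0 by auto
  show ?thesis
  proof (rule that[of "\<lambda>x. indicator D x * f0 x"])
    have "AE x in lebesgue. (if x \<in> D then h x else 0) = f0 x"
      using f0(2) by (rule AE_completion)
    then show "AE x in lebesgue_on D. h x = indicator D x * f0 x"
      using Dl by (simp add: AE_restrict_space_iff) (auto elim!: eventually_mono)
  qed auto
qed

lemma integral_lebesgue_on_borel:
  fixes f :: "real^2 \<Rightarrow> real"
  assumes D: "open D" and f: "f \<in> borel_measurable borel" and 0: "\<And>x. x \<notin> D \<Longrightarrow> f x = 0"
  shows "integrable (lebesgue_on D) f \<longleftrightarrow> integrable lborel f"
    and "(LINT x|lebesgue_on D. f x) = (LINT x|lborel. f x)"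
proof -
  have Dl: "D \<in> sets lebesgue" using D by (simp add: borel_open)
  have eq: "(\<lambda>x. indicator D x * f x) = f" using 0 by (auto simp: indicator_def fun_eq_iff)
  show "integrable (lebesgue_on D) f \<longleftrightarrow> integrable lborel f"
    using Dl f by (simp add: integrable_restrict_space eq integrable_completion)
  show "(LINT x|lebesgue_on D. f x) = (LINT x|lborel. f x)"
    using Dl f by (simp add: integral_restrict_space eq integral_completion)
qed

lemma integrable_of_square:
  assumes D: "open D" "bounded D" and w: "square_integrable D w"
  shows "integrable (lebesgue_on D) w"
proof (rule Bochner_Integration.integrable_bound)
  have "D \<in> lmeasurable" using D by (simp add: lmeasurable_open)
  then have "finite_measure (lebesgue_on D)" by (rule finite_measure_lebesgue_on)
  then show "integrable (lebesgue_on D) (\<lambda>x. 1 + (w x)\<^sup>2)"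
    using w by (auto simp: square_integrable_def finite_measure.integrable_const)
  show "AE x in lebesgue_on D. norm (w x) \<le> norm (1 + (w x)\<^sup>2)"
    using abs_le_1_plus_square by simp
qed (use w in \<open>simp add: square_integrable_def\<close>)

lemma borel_test: "test_function D \<phi> \<Longrightarrow> \<phi> \<in> borel_measurable borel"
  by (rule borel_measurable_continuous_onI[OF test_function_continuous])

lemma borel_lebesgue_on: "f \<in> borel_measurable borel \<Longrightarrow> f \<in> borel_measurable (lebesgue_on D)"
  by (simp add: measurable_completion measurable_restrict_space1)

lemma fundamental_lemma:
  assumes D: "open D" and h: "integrable (lebesgue_on D) h"
    and 0: "\<And>\<phi>. test_function D \<phi> \<Longrightarrow> (LINT x|lebesgue_on D. h x * \<phi> x) = 0"
  shows "AE x in lebesgue_on D. h x = 0"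
proof -
  obtain f where f [measurable]: "f \<in> borel_measurable borel" and f0: "\<And>x. x \<notin> D \<Longrightarrow> f x = 0"
    and fh: "AE x in lebesgue_on D. h x = f x"
    using borel_representative[OF D borel_measurable_integrable[OF h]] by blast
  have fl: "f \<in> borel_measurable (lebesgue_on D)" by (rule borel_lebesgue_on[OF f])
  have "integrable (lebesgue_on D) f"
    using integrable_cong_AE[OF borel_measurable_integrable[OF h] fl fh] h by simp
  then have fi: "integrable lborel f" using integral_lebesgue_on_borel(1)[OF D f f0] by simp
  have "AE x in lborel. x \<in> D \<longrightarrow> f x = 0"
  proof (rule fundamental_lemma_borel[OF fi D])
    fix \<phi> assume \<phi>: "test_function D \<phi>"
    note [measurable] = borel_test[OF \<phi>]
    have "(LINT x|lborel. f x * \<phi> x) = (LINT x|lebesgue_on D. f x * \<phi> x)"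
      by (rule integral_lebesgue_on_borel(2)[OF D, symmetric]) (use f0 in auto)
    also have "\<dots> = (LINT x|lebesgue_on D. h x * \<phi> x)"
    proof (rule integral_cong_AE)
      show "(\<lambda>x. f x * \<phi> x) \<in> borel_measurable (lebesgue_on D)"
        by (intro borel_lebesgue_on) measurable
      show "(\<lambda>x. h x * \<phi> x) \<in> borel_measurable (lebesgue_on D)"
        by (intro borel_measurable_times borel_measurable_integrable[OF h] borel_lebesgue_on borel_test[OF \<phi>])
      show "AE x in lebesgue_on D. f x * \<phi> x = h x * \<phi> x"
        using fh by eventually_elim simp
    qed
    also have "\<dots> = 0" by (rule 0[OF \<phi>])
    finally show "(LINT x|lborel. f x * \<phi> x) = 0" .
  qed
  then have "AE x in lebesgue. x \<in> D \<longrightarrow> f x = 0" by (rule AE_completion)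
  then have "AE x in lebesgue_on D. f x = 0"
    using D by (simp add: AE_restrict_space_iff borel_open)
  with fh show ?thesis by eventually_elim simp
qed

text \<open>The Borel version is applied to representatives vanishing off D. Test functions vanish
  there too, so weak derivatives on D become identities between integrals over the plane.\<close>

lemma poincare_convex:
  assumes D: "open D" "convex D" "bounded D"
    and d: "d \<ge> 0" "\<And>x y. x \<in> D \<Longrightarrow> y \<in> D \<Longrightarrow> norm (y - x) \<le> d"
    and w: "square_integrable D w" and g: "\<And>j. has_weak_partial D (shift j (0, 0)) w (g j)"
  shows "\<exists>m. (LINT x|lebesgue_on D. (w x - m)\<^sup>2)
    \<le> 4 * d\<^sup>2 * (\<Sum>j\<in>UNIV. LINT x|lebesgue_on D. (g j x)\<^sup>2)"
proof -
  have gs: "square_integrable D (g j)" for j using g by (simp add: has_weak_partial_def)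
  obtain f where f [measurable]: "f \<in> borel_measurable borel" and f0: "\<And>x. x \<notin> D \<Longrightarrow> f x = 0"
    and fw: "AE x in lebesgue_on D. w x = f x"
    using borel_representative[OF D(1)] w unfolding square_integrable_def by metis
  have "\<exists>f. f \<in> borel_measurable borel \<and> (\<forall>x. x \<notin> D \<longrightarrow> f x = 0) \<and> (AE x in lebesgue_on D. g j x = f x)" for j
    using borel_representative[OF D(1)] gs[of j] unfolding square_integrable_def by metis
  then obtain k where k [measurable]: "\<And>j. k j \<in> borel_measurable borel"
    and k0: "\<And>j x. x \<notin> D \<Longrightarrow> k j x = 0" and kg: "\<And>j. AE x in lebesgue_on D. g j x = k j x"
    by metis
  have wl: "w \<in> borel_measurable (lebesgue_on D)" and gl: "g j \<in> borel_measurable (lebesgue_on D)" for j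
    using w gs[of j] by (auto simp: square_integrable_def)
  have fl: "f \<in> borel_measurable (lebesgue_on D)" and kl: "k j \<in> borel_measurable (lebesgue_on D)" for j
    by (intro borel_lebesgue_on f k)+
  have "integrable (lebesgue_on D) f"
    using integrable_of_square[OF D(1,3) w] integrable_cong_AE[OF wl fl fw] by simp
  then have fi: "integrable lborel f" using integral_lebesgue_on_borel(1)[OF D(1) f f0] by simp
  have "integrable (lebesgue_on D) (k j)" for j
    using integrable_of_square[OF D(1,3) gs] integrable_cong_AE[OF gl kl kg] by simp
  then have ki: "integrable lborel (k j)" for j
    using integral_lebesgue_on_borel(1)[OF D(1) k k0] by simp
  have weak: "(LINT z|lborel. f z * partial j \<phi> z) = - (LINT z|lborel. k j z * \<phi> z)"
    if \<phi>: "test_function D \<phi>" for j \<phi>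
  proof -
    note p = test_function_partial[OF \<phi>, of j]
    note [measurable] = borel_test[OF \<phi>] borel_test[OF p]
    have "(LINT z|lborel. f z * partial j \<phi> z) = (LINT z|lebesgue_on D. f z * partial j \<phi> z)"
      by (rule integral_lebesgue_on_borel(2)[OF D(1), symmetric]) (use f0 in auto)
    also have "\<dots> = (LINT z|lebesgue_on D. w z * partial j \<phi> z)"
      by (rule integral_cong_AE; (intro borel_measurable_times wl fl borel_lebesgue_on borel_test[OF p])?)
         (use fw in \<open>auto elim: eventually_mono\<close>)
    also have "\<dots> = (LINT z|lebesgue_on D. w z * multi_partial (shift j (0, 0)) \<phi> z)"
      using \<phi> partial_multi_partial[of \<phi> j "(0, 0)"] by (simp add: test_function_iff)
    also have "\<dots> = - (LINT z|lebesgue_on D. g j z * \<phi> z)"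
      using g[of j] \<phi> multi_order_shift[of j "(0, 0)"]
      by (simp add: has_weak_partial_def multi_order_def[of "(0, 0)"])
    also have "(LINT z|lebesgue_on D. g j z * \<phi> z) = (LINT z|lebesgue_on D. k j z * \<phi> z)"
      by (rule integral_cong_AE; (intro borel_measurable_times gl kl borel_lebesgue_on borel_test[OF \<phi>])?)
         (use kg[of j] in \<open>auto elim: eventually_mono\<close>)
    also have "\<dots> = (LINT z|lborel. k j z * \<phi> z)"
      by (rule integral_lebesgue_on_borel(2)[OF D(1)]) (use k0 in auto)
    finally show ?thesis .
  qed
  obtain m where m: "(\<integral>\<^sup>+y. ennreal (indicator D y * (f y - m)\<^sup>2) \<partial>lborel)
    \<le> ennreal (4 * d\<^sup>2) * (\<integral>\<^sup>+z. ennreal (\<Sum>j\<in>UNIV. (k j z)\<^sup>2) \<partial>lborel)"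
    using poincare_borel[OF fi ki weak D d] by blast
  have k2: "integrable lborel (\<lambda>x. (k j x)\<^sup>2)"
    "(LINT x|lborel. (k j x)\<^sup>2) = (LINT x|lebesgue_on D. (g j x)\<^sup>2)" for j
  proof -
    have g2: "integrable (lebesgue_on D) (\<lambda>x. (g j x)\<^sup>2)" using gs by (simp add: square_integrable_def)
    have ae: "AE x in lebesgue_on D. (g j x)\<^sup>2 = (k j x)\<^sup>2" using kg[of j] by eventually_elim simp
    have mm: "(\<lambda>x. (k j x)\<^sup>2) \<in> borel_measurable borel" by measurable
    have gm: "(\<lambda>x. (g j x)\<^sup>2) \<in> borel_measurable (lebesgue_on D)" using gl by simp
    note km = borel_lebesgue_on[OF mm]
    note * = integral_lebesgue_on_borel[OF D(1) mm]
    from g2 integrable_cong_AE[OF gm km ae] *(1) k0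
    show "integrable lborel (\<lambda>x. (k j x)\<^sup>2)" by simp
    from integral_cong_AE[OF gm km ae] *(2) k0
    show "(LINT x|lborel. (k j x)\<^sup>2) = (LINT x|lebesgue_on D. (g j x)\<^sup>2)" by simp
  qed
  have "(\<integral>\<^sup>+z. ennreal (\<Sum>j\<in>UNIV. (k j z)\<^sup>2) \<partial>lborel) = ennreal (LINT z|lborel. (\<Sum>j\<in>UNIV. (k j z)\<^sup>2))"
    using k2(1) by (intro nn_integral_eq_integral) (auto intro!: AE_I2 sum_nonneg)
  also have "(LINT z|lborel. (\<Sum>j\<in>UNIV. (k j z)\<^sup>2)) = (\<Sum>j\<in>UNIV. LINT x|lebesgue_on D. (g j x)\<^sup>2)"
    using k2 by simp
  finally have m': "(\<integral>\<^sup>+y. ennreal (indicator D y * (f y - m)\<^sup>2) \<partial>lborel)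
    \<le> ennreal (4 * d\<^sup>2 * (\<Sum>j\<in>UNIV. LINT x|lebesgue_on D. (g j x)\<^sup>2))"
    using m by (simp add: ennreal_mult'[symmetric])
  have [measurable]: "D \<in> sets borel" using D by simp
  have "(LINT x|lebesgue_on D. (w x - m)\<^sup>2) = (LINT x|lebesgue_on D. indicator D x * (f x - m)\<^sup>2)"
  proof (rule integral_cong_AE)
    show "(\<lambda>x. indicator D x * (f x - m)\<^sup>2) \<in> borel_measurable (lebesgue_on D)"
      by (intro borel_lebesgue_on) measurable
    have "AE x in lebesgue_on D. x \<in> D" by (rule AE_I2) simp
    with fw show "AE x in lebesgue_on D. (w x - m)\<^sup>2 = indicator D x * (f x - m)\<^sup>2"
      by eventually_elim simp
  qed (use wl in simp)
  also have "\<dots> = (LINT x|lborel. indicator D x * (f x - m)\<^sup>2)"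
    by (rule integral_lebesgue_on_borel(2)[OF D(1)]) auto
  also have "\<dots> \<le> 4 * d\<^sup>2 * (\<Sum>j\<in>UNIV. LINT x|lebesgue_on D. (g j x)\<^sup>2)"
  proof -
    have "0 \<le> 4 * d\<^sup>2 * (\<Sum>j\<in>UNIV. LINT x|lebesgue_on D. (g j x)\<^sup>2)"
      by (intro mult_nonneg_nonneg sum_nonneg) auto
    then show ?thesis using m' integral_eq_nn_integral[of "\<lambda>x. indicator D x * (f x - m)\<^sup>2" lborel]
      by (simp add: enn2real_leI)
  qed
  finally show ?thesis by blast
qed

section \<open>Sobolev functions on bounded open sets\<close>

text \<open>Constants are irrelevant here, so squared norms with \<open>(a + b)\<^sup>2 \<le> 2 a\<^sup>2 + 2 b\<^sup>2\<close> replace the Minkowski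
  inequality throughout.\<close>

definition nsq :: "(real^2) set \<Rightarrow> (real^2 \<Rightarrow> real) \<Rightarrow> real" where
  "nsq D w = (LINT x|lebesgue_on D. (w x)\<^sup>2)"

lemma nsq_nonneg [simp]: "0 \<le> nsq D w"
  by (simp add: nsq_def)

lemma L2_norm_on_sq: "(L2_norm_on D w)\<^sup>2 = nsq D w"
  by (simp add: L2_norm_on_def nsq_def)

lemma square_integrable_measurable: "square_integrable D w \<Longrightarrow> w \<in> borel_measurable (lebesgue_on D)"
  and square_integrable_square: "square_integrable D w \<Longrightarrow> integrable (lebesgue_on D) (\<lambda>x. (w x)\<^sup>2)"
  by (auto simp: square_integrable_def)

lemma square_integrable_mult:
  assumes "square_integrable D u" "square_integrable D v"
  shows "integrable (lebesgue_on D) (\<lambda>x. u x * v x)"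
proof (rule Bochner_Integration.integrable_bound)
  show "integrable (lebesgue_on D) (\<lambda>x. (u x)\<^sup>2 + (v x)\<^sup>2)"
    using assms by (simp add: square_integrable_square)
  have "\<bar>u x * v x\<bar> \<le> (u x)\<^sup>2 + (v x)\<^sup>2" for x
  proof -
    have "2 * (\<bar>u x\<bar> * \<bar>v x\<bar>) \<le> (u x)\<^sup>2 + (v x)\<^sup>2"
      using sum_squares_bound[of "\<bar>u x\<bar>" "\<bar>v x\<bar>"] by (simp add: mult.assoc)
    moreover have "0 \<le> \<bar>u x\<bar> * \<bar>v x\<bar>" by simp
    ultimately show ?thesis unfolding abs_mult by linarith
  qed
  then show "AE x in lebesgue_on D. norm (u x * v x) \<le> norm ((u x)\<^sup>2 + (v x)\<^sup>2)"
    by (simp add: abs_of_nonneg)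
qed (use assms in \<open>auto simp: square_integrable_def\<close>)

lemma square_integrable_cmult: "square_integrable D w \<Longrightarrow> square_integrable D (\<lambda>x. c * w x)"
  by (auto simp: square_integrable_def power_mult_distrib)

lemma square_integrable_add:
  assumes u: "square_integrable D u" and v: "square_integrable D v"
  shows "square_integrable D (\<lambda>x. u x + v x)"
proof -
  have "integrable (lebesgue_on D) (\<lambda>x. (u x)\<^sup>2 + (v x)\<^sup>2 + 2 * (u x * v x))"
    using square_integrable_mult[OF u v] u v
    by (intro Bochner_Integration.integrable_add integrable_mult_right) (auto simp: square_integrable_def)
  moreover have "(\<lambda>x. u x + v x) \<in> borel_measurable (lebesgue_on D)"
    using u v by (intro borel_measurable_add square_integrable_measurable)
  ultimately show ?thesis
    by (simp add: square_integrable_def power2_sum mult.assoc)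
qed

lemma square_integrable_diff:
  "square_integrable D u \<Longrightarrow> square_integrable D v \<Longrightarrow> square_integrable D (\<lambda>x. u x - v x)"
  using square_integrable_add[of D u "\<lambda>x. (-1) * v x"] square_integrable_cmult[of D v "-1"] by simp

lemma square_integrable_0: "square_integrable D (\<lambda>x. 0)"
  by (simp add: square_integrable_def)

lemma square_integrable_sum:
  "finite I \<Longrightarrow> (\<And>i. i \<in> I \<Longrightarrow> square_integrable D (u i)) \<Longrightarrow> square_integrable D (\<lambda>x. \<Sum>i\<in>I. u i x)"
  by (induction I rule: finite_induct) (auto intro: square_integrable_add square_integrable_0)

lemma nsq_add:
  assumes u: "square_integrable D u" and v: "square_integrable D v"
  shows "nsq D (\<lambda>x. u x + v x) \<le> 2 * nsq D u + 2 * nsq D v"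
proof -
  have "nsq D (\<lambda>x. u x + v x) \<le> (LINT x|lebesgue_on D. 2 * (u x)\<^sup>2 + 2 * (v x)\<^sup>2)"
    unfolding nsq_def
  proof (rule integral_mono)
    show "integrable (lebesgue_on D) (\<lambda>x. (u x + v x)\<^sup>2)"
      using square_integrable_add[OF u v] by (simp add: square_integrable_def)
    show "(u x + v x)\<^sup>2 \<le> 2 * (u x)\<^sup>2 + 2 * (v x)\<^sup>2" for x
      using sum_squares_bound[of "u x" "v x"] by (simp add: power2_sum)
  qed (use u v in \<open>simp add: square_integrable_square\<close>)
  also have "\<dots> = 2 * nsq D u + 2 * nsq D v"
    using u v by (simp add: square_integrable_square nsq_def)
  finally show ?thesis .
qed

lemma nsq_cmult: "nsq D (\<lambda>x. c * w x) = c\<^sup>2 * nsq D w"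
  by (simp add: nsq_def power_mult_distrib)

lemma nsq_diff:
  assumes u: "square_integrable D u" and v: "square_integrable D v"
  shows "nsq D (\<lambda>x. u x - v x) \<le> 2 * nsq D u + 2 * nsq D v"
  using nsq_add[OF u square_integrable_cmult[OF v, of "-1"]] nsq_cmult[of D "-1" v] by simp

lemma nsq_cong_AE:
  assumes "u \<in> borel_measurable (lebesgue_on D)" "v \<in> borel_measurable (lebesgue_on D)"
    "AE x in lebesgue_on D. u x = v x"
  shows "nsq D u = nsq D v"
  unfolding nsq_def
proof (rule integral_cong_AE)
  show "AE x in lebesgue_on D. (u x)\<^sup>2 = (v x)\<^sup>2" using assms(3) by eventually_elim simp
qed (use assms in simp_all)

lemma Cauchy_Schwarz_nsq:
  assumes u: "square_integrable D u" and v: "square_integrable D v"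
  shows "(LINT x|lebesgue_on D. u x * v x)\<^sup>2 \<le> nsq D u * nsq D v"
proof -
  define I where "I = (LINT x|lebesgue_on D. u x * v x)"
  have p: "0 \<le> nsq D u + 2 * t * I + t\<^sup>2 * nsq D v" for t
  proof -
    have "0 \<le> (LINT x|lebesgue_on D. (u x + t * v x)\<^sup>2)"
      by (intro Bochner_Integration.integral_nonneg) auto
    also have "\<dots> = (LINT x|lebesgue_on D. (u x)\<^sup>2 + 2 * t * (u x * v x) + t\<^sup>2 * (v x)\<^sup>2)"
      by (intro Bochner_Integration.integral_cong) (auto simp: power2_eq_square algebra_simps)
    also have "\<dots> = nsq D u + 2 * t * I + t\<^sup>2 * nsq D v"
      using u v square_integrable_mult[OF u v] by (simp add: nsq_def I_def square_integrable_square)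
    finally show ?thesis .
  qed
  have "I\<^sup>2 \<le> nsq D u * nsq D v"
  proof (cases "nsq D v = 0")
    case True
    have "I = 0"
    proof (rule ccontr)
      assume "I \<noteq> 0"
      \<comment> \<open>With \<open>nsq D v = 0\<close> the polynomial is affine in t, and this t
        gives it the value -1.\<close>
      define t where "t = - (nsq D u + 1) / (2 * I)"
      have "2 * t * I = - (nsq D u + 1)" using \<open>I \<noteq> 0\<close> by (simp add: t_def)
      then show False using p[of t] unfolding True by simp
    qed
    then show ?thesis by simp
  next
    case False
    then have B: "nsq D v > 0" by (simp add: less_le)
    have "0 \<le> nsq D u - I\<^sup>2 / nsq D v"
      using p[of "- I / nsq D v"] B by (simp add: power2_eq_square field_simps)
    then show ?thesis using B by (simp add: field_simps)
  qed
  then show ?thesis by (simp add: I_def)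
qed

lemma integral_lebesgue_on_zero_outside:
  fixes F :: "real^2 \<Rightarrow> real"
  assumes "open D" "open D'" "D' \<subseteq> D" "\<And>x. x \<notin> D' \<Longrightarrow> F x = 0"
  shows "(LINT x|lebesgue_on D'. F x) = (LINT x|lebesgue_on D. F x)"
proof -
  have "(\<lambda>x. indicator D' x *\<^sub>R F x) = (\<lambda>x. indicator D x *\<^sub>R F x)"
    using assms by (auto simp: indicator_def fun_eq_iff)
  then show ?thesis using assms(1,2) by (simp add: integral_restrict_space borel_open)
qed

lemma square_integrable_mono:
  assumes "D' \<in> sets lebesgue" "D \<in> sets lebesgue" "D' \<subseteq> D" "square_integrable D w"
  shows "square_integrable D' w" "nsq D' w \<le> nsq D w"
proof -
  have m: "w \<in> borel_measurable (lebesgue_on D')"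
    using assms by (metis square_integrable_measurable measurable_restrict_mono)
  have I0: "integrable lebesgue (\<lambda>x. indicator D x *\<^sub>R (w x)\<^sup>2)"
    using assms square_integrable_square[OF assms(4)] by (simp add: integrable_restrict_space)
  have I: "integrable lebesgue (\<lambda>x. indicator D' x *\<^sub>R (indicator D x *\<^sub>R (w x)\<^sup>2))"
    by (rule integrable_mult_indicator[OF assms(1) I0])
  have eq: "(\<lambda>x. indicator D' x *\<^sub>R (indicator D x *\<^sub>R (w x)\<^sup>2)) = (\<lambda>x. indicator D' x *\<^sub>R (w x)\<^sup>2)"
    using assms(3) by (auto simp: indicator_def fun_eq_iff)
  have I': "integrable (lebesgue_on D') (\<lambda>x. (w x)\<^sup>2)"
    using I assms(1) unfolding eq by (simp add: integrable_restrict_space)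
  with m show "square_integrable D' w" by (simp add: square_integrable_def)
  have "nsq D' w = (LINT x|lebesgue. indicator D' x *\<^sub>R (w x)\<^sup>2)"
    unfolding nsq_def using assms(1) by (simp add: integral_restrict_space)
  also have "\<dots> \<le> (LINT x|lebesgue. indicator D x *\<^sub>R (w x)\<^sup>2)"
    by (rule integral_mono)
       (use I eq \<open>integrable lebesgue (\<lambda>x. indicator D x *\<^sub>R (w x)\<^sup>2)\<close> assms(3) in
         \<open>auto simp: indicator_def\<close>)
  also have "\<dots> = nsq D w"
    unfolding nsq_def using assms(2) by (simp add: integral_restrict_space)
  finally show "nsq D' w \<le> nsq D w" .
qed

lemma square_integrable_compact:
  fixes f :: "real^2 \<Rightarrow> real"
  assumes D: "open D" "D \<subseteq> K" and K: "compact K" "continuous_on K f"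
  shows "square_integrable D f"
proof -
  have cD: "continuous_on D f" using K(2) D(2) by (rule continuous_on_subset)
  have fm: "f \<in> borel_measurable (lebesgue_on D)"
    using cD D(1) by (intro continuous_imp_measurable_on_sets_lebesgue) (auto simp: borel_open)
  obtain B where B: "\<And>x. x \<in> K \<Longrightarrow> \<bar>f x\<bar> \<le> B"
    using compact_imp_bounded[OF compact_continuous_image[OF K(2,1)]]
    unfolding bounded_iff by fastforce
  have "finite_measure (lebesgue_on D)"
    using D K(1) by (intro finite_measure_lebesgue_on lmeasurable_open) (auto intro: bounded_subset compact_imp_bounded)
  then have "integrable (lebesgue_on D) (\<lambda>x. (f x)\<^sup>2)"
  proof (rule finite_measure.integrable_const_bound[where B="B\<^sup>2"])
    show "AE x in lebesgue_on D. norm ((f x)\<^sup>2) \<le> B\<^sup>2"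
    proof (rule AE_I2)
      fix x assume "x \<in> space (lebesgue_on D)"
      then have "\<bar>f x\<bar> \<le> B" using B D(2) by auto
      then have "\<bar>f x\<bar>\<^sup>2 \<le> B\<^sup>2" by (intro power_mono) auto
      then show "norm ((f x)\<^sup>2) \<le> B\<^sup>2" by simp
    qed
  qed (use fm in simp)
  then show ?thesis using fm by (simp add: square_integrable_def)
qed

lemma square_integrable_continuous:
  assumes "open D" "bounded D" "continuous_on UNIV p"
  shows "square_integrable D p"
  using assms continuous_on_subset[OF assms(3) subset_UNIV]
  by (intro square_integrable_compact[OF _ closure_subset]) auto

lemma test_function_square_integrable:
  assumes "open D" "bounded D" "test_function D' \<phi>"
  shows "square_integrable D \<phi>"
  using assms by (intro square_integrable_continuous test_function_continuous)

section \<open>Weak derivatives on a bounded open set\<close>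

locale bounded_open =
  fixes D :: "(real^2) set"
  assumes opn: "open D" and bdd: "bounded D"
begin

lemma test_sq: "test_function D \<phi> \<Longrightarrow> square_integrable D \<phi>"
  and multi_partial_sq: "test_function D \<phi> \<Longrightarrow> square_integrable D (multi_partial \<alpha> \<phi>)"
  using test_function_square_integrable[OF opn bdd] test_function_multi_partial by blast+

lemma has_weak_partial_unique:
  assumes "has_weak_partial D \<alpha> w g" "has_weak_partial D \<alpha> w h"
  shows "AE x in lebesgue_on D. g x = h x"
proof -
  have gs: "square_integrable D g" and hs: "square_integrable D h"
    using assms by (auto simp: has_weak_partial_def)
  have "AE x in lebesgue_on D. g x - h x = 0"
  proof (rule fundamental_lemma[OF opn])
    show "integrable (lebesgue_on D) (\<lambda>x. g x - h x)"
      using integrable_of_square[OF opn bdd] square_integrable_diff[OF gs hs] by blast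
    fix \<phi> assume \<phi>: "test_function D \<phi>"
    have "(-1 :: real) ^ multi_order \<alpha> * (LINT x|lebesgue_on D. g x * \<phi> x)
        = (-1) ^ multi_order \<alpha> * (LINT x|lebesgue_on D. h x * \<phi> x)"
      using assms(1)[unfolded has_weak_partial_def, THEN conjunct2, rule_format, OF \<phi>]
        assms(2)[unfolded has_weak_partial_def, THEN conjunct2, rule_format, OF \<phi>] by (rule trans[OF sym])
    then have "(LINT x|lebesgue_on D. g x * \<phi> x) = (LINT x|lebesgue_on D. h x * \<phi> x)" by simp
    then show "(LINT x|lebesgue_on D. (g x - h x) * \<phi> x) = 0"
      using square_integrable_mult[OF gs test_sq[OF \<phi>]] square_integrable_mult[OF hs test_sq[OF \<phi>]]
      by (simp add: left_diff_distrib)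
  qed
  then show ?thesis by eventually_elim simp
qed

lemma has_weak_partial_lincomb:
  assumes w: "square_integrable D w" "square_integrable D v"
    and g: "has_weak_partial D \<alpha> w g" "has_weak_partial D \<alpha> v h"
  shows "has_weak_partial D \<alpha> (\<lambda>x. a * w x + b * v x) (\<lambda>x. a * g x + b * h x)"
proof -
  have gs: "square_integrable D g" and hs: "square_integrable D h"
    using g by (auto simp: has_weak_partial_def)
  have "(LINT x|lebesgue_on D. (a * w x + b * v x) * multi_partial \<alpha> \<phi> x) =
        (-1) ^ multi_order \<alpha> * (LINT x|lebesgue_on D. (a * g x + b * h x) * \<phi> x)"
    if \<phi>: "test_function D \<phi>" for \<phi>
  proof -
    have split: "(LINT x|lebesgue_on D. (a * u x + b * u' x) * \<psi> x)
       = a * (LINT x|lebesgue_on D. u x * \<psi> x) + b * (LINT x|lebesgue_on D. u' x * \<psi> x)"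
      if "square_integrable D u" "square_integrable D u'" "square_integrable D \<psi>" for u u' \<psi>
      using square_integrable_mult[OF that(1,3)] square_integrable_mult[OF that(2,3)]
      by (simp add: distrib_right mult.assoc)
    show ?thesis
      using g \<phi> unfolding split[OF w multi_partial_sq[OF \<phi>]] split[OF gs hs test_sq[OF \<phi>]]
        has_weak_partial_def by (simp add: algebra_simps)
  qed
  then show ?thesis
    using square_integrable_add[OF square_integrable_cmult[OF gs] square_integrable_cmult[OF hs]]
    by (simp add: has_weak_partial_def)
qed

lemma has_weak_partial_cong_AE:
  assumes w: "square_integrable D w" "square_integrable D v" "AE x in lebesgue_on D. w x = v x"
    and g: "has_weak_partial D \<alpha> w g"
  shows "has_weak_partial D \<alpha> v g"
proof -
  have "(LINT x|lebesgue_on D. v x * multi_partial \<alpha> \<phi> x) = (LINT x|lebesgue_on D. w x * multi_partial \<alpha> \<phi> x)"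
    if \<phi>: "test_function D \<phi>" for \<phi>
  proof (rule integral_cong_AE)
    show "AE x in lebesgue_on D. v x * multi_partial \<alpha> \<phi> x = w x * multi_partial \<alpha> \<phi> x"
      using w(3) by eventually_elim simp
  qed (intro borel_measurable_times square_integrable_measurable w multi_partial_sq[OF \<phi>])+
  then show ?thesis using g by (simp add: has_weak_partial_def)
qed

lemma has_weak_partial_0: "square_integrable D w \<Longrightarrow> has_weak_partial D (0, 0) w w"
  by (simp add: has_weak_partial_def multi_order_def)

text \<open>Testing with \<open>partial j \<phi>\<close> shows it. It presents derivatives of order
  k + 1 as first derivatives of those of order k, so that an H1 inequality can be iterated.\<close>

lemma has_weak_partial_shift:
  assumes "has_weak_partial D \<alpha> w g" "has_weak_partial D (shift j \<alpha>) w h"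
  shows "has_weak_partial D (shift j (0, 0)) g h"
proof -
  have "(LINT x|lebesgue_on D. g x * partial j \<phi> x) = - (LINT x|lebesgue_on D. h x * \<phi> x)"
    if \<phi>: "test_function D \<phi>" for \<phi>
  proof -
    have s: "smooth \<phi>" using \<phi> by (simp add: test_function_iff)
    have "(-1) ^ multi_order \<alpha> * (LINT x|lebesgue_on D. g x * partial j \<phi> x)
        = (LINT x|lebesgue_on D. w x * multi_partial \<alpha> (partial j \<phi>) x)"
      using assms(1) test_function_partial[OF \<phi>, of j] by (simp add: has_weak_partial_def)
    also have "\<dots> = (-1) ^ Suc (multi_order \<alpha>) * (LINT x|lebesgue_on D. h x * \<phi> x)"
      using assms(2) \<phi> by (simp add: has_weak_partial_def multi_partial_partial[OF s])
    finally have "(-1) ^ multi_order \<alpha> * (LINT x|lebesgue_on D. g x * partial j \<phi> x)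
        = (-1) ^ multi_order \<alpha> * (- (LINT x|lebesgue_on D. h x * \<phi> x))" by simp
    then show ?thesis by (subst (asm) mult_cancel_left) simp
  qed
  moreover have "partial j \<phi> = multi_partial (shift j (0, 0)) \<phi>" if "test_function D \<phi>" for \<phi>
    using partial_multi_partial[of \<phi> j "(0, 0)"] that by (simp add: test_function_iff)
  moreover have "multi_order (shift j (0, 0)) = 1" by (simp add: multi_order_def[of "(0, 0)"])
  ultimately show ?thesis
    using assms(2) by (simp add: has_weak_partial_def)
qed

text \<open>The converse direction, by which higher weak derivatives of smooth functions are built
  one order at a time.\<close>

lemma has_weak_partial_shift_intro:
  assumes "has_weak_partial D \<alpha> w g" "has_weak_partial D (shift j (0, 0)) g h"
  shows "has_weak_partial D (shift j \<alpha>) w h"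
proof -
  have "(LINT x|lebesgue_on D. w x * multi_partial (shift j \<alpha>) \<phi> x)
      = (-1) ^ multi_order (shift j \<alpha>) * (LINT x|lebesgue_on D. h x * \<phi> x)"
    if \<phi>: "test_function D \<phi>" for \<phi>
  proof -
    have s: "smooth \<phi>" using \<phi> by (simp add: test_function_iff)
    have "(LINT x|lebesgue_on D. w x * multi_partial \<alpha> (partial j \<phi>) x)
       = (-1) ^ multi_order \<alpha> * (LINT x|lebesgue_on D. g x * partial j \<phi> x)"
      using assms(1) test_function_partial[OF \<phi>, of j] by (simp add: has_weak_partial_def)
    also have "(LINT x|lebesgue_on D. g x * partial j \<phi> x) = - (LINT x|lebesgue_on D. h x * \<phi> x)"
      using assms(2) \<phi> partial_multi_partial[OF s, of j "(0, 0)"] multi_order_shift[of j "(0, 0)"]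
      by (simp add: has_weak_partial_def multi_order_def[of "(0, 0)"])
    finally show ?thesis by (simp add: multi_partial_partial[OF s])
  qed
  then show ?thesis using assms(2) by (simp add: has_weak_partial_def)
qed

lemma has_weak_partial_mono:
  assumes "open D'" "D' \<subseteq> D" "has_weak_partial D \<alpha> w g"
  shows "has_weak_partial D' \<alpha> w g"
proof -
  have gs: "square_integrable D g" using assms by (simp add: has_weak_partial_def)
  have "(LINT x|lebesgue_on D'. w x * multi_partial \<alpha> \<phi> x) =
        (-1) ^ multi_order \<alpha> * (LINT x|lebesgue_on D'. g x * \<phi> x)"
    if \<phi>: "test_function D' \<phi>" for \<phi>
  proof -
    note eq = integral_lebesgue_on_zero_outside[OF opn assms(1,2)]
    have "(LINT x|lebesgue_on D'. w x * multi_partial \<alpha> \<phi> x) = (LINT x|lebesgue_on D. w x * multi_partial \<alpha> \<phi> x)"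
      by (rule eq) (use test_function_zero[OF test_function_multi_partial[OF \<phi>]] in auto)
    moreover have "(LINT x|lebesgue_on D'. g x * \<phi> x) = (LINT x|lebesgue_on D. g x * \<phi> x)"
      by (rule eq) (use test_function_zero[OF \<phi>] in auto)
    ultimately show ?thesis
      using assms(3) test_function_mono[OF \<phi> assms(2)] by (simp add: has_weak_partial_def)
  qed
  then show ?thesis
    using square_integrable_mono(1)[OF _ _ assms(2) gs] assms(1) opn
    by (simp add: has_weak_partial_def borel_open)
qed

text \<open>The choice made by \<open>weak_partial\<close> is determined only up to null sets; norms
  notice it only through \<open>nsq\<close>, which is independent of the choice.\<close>

lemma weak_partial_eq:
  assumes "has_weak_partial D \<alpha> w g"
  shows "has_weak_partial D \<alpha> w (weak_partial D \<alpha> w)"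
    "AE x in lebesgue_on D. weak_partial D \<alpha> w x = g x" "nsq D (weak_partial D \<alpha> w) = nsq D g"
proof -
  show 1: "has_weak_partial D \<alpha> w (weak_partial D \<alpha> w)"
    unfolding weak_partial_def using assms by (rule someI[of "has_weak_partial D \<alpha> w"])
  from has_weak_partial_unique[OF this assms]
  show 2: "AE x in lebesgue_on D. weak_partial D \<alpha> w x = g x" .
  show "nsq D (weak_partial D \<alpha> w) = nsq D g"
    by (rule nsq_cong_AE[OF _ _ 2]) (use 1 assms in \<open>auto simp: has_weak_partial_def square_integrable_def\<close>)
qed

lemma sobolev_weak_partial:
  "w \<in> sobolev k D \<Longrightarrow> multi_order \<alpha> \<le> k \<Longrightarrow> has_weak_partial D \<alpha> w (weak_partial D \<alpha> w)"
  using weak_partial_eq(1) unfolding sobolev_def by blast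

lemma sobolev_square_integrable: "w \<in> sobolev k D \<Longrightarrow> square_integrable D w"
  by (simp add: sobolev_def)

end

section \<open>Sobolev norms in squared form\<close>

lemma finite_multi_order: "finite {\<alpha>. multi_order \<alpha> \<le> k}" "finite {\<alpha>. multi_order \<alpha> = k}"
proof -
  have "{\<alpha>. multi_order \<alpha> \<le> k} \<subseteq> {..k} \<times> {..k}" by (auto simp: multi_order_def)
  then show "finite {\<alpha>. multi_order \<alpha> \<le> k}" by (rule finite_subset) simp
  then show "finite {\<alpha>. multi_order \<alpha> = k}" by (rule rev_finite_subset) auto
qed

lemma sobolev_norm_sq: "(sobolev_norm k D w)\<^sup>2 = (\<Sum>\<alpha> | multi_order \<alpha> \<le> k. nsq D (weak_partial D \<alpha> w))"
  by (simp add: sobolev_norm_def L2_norm_on_sq sum_nonneg)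

lemma sobolev_seminorm_sq: "(sobolev_seminorm k D w)\<^sup>2 = (\<Sum>\<alpha> | multi_order \<alpha> = k. nsq D (weak_partial D \<alpha> w))"
  by (simp add: sobolev_seminorm_def L2_norm_on_sq sum_nonneg)

lemma sobolev_norm_nonneg: "0 \<le> sobolev_norm k D w" "0 \<le> sobolev_seminorm k D w"
  by (auto simp: sobolev_norm_def sobolev_seminorm_def intro: sum_nonneg)

context bounded_open
begin

lemma nsq_weak_partial_le_norm:
  "multi_order \<alpha> \<le> k \<Longrightarrow> nsq D (weak_partial D \<alpha> w) \<le> (sobolev_norm k D w)\<^sup>2"
  unfolding sobolev_norm_sq by (rule member_le_sum) (auto simp: finite_multi_order)

lemma nsq_le_norm:
  assumes "w \<in> sobolev k D"
  shows "nsq D w \<le> (sobolev_norm k D w)\<^sup>2"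
  using nsq_weak_partial_le_norm[of "(0, 0)" k w]
    weak_partial_eq(3)[OF has_weak_partial_0[OF sobolev_square_integrable[OF assms]]]
  by (simp add: multi_order_def)

lemma sobolev_lincomb:
  assumes "w \<in> sobolev k D" "v \<in> sobolev k D"
  shows "(\<lambda>x. a * w x + b * v x) \<in> sobolev k D"
    "(sobolev_norm k D (\<lambda>x. a * w x + b * v x))\<^sup>2
      \<le> 2 * a\<^sup>2 * (sobolev_norm k D w)\<^sup>2 + 2 * b\<^sup>2 * (sobolev_norm k D v)\<^sup>2"
proof -
  note sq = assms[THEN sobolev_square_integrable]
  have h: "has_weak_partial D \<alpha> (\<lambda>x. a * w x + b * v x)
      (\<lambda>x. a * weak_partial D \<alpha> w x + b * weak_partial D \<alpha> v x)" if "multi_order \<alpha> \<le> k" for \<alpha>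
    by (intro has_weak_partial_lincomb sq sobolev_weak_partial[OF assms(1) that]
        sobolev_weak_partial[OF assms(2) that])
  show "(\<lambda>x. a * w x + b * v x) \<in> sobolev k D"
    unfolding sobolev_def
    using h square_integrable_add[OF square_integrable_cmult[OF sq(1)] square_integrable_cmult[OF sq(2)]]
    by blast
  have "nsq D (weak_partial D \<alpha> (\<lambda>x. a * w x + b * v x))
      \<le> 2 * a\<^sup>2 * nsq D (weak_partial D \<alpha> w) + 2 * b\<^sup>2 * nsq D (weak_partial D \<alpha> v)"
    if \<alpha>: "multi_order \<alpha> \<le> k" for \<alpha>
  proof -
    have s: "square_integrable D (weak_partial D \<alpha> w)" "square_integrable D (weak_partial D \<alpha> v)"
      using sobolev_weak_partial[OF assms(1) \<alpha>] sobolev_weak_partial[OF assms(2) \<alpha>]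
      by (auto simp: has_weak_partial_def)
    show ?thesis
      using nsq_add[OF square_integrable_cmult[OF s(1), of a] square_integrable_cmult[OF s(2), of b]]
      unfolding weak_partial_eq(3)[OF h[OF \<alpha>]] nsq_cmult by simp
  qed
  then show "(sobolev_norm k D (\<lambda>x. a * w x + b * v x))\<^sup>2
      \<le> 2 * a\<^sup>2 * (sobolev_norm k D w)\<^sup>2 + 2 * b\<^sup>2 * (sobolev_norm k D v)\<^sup>2"
    unfolding sobolev_norm_sq sum_distrib_left sum.distrib[symmetric] by (intro sum_mono) auto
qed

lemma sobolev_diff:
  assumes "w \<in> sobolev k D" "v \<in> sobolev k D"
  shows "(\<lambda>x. w x - v x) \<in> sobolev k D"
    "(sobolev_norm k D (\<lambda>x. w x - v x))\<^sup>2 \<le> 2 * (sobolev_norm k D w)\<^sup>2 + 2 * (sobolev_norm k D v)\<^sup>2"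
  using sobolev_lincomb[OF assms, of 1 "-1"] by simp_all

lemma sobolev_add:
  assumes "w \<in> sobolev k D" "v \<in> sobolev k D"
  shows "(\<lambda>x. w x + v x) \<in> sobolev k D"
    "(sobolev_norm k D (\<lambda>x. w x + v x))\<^sup>2 \<le> 2 * (sobolev_norm k D w)\<^sup>2 + 2 * (sobolev_norm k D v)\<^sup>2"
  using sobolev_lincomb[OF assms, of 1 1] by simp_all

lemma sobolev_level_mono: "l \<le> k \<Longrightarrow> sobolev k D \<subseteq> sobolev l D"
  by (auto simp: sobolev_def)

lemma sobolev_domain_mono:
  assumes D': "open D'" "D' \<subseteq> D" and w: "w \<in> sobolev k D"
  shows "w \<in> sobolev k D'" "sobolev_norm k D' w \<le> sobolev_norm k D w"
proof -
  interpret D': bounded_open D' using D' bdd by unfold_locales (auto intro: bounded_subset)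
  have h: "has_weak_partial D' \<alpha> w (weak_partial D \<alpha> w)" if "multi_order \<alpha> \<le> k" for \<alpha>
    by (rule has_weak_partial_mono[OF D' sobolev_weak_partial[OF w that]])
  have m: "D' \<in> sets lebesgue" "D \<in> sets lebesgue" using D' opn by (auto simp: borel_open)
  show "w \<in> sobolev k D'"
    using h square_integrable_mono(1)[OF m D'(2) sobolev_square_integrable[OF w]]
    by (auto simp: sobolev_def)
  have "(sobolev_norm k D' w)\<^sup>2 \<le> (sobolev_norm k D w)\<^sup>2"
    unfolding sobolev_norm_sq
  proof (rule sum_mono)
    fix \<alpha> assume "\<alpha> \<in> {\<alpha>. multi_order \<alpha> \<le> k}"
    then have \<alpha>: "multi_order \<alpha> \<le> k" by simp
    show "nsq D' (weak_partial D' \<alpha> w) \<le> nsq D (weak_partial D \<alpha> w)"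
      unfolding D'.weak_partial_eq(3)[OF h[OF \<alpha>]]
      using square_integrable_mono(2)[OF m D'(2)] sobolev_weak_partial[OF w \<alpha>]
      by (simp add: has_weak_partial_def)
  qed
  then show "sobolev_norm k D' w \<le> sobolev_norm k D w"
    by (rule power2_le_imp_le) (rule sobolev_norm_nonneg)
qed

end

section \<open>Averaged Taylor polynomials\<close>

definition quad :: "real \<Rightarrow> real \<Rightarrow> real \<Rightarrow> real \<Rightarrow> real \<Rightarrow> real \<Rightarrow> real^2 \<Rightarrow> real" where
  "quad a b c d e f x = a + b * x$1 + c * x$2 + d * (x$1)\<^sup>2 + e * (x$1 * x$2) + f * (x$2)\<^sup>2"

lemma quadratics_iff: "p \<in> quadratics \<longleftrightarrow> (\<exists>a b c d e f. p = quad a b c d e f)"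
  unfolding quadratics_def quad_def fun_eq_iff by simp

lemma quad_in_quadratics: "quad a b c d e f \<in> quadratics"
  unfolding quadratics_iff by blast

lemma has_derivative_quad:
  "(quad a b c d e f has_derivative
     (\<lambda>h. (b + 2 * d * x$1 + e * x$2) * h$1 + (c + e * x$1 + 2 * f * x$2) * h$2)) (at x)"
proof -
  have n: "((\<lambda>x::real^2. x $ i) has_derivative (\<lambda>h. h $ i)) (at x)" for i
    by (rule bounded_linear.has_derivative[OF bounded_linear_vec_nth has_derivative_ident])
  show ?thesis
    unfolding quad_def
    by (rule has_derivative_eq_rhs, (rule derivative_intros n)+)
       (simp add: fun_eq_iff algebra_simps power2_eq_square)
qed

lemma partial_quad [simp]:
  "partial 1 (quad a b c d e f) = quad b (2 * d) e 0 0 0"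
  "partial 2 (quad a b c d e f) = quad c e (2 * f) 0 0 0"
  unfolding partial_eqI[OF has_derivative_quad] by (auto simp: quad_def)

lemma quad_differentiable: "quad a b c d e f differentiable_on UNIV"
  unfolding differentiable_on_def differentiable_def using has_derivative_quad by blast

lemma partial_quadratics: "p \<in> quadratics \<Longrightarrow> partial j p \<in> quadratics"
  using exhaust_2[of j] unfolding quadratics_iff by fastforce

lemma multi_partial_quadratics: "p \<in> quadratics \<Longrightarrow> multi_partial \<alpha> p \<in> quadratics"
proof -
  have "p \<in> quadratics \<Longrightarrow> (partial j ^^ n) p \<in> quadratics" for j n p
    by (induction n) (auto intro: partial_quadratics)
  then show "p \<in> quadratics \<Longrightarrow> multi_partial \<alpha> p \<in> quadratics" by (simp add: multi_partial_def)
qed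

lemma smooth_quadratics: "p \<in> quadratics \<Longrightarrow> smooth p"
  unfolding smooth_def using multi_partial_quadratics quad_differentiable
  by (metis quadratics_iff)

lemma quad_lincomb:
  "(\<lambda>x. r * quad a b c d e f x + s * quad a' b' c' d' e' f' x)
    = quad (r*a + s*a') (r*b + s*b') (r*c + s*c') (r*d + s*d') (r*e + s*e') (r*f + s*f')"
  by (auto simp: quad_def fun_eq_iff algebra_simps)

lemma quadratics_lincomb:
  assumes "p \<in> quadratics" "q \<in> quadratics"
  shows "(\<lambda>x. r * p x + s * q x) \<in> quadratics"
proof -
  obtain a b c d e f where p: "p = quad a b c d e f" using assms(1) unfolding quadratics_iff by blast
  obtain a' b' c' d' e' f' where q: "q = quad a' b' c' d' e' f'" using assms(2) unfolding quadratics_iff by blast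
  show ?thesis unfolding p q quad_lincomb quadratics_iff by blast
qed

lemma quadratics_0: "(\<lambda>x. 0) \<in> quadratics"
proof -
  have "(\<lambda>x. 0) = quad 0 0 0 0 0 0" by (auto simp: quad_def)
  then show ?thesis unfolding quadratics_iff by blast
qed

lemma quadratics_sum:
  "finite I \<Longrightarrow> (\<And>i. i \<in> I \<Longrightarrow> q i \<in> quadratics) \<Longrightarrow> (\<lambda>x. \<Sum>i\<in>I. c i * q i x) \<in> quadratics"
proof (induction I rule: finite_induct)
  case empty
  then show ?case using quadratics_0 by simp
next
  case (insert i I)
  have "(\<lambda>x. c i * q i x + 1 * (\<Sum>i\<in>I. c i * q i x)) \<in> quadratics"
    using insert by (intro quadratics_lincomb) auto
  then show ?case using insert by simp
qed

lemma multi_order_le_2: "multi_order \<alpha> \<le> 2 \<Longrightarrow> \<alpha> \<in> {(0,0), (1,0), (0,1), (2,0), (1,1), (0,2)}"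
proof -
  obtain a b where \<alpha>: "\<alpha> = (a, b)" by force
  assume "multi_order \<alpha> \<le> 2"
  then have "a + b \<le> 2" by (simp add: multi_order_def \<alpha>)
  then have "(a = 0 \<and> b = 0) \<or> (a = 1 \<and> b = 0) \<or> (a = 0 \<and> b = 1) \<or> (a = 2 \<and> b = 0) \<or> (a = 1 \<and> b = 1) \<or> (a = 0 \<and> b = 2)"
    by arith
  then show ?thesis unfolding \<alpha> by auto
qed

lemma multi_partial_quad:
  "multi_partial (0, 0) (quad a b c d e f) = quad a b c d e f"
  "multi_partial (1, 0) (quad a b c d e f) = quad b (2 * d) e 0 0 0"
  "multi_partial (0, 1) (quad a b c d e f) = quad c e (2 * f) 0 0 0"
  "multi_partial (2, 0) (quad a b c d e f) = quad (2 * d) 0 0 0 0 0"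
  "multi_partial (1, 1) (quad a b c d e f) = quad e 0 0 0 0 0"
  "multi_partial (0, 2) (quad a b c d e f) = quad (2 * f) 0 0 0 0 0"
  by (simp_all add: multi_partial_def eval_nat_numeral)

lemma multi_partial_quadratics_3:
  assumes p: "p \<in> quadratics" and \<alpha>: "multi_order \<alpha> = 3"
  shows "multi_partial \<alpha> p = (\<lambda>x. 0)"
proof -
  obtain a b c d e f where p: "p = quad a b c d e f" using p unfolding quadratics_iff by blast
  obtain i j where ij: "\<alpha> = (i, j)" by force
  from \<alpha> have "i + j = 3" by (simp add: ij multi_order_def)
  then have "(i = 0 \<and> j = 3) \<or> (i = 1 \<and> j = 2) \<or> (i = 2 \<and> j = 1) \<or> (i = 3 \<and> j = 0)" by arith
  moreover have "quad 0 0 0 0 0 0 = (\<lambda>x. 0)" by (auto simp: quad_def)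
  ultimately show ?thesis
    unfolding p ij by (elim disjE conjE) (simp_all add: multi_partial_def eval_nat_numeral)
qed

section \<open>Smooth functions and quadratics as Sobolev functions\<close>

context bounded_open
begin

lemma smooth_square_integrable: "smooth p \<Longrightarrow> square_integrable D p"
  by (intro square_integrable_continuous opn bdd smooth_continuous)

text \<open>Each induction step is one integration by parts, legitimate for any growth of p because
  the test function has compact support.\<close>

lemma smooth_has_weak_partial:
  assumes "smooth p"
  shows "has_weak_partial D \<alpha> p (multi_partial \<alpha> p)"
proof (induction \<alpha> rule: shift_induct)
  case 0
  show ?case using has_weak_partial_0[OF smooth_square_integrable[OF assms]] by simp
next
  case (shift j \<alpha>)
  define f where "f = multi_partial \<alpha> p"
  have f: "smooth f" "smooth (partial j f)"
    unfolding f_def by (intro smooth_partial smooth_multi_partial assms)+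
  have fm: "f \<in> borel_measurable borel" "partial j f \<in> borel_measurable borel"
    using f by (auto intro: borel_measurable_continuous_onI smooth_continuous)
  have "(LINT x|lebesgue_on D. f x * partial j \<phi> x) = - (LINT x|lebesgue_on D. partial j f x * \<phi> x)"
    if \<phi>: "test_function D \<phi>" for \<phi>
  proof -
    note p = test_function_partial[OF \<phi>, of j]
    have "(LINT x|lebesgue_on D. f x * partial j \<phi> x) = (LINT x|lborel. f x * partial j \<phi> x)"
      by (rule integral_lebesgue_on_borel(2)[OF opn])
         (use fm borel_test[OF p] test_function_zero[OF p] in auto)
    also have "\<dots> = - (LINT x|lborel. partial j f x * \<phi> x)"
      using f by (intro integration_by_parts[OF _ _ \<phi>] smooth_differentiable smooth_continuous)
    also have "(LINT x|lborel. partial j f x * \<phi> x) = (LINT x|lebesgue_on D. partial j f x * \<phi> x)"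
      by (rule integral_lebesgue_on_borel(2)[OF opn, symmetric])
         (use fm borel_test[OF \<phi>] test_function_zero[OF \<phi>] in auto)
    finally show ?thesis .
  qed
  moreover have "partial j \<phi> = multi_partial (shift j (0, 0)) \<phi>" if "test_function D \<phi>" for \<phi>
    using partial_multi_partial[of \<phi> j "(0, 0)"] that by (simp add: test_function_iff)
  moreover have "multi_order (shift j (0, 0)) = 1" by (simp add: multi_order_def[of "(0, 0)"])
  ultimately have "has_weak_partial D (shift j (0, 0)) f (partial j f)"
    using smooth_square_integrable[OF f(2)] by (simp add: has_weak_partial_def)
  from has_weak_partial_shift_intro[OF shift[folded f_def] this] show ?case
    unfolding f_def partial_multi_partial[OF assms] .
qed

lemma smooth_sobolev: "smooth p \<Longrightarrow> p \<in> sobolev k D"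
  unfolding sobolev_def using smooth_has_weak_partial smooth_square_integrable by blast

text \<open>Only the coefficients vary; the constant comes from the norms of finitely many fixed
  polynomials.\<close>

lemma sobolev_norm_sum_bound:
  assumes "finite I" "\<And>i. i \<in> I \<Longrightarrow> q i \<in> quadratics"
  shows "\<exists>C\<ge>0. \<forall>c. (sobolev_norm k D (\<lambda>x. \<Sum>i\<in>I. c i * q i x))\<^sup>2 \<le> C * (\<Sum>i\<in>I. (c i)\<^sup>2)"
  using assms
proof (induction I rule: finite_induct)
  case empty
  have "(sobolev_norm k D (\<lambda>x. 0))\<^sup>2 \<le> 0"
    using sobolev_lincomb(2)[OF smooth_sobolev smooth_sobolev, OF smooth_quadratics smooth_quadratics,
        OF quadratics_0 quadratics_0, of k 0 0] by simp
  then show ?case by auto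
next
  case (insert i I)
  then obtain C where C: "C \<ge> 0"
    "\<And>c. (sobolev_norm k D (\<lambda>x. \<Sum>i\<in>I. c i * q i x))\<^sup>2 \<le> C * (\<Sum>i\<in>I. (c i)\<^sup>2)" by auto
  define B where "B = max (2 * (sobolev_norm k D (q i))\<^sup>2) (2 * C)"
  have "(sobolev_norm k D (\<lambda>x. \<Sum>i\<in>insert i I. c i * q i x))\<^sup>2 \<le> B * (\<Sum>i\<in>insert i I. (c i)\<^sup>2)" for c
  proof -
    have s: "q i \<in> sobolev k D" "(\<lambda>x. \<Sum>i\<in>I. c i * q i x) \<in> sobolev k D"
      using insert by (auto intro!: smooth_sobolev smooth_quadratics quadratics_sum)
    have "(sobolev_norm k D (\<lambda>x. \<Sum>i\<in>insert i I. c i * q i x))\<^sup>2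
        \<le> 2 * (c i)\<^sup>2 * (sobolev_norm k D (q i))\<^sup>2 + 2 * (sobolev_norm k D (\<lambda>x. \<Sum>i\<in>I. c i * q i x))\<^sup>2"
      using sobolev_lincomb(2)[OF s, of "c i" 1] insert.hyps by simp
    also have "\<dots> \<le> (2 * (sobolev_norm k D (q i))\<^sup>2) * (c i)\<^sup>2 + (2 * C) * (\<Sum>i\<in>I. (c i)\<^sup>2)"
      using C(2)[of c] by simp
    also have "\<dots> \<le> B * (c i)\<^sup>2 + B * (\<Sum>i\<in>I. (c i)\<^sup>2)"
      unfolding B_def by (intro add_mono mult_right_mono sum_nonneg) auto
    finally show ?thesis using insert.hyps by (simp add: distrib_left)
  qed
  moreover have "B \<ge> 0" unfolding B_def by (rule max.coboundedI1) simp
  ultimately show ?case by blast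
qed

end

section \<open>Weighted means and the projection onto quadratics\<close>

locale averaged = bounded_open +
  fixes \<phi> :: "real^2 \<Rightarrow> real"
  assumes \<phi>: "test_function D \<phi>" and \<phi>1: "(LINT x|lebesgue_on D. \<phi> x) = 1"
begin

text \<open>On quadratics the weighted means of the derivatives form a triangular system: those of
  order two fix the leading coefficients, and lower coefficients are then corrected by the moments
  of \<phi>.\<close>

lemma dual_quadratics:
  "\<exists>q. \<forall>\<beta>. multi_order \<beta> \<le> 2 \<longrightarrow> q \<beta> \<in> quadratics \<and> (\<forall>\<gamma>. multi_order \<gamma> \<le> 2 \<longrightarrow>
     (LINT x|lebesgue_on D. multi_partial \<gamma> (q \<beta>) x * \<phi> x) = (if \<gamma> = \<beta> then 1 else 0))"
proof -
  define M where "M f = (LINT x|lebesgue_on D. f x * \<phi> x)" for f :: "real^2 \<Rightarrow> real"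
  define m10 where "m10 = M (\<lambda>x. x$1)"
  define m01 where "m01 = M (\<lambda>x. x$2)"
  define m20 where "m20 = M (\<lambda>x. (x$1)\<^sup>2)"
  define m11 where "m11 = M (\<lambda>x. x$1 * x$2)"
  define m02 where "m02 = M (\<lambda>x. (x$2)\<^sup>2)"
  have int: "integrable (lebesgue_on D) (\<lambda>x. f x * \<phi> x)" if "continuous_on UNIV f" for f
    by (intro square_integrable_mult test_sq[OF \<phi>] square_integrable_continuous opn bdd that)
  have Mq: "M (quad a b c d e f) = a + b * m10 + c * m01 + d * m20 + e * m11 + f * m02" for a b c d e f
  proof -
    have i: "integrable (lebesgue_on D) (\<lambda>x. 1 * \<phi> x)" "integrable (lebesgue_on D) (\<lambda>x. x$1 * \<phi> x)"
      "integrable (lebesgue_on D) (\<lambda>x. x$2 * \<phi> x)" "integrable (lebesgue_on D) (\<lambda>x. (x$1)\<^sup>2 * \<phi> x)"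
      "integrable (lebesgue_on D) (\<lambda>x. x$1 * x$2 * \<phi> x)" "integrable (lebesgue_on D) (\<lambda>x. (x$2)\<^sup>2 * \<phi> x)"
      by (intro int continuous_intros)+
    have "M (quad a b c d e f) = (LINT x|lebesgue_on D. a * (1 * \<phi> x) + b * (x$1 * \<phi> x) + c * (x$2 * \<phi> x)
       + d * ((x$1)\<^sup>2 * \<phi> x) + e * (x$1 * x$2 * \<phi> x) + f * ((x$2)\<^sup>2 * \<phi> x))"
      unfolding M_def by (intro Bochner_Integration.integral_cong) (auto simp: quad_def algebra_simps)
    also have "\<dots> = a + b * m10 + c * m01 + d * m20 + e * m11 + f * m02"
      unfolding m10_def m01_def m20_def m11_def m02_def M_def
      using i \<phi>1 by (simp add: Bochner_Integration.integral_add)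
    finally show ?thesis .
  qed
  \<comment> \<open>Solved from the highest order down. For example 1/2 x^2 - m10 x has a first
    derivative of mean 0, and the constant term m10^2 - m20/2 removes its own mean.\<close>
  define q where "q \<beta> =
    (if \<beta> = (0,0) then quad 1 0 0 0 0 0
     else if \<beta> = (1,0) then quad (- m10) 1 0 0 0 0
     else if \<beta> = (0,1) then quad (- m01) 0 1 0 0 0
     else if \<beta> = (2,0) then quad (m10\<^sup>2 - m20 / 2) (- m10) 0 (1 / 2) 0 0
     else if \<beta> = (1,1) then quad (2 * m10 * m01 - m11) (- m01) (- m10) 0 1 0
     else quad (m01\<^sup>2 - m02 / 2) 0 (- m01) 0 0 (1 / 2))" for \<beta> :: "nat \<times> nat"
  show ?thesis
  proof (intro exI[of _ q] allI impI conjI)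
    fix \<beta> show "q \<beta> \<in> quadratics" by (simp add: q_def quad_in_quadratics)
  next
    fix \<beta> \<gamma> assume "multi_order \<beta> \<le> 2" "multi_order \<gamma> \<le> 2"
    then have *: "\<beta> \<in> {(0,0), (1,0), (0,1), (2,0), (1,1), (0,2)}" "\<gamma> \<in> {(0,0), (1,0), (0,1), (2,0), (1,1), (0,2)}"
      using multi_order_le_2 by blast+
    have qs: "q (0,0) = quad 1 0 0 0 0 0" "q (1,0) = quad (- m10) 1 0 0 0 0"
      "q (0,1) = quad (- m01) 0 1 0 0 0" "q (2,0) = quad (m10\<^sup>2 - m20 / 2) (- m10) 0 (1 / 2) 0 0"
      "q (1,1) = quad (2 * m10 * m01 - m11) (- m01) (- m10) 0 1 0"
      "q (0,2) = quad (m01\<^sup>2 - m02 / 2) 0 (- m01) 0 0 (1 / 2)"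
      by (simp_all add: q_def)
    have "M (multi_partial \<gamma> (q \<beta>)) = (if \<gamma> = \<beta> then 1 else 0)"
      using * by (elim insertE emptyE;
          simp del: One_nat_def add: qs multi_partial_quad Mq power2_eq_square)
    then show "(LINT x|lebesgue_on D. multi_partial \<gamma> (q \<beta>) x * \<phi> x) = (if \<gamma> = \<beta> then 1 else 0)"
      by (simp add: M_def)
  qed
qed

definition dualq :: "nat \<times> nat \<Rightarrow> real^2 \<Rightarrow> real" where
  "dualq = (SOME q. \<forall>\<beta>. multi_order \<beta> \<le> 2 \<longrightarrow> q \<beta> \<in> quadratics \<and> (\<forall>\<gamma>. multi_order \<gamma> \<le> 2 \<longrightarrow>
     (LINT x|lebesgue_on D. multi_partial \<gamma> (q \<beta>) x * \<phi> x) = (if \<gamma> = \<beta> then 1 else 0)))"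

lemma dualq:
  assumes "multi_order \<beta> \<le> 2"
  shows "dualq \<beta> \<in> quadratics"
    "multi_order \<gamma> \<le> 2 \<Longrightarrow>
      (LINT x|lebesgue_on D. multi_partial \<gamma> (dualq \<beta>) x * \<phi> x) = (if \<gamma> = \<beta> then 1 else 0)"
  using someI_ex[OF dual_quadratics, folded dualq_def] assms by blast+

definition coef :: "nat \<times> nat \<Rightarrow> (real^2 \<Rightarrow> real) \<Rightarrow> real" where
  "coef \<beta> w = (-1) ^ multi_order \<beta> * (LINT x|lebesgue_on D. w x * multi_partial \<beta> \<phi> x)"

text \<open>\<open>coef \<beta> w\<close> is the \<open>\<phi>\<close>-weighted mean of \<open>D\<^sup>\<beta> w\<close>, with the derivatives moved to \<open>\<phi>\<close> so that it is defined and
  bounded on \<open>L\<^sup>2\<close>; \<open>dualq\<close> is the dual basis of the quadratics.\<close>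

definition proj :: "(real^2 \<Rightarrow> real) \<Rightarrow> real^2 \<Rightarrow> real" where
  "proj w x = (\<Sum>\<beta> | multi_order \<beta> \<le> 2. coef \<beta> w * dualq \<beta> x)"

lemma coef_lincomb:
  assumes "square_integrable D w" "square_integrable D v"
  shows "coef \<beta> (\<lambda>x. a * w x + b * v x) = a * coef \<beta> w + b * coef \<beta> v"
  using square_integrable_mult[OF assms(1) multi_partial_sq[OF \<phi>, of \<beta>]]
    square_integrable_mult[OF assms(2) multi_partial_sq[OF \<phi>, of \<beta>]]
  by (simp add: coef_def distrib_right distrib_left mult.assoc mult.left_commute)

lemma proj_lincomb:
  assumes "square_integrable D w" "square_integrable D v"
  shows "proj (\<lambda>x. a * w x + b * v x) x = a * proj w x + b * proj v x"
  by (simp add: proj_def coef_lincomb[OF assms] distrib_right sum.distrib sum_distrib_left mult.assoc)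

lemma coef_bound:
  assumes "square_integrable D w"
  shows "(coef \<beta> w)\<^sup>2 \<le> nsq D (multi_partial \<beta> \<phi>) * nsq D w"
  using Cauchy_Schwarz_nsq[OF assms multi_partial_sq[OF \<phi>, of \<beta>]]
  by (simp add: coef_def power_mult_distrib mult.commute power_mult[symmetric])

lemma proj_quadratics: "proj w \<in> quadratics"
  unfolding proj_def by (rule quadratics_sum[OF finite_multi_order(1)]) (simp add: dualq)

lemma coef_eq:
  assumes "has_weak_partial D \<beta> w g"
  shows "coef \<beta> w = (LINT x|lebesgue_on D. g x * \<phi> x)"
  using assms \<phi> by (simp add: coef_def has_weak_partial_def mult.assoc[symmetric] power_mult_distrib[symmetric])

lemma coef_dualq:
  assumes "multi_order \<beta> \<le> 2" "multi_order \<gamma> \<le> 2"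
  shows "coef \<gamma> (dualq \<beta>) = (if \<gamma> = \<beta> then 1 else 0)"
  using coef_eq[OF smooth_has_weak_partial[OF smooth_quadratics[OF dualq(1)[OF assms(1)]]], of \<gamma>]
    dualq(2)[OF assms] by simp

lemma coef_sum:
  assumes "finite I" "\<And>i. i \<in> I \<Longrightarrow> square_integrable D (q i)"
  shows "coef \<gamma> (\<lambda>x. \<Sum>i\<in>I. c i * q i x) = (\<Sum>i\<in>I. c i * coef \<gamma> (q i))"
  using assms
proof (induction I rule: finite_induct)
  case empty
  show ?case by (simp add: coef_def)
next
  case (insert i I)
  have "square_integrable D (\<lambda>x. \<Sum>i\<in>I. c i * q i x)"
    using insert by (intro square_integrable_sum square_integrable_cmult) auto
  then show ?case
    using coef_lincomb[of "q i" "\<lambda>x. \<Sum>i\<in>I. c i * q i x" \<gamma> "c i" 1] insert by simp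
qed

lemma coef_proj:
  assumes "multi_order \<gamma> \<le> 2"
  shows "coef \<gamma> (proj w) = coef \<gamma> w"
proof -
  have "coef \<gamma> (proj w) = (\<Sum>\<beta> | multi_order \<beta> \<le> 2. coef \<beta> w * coef \<gamma> (dualq \<beta>))"
    unfolding proj_def[abs_def]
    by (rule coef_sum[OF finite_multi_order(1)]) (auto intro: smooth_square_integrable smooth_quadratics dualq)
  also have "\<dots> = (\<Sum>\<beta> | multi_order \<beta> \<le> 2. if \<gamma> = \<beta> then coef \<beta> w else 0)"
    by (rule sum.cong) (use coef_dualq assms in auto)
  also have "\<dots> = coef \<gamma> w" using assms by (simp add: finite_multi_order)
  finally show ?thesis .
qed

text \<open>Applied with D' = D and with D' = \<Omega>: the polynomial has to be controlled on the
  whole domain by values on D, which works because only its finitely many coefficients depend on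
  w.\<close>

lemma proj_bound:
  assumes "bounded_open D'"
  shows "\<exists>C\<ge>0. \<forall>w. square_integrable D w \<longrightarrow> (sobolev_norm k D' (proj w))\<^sup>2 \<le> C * nsq D w"
proof -
  interpret D': bounded_open D' by fact
  obtain C where C: "C \<ge> 0" "\<And>c. (sobolev_norm k D' (\<lambda>x. \<Sum>\<beta> | multi_order \<beta> \<le> 2. c \<beta> * dualq \<beta> x))\<^sup>2
      \<le> C * (\<Sum>\<beta> | multi_order \<beta> \<le> 2. (c \<beta>)\<^sup>2)"
    using D'.sobolev_norm_sum_bound[OF finite_multi_order(1)[of 2], of dualq k] dualq(1) by auto
  define K where "K = (\<Sum>\<beta> | multi_order \<beta> \<le> 2. nsq D (multi_partial \<beta> \<phi>))"
  have K: "K \<ge> 0" by (simp add: K_def sum_nonneg)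
  have "(sobolev_norm k D' (proj w))\<^sup>2 \<le> (C * K) * nsq D w" if w: "square_integrable D w" for w
  proof -
    have "(sobolev_norm k D' (proj w))\<^sup>2 \<le> C * (\<Sum>\<beta> | multi_order \<beta> \<le> 2. (coef \<beta> w)\<^sup>2)"
      using C(2)[of "\<lambda>\<beta>. coef \<beta> w"] by (simp add: proj_def[abs_def])
    also have "\<dots> \<le> C * (\<Sum>\<beta> | multi_order \<beta> \<le> 2. nsq D (multi_partial \<beta> \<phi>) * nsq D w)"
      using coef_bound[OF w] by (intro mult_left_mono sum_mono C)
    finally show ?thesis by (simp add: K_def sum_distrib_right mult.assoc)
  qed
  then show ?thesis using C K by (intro exI[of _ "C * K"]) auto
qed

lemma sobolev_proj_estimate:
  assumes P: "P \<ge> 0" and poincare: "\<And>w. w \<in> sobolev 1 D \<Longrightarrow> (LINT x|lebesgue_on D. w x * \<phi> x) = 0 \<Longrightarrow>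
      nsq D w \<le> P * (\<Sum>j\<in>UNIV. nsq D (weak_partial D (shift j (0, 0)) w))"
  shows "\<exists>C\<ge>0. \<forall>w\<in>sobolev 3 D.
    (sobolev_norm 3 D (\<lambda>x. w x - proj w x))\<^sup>2 \<le> C * (sobolev_seminorm 3 D w)\<^sup>2"
proof -
  define N where "N = real (card {\<alpha>. multi_order \<alpha> \<le> 3})"
  \<comment> \<open>P stems from the assumed inequality, 2 counts the first derivatives of each
    derivative, and N is a crude bound for the number of derivatives of one order.\<close>
  define M where "M = N * (2 * P)"
  have M: "M \<ge> 0" using P by (simp add: M_def N_def)
  have "(sobolev_norm 3 D (\<lambda>x. w x - proj w x))\<^sup>2 \<le> (M * M * M + M * M + M + 1) * (sobolev_seminorm 3 D w)\<^sup>2"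
    if w: "w \<in> sobolev 3 D" for w
  proof -
    have ps: "smooth (proj w)" by (rule smooth_quadratics[OF proj_quadratics])
    define v where "v = (\<lambda>x. w x - proj w x)"
    have v: "v \<in> sobolev 3 D" unfolding v_def by (rule sobolev_diff(1)[OF w smooth_sobolev[OF ps]])
    define S where "S k = (\<Sum>\<alpha> | multi_order \<alpha> = k. nsq D (weak_partial D \<alpha> v))" for k
    have S0: "S k \<ge> 0" for k by (simp add: S_def sum_nonneg)
    have step: "S k \<le> M * S (Suc k)" if k: "k \<le> 2" for k
    proof -
      have each: "nsq D (weak_partial D \<beta> v) \<le> 2 * P * S (Suc k)" if \<beta>: "multi_order \<beta> = k" for \<beta>
      proof -
        define g where "g = weak_partial D \<beta> v"
        have \<beta>3: "multi_order \<beta> \<le> 3" "multi_order (shift j \<beta>) \<le> 3" for j using \<beta> k by auto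
        have h: "has_weak_partial D \<beta> v g" unfolding g_def by (rule sobolev_weak_partial[OF v \<beta>3(1)])
        have hs: "has_weak_partial D (shift j (0, 0)) g (weak_partial D (shift j \<beta>) v)" for j
          by (rule has_weak_partial_shift[OF h sobolev_weak_partial[OF v \<beta>3(2)]])
        have gsq: "square_integrable D g" using h by (simp add: has_weak_partial_def)
        have g1: "g \<in> sobolev 1 D"
        proof -
          have "\<exists>h. has_weak_partial D \<alpha> g h" if "multi_order \<alpha> \<le> 1" for \<alpha>
          proof -
            obtain a b where ab: "\<alpha> = (a, b)" by force
            have "a + b \<le> 1" using that by (simp add: ab multi_order_def)
            then have "\<alpha> = (0, 0) \<or> \<alpha> = shift 1 (0, 0) \<or> \<alpha> = shift 2 (0, 0)"
              unfolding ab shift_def by (cases a; cases b) auto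
            then show ?thesis using has_weak_partial_0[OF gsq] hs by blast
          qed
          then show ?thesis using gsq unfolding sobolev_def by blast
        qed
        \<comment> \<open>The projection keeps all \<open>coef\<close> up to order two, so the
          derivative g of v has weighted mean 0 and the assumed inequality applies to it.\<close>
        have "(LINT x|lebesgue_on D. g x * \<phi> x) = coef \<beta> v" by (rule coef_eq[OF h, symmetric])
        also have "\<dots> = coef \<beta> w - coef \<beta> (proj w)"
          using coef_lincomb[OF sobolev_square_integrable[OF w] smooth_square_integrable[OF ps], of \<beta> 1 "-1"]
          by (simp add: v_def)
        also have "\<dots> = 0" using coef_proj[of \<beta> w] \<beta> k by simp
        finally have "nsq D g \<le> P * (\<Sum>j\<in>UNIV. nsq D (weak_partial D (shift j (0, 0)) g))"
          by (rule poincare[OF g1])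
        also have "\<dots> = P * (\<Sum>j\<in>UNIV. nsq D (weak_partial D (shift j \<beta>) v))"
          using weak_partial_eq(3)[OF hs] by simp
        also have "\<dots> \<le> P * (\<Sum>j\<in>(UNIV :: 2 set). S (Suc k))"
        proof (intro mult_left_mono sum_mono P)
          fix j
          show "nsq D (weak_partial D (shift j \<beta>) v) \<le> S (Suc k)"
            unfolding S_def by (rule member_le_sum) (auto simp: \<beta> finite_multi_order)
        qed
        finally show ?thesis by (simp add: g_def)
      qed
      have "S k \<le> (\<Sum>\<alpha> | multi_order \<alpha> = k. 2 * P * S (Suc k))"
        unfolding S_def[of k] by (rule sum_mono) (use each in auto)
      also have "\<dots> = real (card {\<alpha>. multi_order \<alpha> = k}) * (2 * P * S (Suc k))" by simp
      also have "\<dots> \<le> N * (2 * P * S (Suc k))"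
      proof (rule mult_right_mono)
        have "card {\<alpha>. multi_order \<alpha> = k} \<le> card {\<alpha>. multi_order \<alpha> \<le> 3}"
          using k by (intro card_mono finite_multi_order) auto
        then show "real (card {\<alpha>. multi_order \<alpha> = k}) \<le> N" by (simp add: N_def)
      qed (use P S0 in simp)
      finally show ?thesis by (simp add: M_def)
    qed
    have s2: "S 2 \<le> M * S 3" and s1: "S 1 \<le> M * S 2" and s0: "S 0 \<le> M * S 1"
      using step[of 2] step[of 1] step[of 0] by (simp_all add: eval_nat_numeral)
    have s1': "S 1 \<le> M * M * S 3" using order_trans[OF s1 mult_left_mono[OF s2 M]] by (simp add: mult.assoc)
    have s0': "S 0 \<le> M * M * M * S 3" using order_trans[OF s0 mult_left_mono[OF s1' M]] by (simp add: mult.assoc)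
    have "{\<alpha>. multi_order \<alpha> \<le> 3} = (\<Union>k\<in>{..3}. {\<alpha>. multi_order \<alpha> = k})" by auto
    then have "(sobolev_norm 3 D v)\<^sup>2 = (\<Sum>k\<in>{..3}. S k)"
      unfolding sobolev_norm_sq S_def by (simp add: sum.UNION_disjoint finite_multi_order disjoint_iff)
    also have "\<dots> = S 0 + S 1 + S 2 + S 3" by (simp add: eval_nat_numeral)
    also have "\<dots> \<le> (M * M * M + M * M + M + 1) * S 3"
      using s0' s1' s2 by (simp add: distrib_right)
    \<comment> \<open>Third derivatives of a quadratic vanish, so the top-order term does not see
      the projection.\<close>
    also have "S 3 = (sobolev_seminorm 3 D w)\<^sup>2"
      unfolding S_def sobolev_seminorm_sq
    proof (rule sum.cong[OF refl])
      fix \<alpha> assume "\<alpha> \<in> {\<alpha>. multi_order \<alpha> = 3}"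
      then have \<alpha>: "multi_order \<alpha> = 3" by simp
      have "has_weak_partial D \<alpha> (\<lambda>x. 1 * w x + (-1) * proj w x)
          (\<lambda>x. 1 * weak_partial D \<alpha> w x + (-1) * multi_partial \<alpha> (proj w) x)"
        by (intro has_weak_partial_lincomb sobolev_square_integrable[OF w] smooth_square_integrable[OF ps]
            smooth_has_weak_partial[OF ps] sobolev_weak_partial[OF w]) (simp add: \<alpha>)
      from weak_partial_eq(3)[OF this]
      show "nsq D (weak_partial D \<alpha> v) = nsq D (weak_partial D \<alpha> w)"
        by (simp add: v_def multi_partial_quadratics_3[OF proj_quadratics \<alpha>])
    qed
    finally show ?thesis by (simp add: v_def)
  qed
  moreover have "M * M * M + M * M + M + 1 \<ge> 0" using M by simp
  ultimately show ?thesis by blast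
qed

end

section \<open>The Poincare inequality on subdomains with an extension operator\<close>

definition gsq :: "(real^2) set \<Rightarrow> (real^2 \<Rightarrow> real) \<Rightarrow> real" where
  "gsq D w = (\<Sum>j\<in>UNIV. nsq D (weak_partial D (shift j (0, 0)) w))"

lemma gsq_nonneg [simp]: "0 \<le> gsq D w"
  by (simp add: gsq_def sum_nonneg)

lemma nsq_indicator:
  assumes "S \<in> sets lebesgue"
  shows "nsq S f = (LINT x|lebesgue. indicator S x * (f x)\<^sup>2)"
    "square_integrable S f \<Longrightarrow> integrable lebesgue (\<lambda>x. indicator S x * (f x)\<^sup>2)"
proof -
  show "nsq S f = (LINT x|lebesgue. indicator S x * (f x)\<^sup>2)"
    using assms by (simp add: nsq_def integral_restrict_space)
  show "square_integrable S f \<Longrightarrow> integrable lebesgue (\<lambda>x. indicator S x * (f x)\<^sup>2)"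
    using assms integrable_restrict_space[of S lebesgue "\<lambda>x. (f x)\<^sup>2"]
    by (simp add: square_integrable_def)
qed

text \<open>The negligible set N takes up the lines along which a domain is cut and the boundaries
  of triangles.\<close>

lemma nsq_cover:
  assumes S: "S \<in> sets lebesgue" "square_integrable S f" and fin: "finite I"
    and U: "\<And>i. i \<in> I \<Longrightarrow> U i \<in> sets lebesgue \<and> square_integrable (U i) f"
    and N: "negligible N" and cover: "S \<subseteq> (\<Union>i\<in>I. U i) \<union> N"
  shows "nsq S f \<le> (\<Sum>i\<in>I. nsq (U i) f)"
proof -
  have int: "integrable lebesgue (\<lambda>x. indicator (U i) x * (f x)\<^sup>2)" if "i \<in> I" for i
    using U[OF that] nsq_indicator(2) by blast
  have "nsq S f \<le> (LINT x|lebesgue. (\<Sum>i\<in>I. indicator (U i) x * (f x)\<^sup>2))"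
    unfolding nsq_indicator(1)[OF S(1)]
  proof (rule integral_mono_AE)
    show "integrable lebesgue (\<lambda>x. indicator S x * (f x)\<^sup>2)" by (rule nsq_indicator(2)[OF S])
    show "integrable lebesgue (\<lambda>x. \<Sum>i\<in>I. indicator (U i) x * (f x)\<^sup>2)"
      using int by (rule Bochner_Integration.integrable_sum)
    have "AE x in lebesgue. x \<notin> N" using N by (simp add: negligible_iff_null_sets AE_not_in)
    then show "AE x in lebesgue. indicator S x * (f x)\<^sup>2 \<le> (\<Sum>i\<in>I. indicator (U i) x * (f x)\<^sup>2)"
    proof eventually_elim
      case (elim x)
      show ?case
      proof (cases "x \<in> S")
        case True
        with elim cover obtain i where i: "i \<in> I" "x \<in> U i" by blast
        have "indicator (U i) x * (f x)\<^sup>2 \<le> (\<Sum>i\<in>I. indicator (U i) x * (f x)\<^sup>2)"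
          by (rule member_le_sum) (use i fin in auto)
        then show ?thesis using True i by simp
      qed (simp add: sum_nonneg)
    qed
  qed
  also have "\<dots> = (\<Sum>i\<in>I. LINT x|lebesgue. indicator (U i) x * (f x)\<^sup>2)"
    using int by (rule Bochner_Integration.integral_sum)
  also have "\<dots> = (\<Sum>i\<in>I. nsq (U i) f)"
    using U nsq_indicator(1) by (intro sum.cong) auto
  finally show ?thesis .
qed

lemma nsq_disjoint:
  assumes "U \<in> sets lebesgue" "V \<in> sets lebesgue" "D \<in> sets lebesgue" "U \<inter> V = {}" "U \<union> V \<subseteq> D"
    "square_integrable D f"
  shows "nsq U f + nsq V f \<le> nsq D f"
proof -
  have i: "integrable lebesgue (\<lambda>x. indicator U x * (f x)\<^sup>2)" "integrable lebesgue (\<lambda>x. indicator V x * (f x)\<^sup>2)"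
    "integrable lebesgue (\<lambda>x. indicator D x * (f x)\<^sup>2)"
    using assms square_integrable_mono(1)[of _ D f] by (auto intro!: nsq_indicator(2))
  have "nsq U f + nsq V f = (LINT x|lebesgue. indicator U x * (f x)\<^sup>2 + indicator V x * (f x)\<^sup>2)"
    using i by (simp add: nsq_indicator assms)
  also have "\<dots> \<le> (LINT x|lebesgue. indicator D x * (f x)\<^sup>2)"
    by (rule integral_mono) (use i assms(4,5) in \<open>auto simp: indicator_def\<close>)
  finally show ?thesis by (simp add: nsq_indicator assms)
qed

lemma nsq_const:
  assumes "S \<in> lmeasurable"
  shows "nsq S (\<lambda>x. m) = m\<^sup>2 * measure lebesgue S"
  using assms by (simp add: nsq_indicator fmeasurableD mult.commute)

lemma square_integrable_const: "S \<in> lmeasurable \<Longrightarrow> square_integrable S (\<lambda>x. m)"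
  using finite_measure.integrable_const[OF finite_measure_lebesgue_on, of S "m\<^sup>2"]
  by (simp add: square_integrable_def)

section \<open>Gradient norms on subsets, and the Poincare inequality for pairs of sets\<close>

context bounded_open
begin

lemma opn_lebesgue: "D \<in> sets lebesgue" using opn by (simp add: borel_open)

lemma sub_bounded_open: "open U \<Longrightarrow> U \<subseteq> D \<Longrightarrow> bounded_open U"
  using bdd bounded_subset by unfold_locales auto

lemma gradient_square_integrable:
  "w \<in> sobolev 1 D \<Longrightarrow> square_integrable D (weak_partial D (shift j (0, 0)) w)"
  using sobolev_weak_partial[of w 1 "shift j (0, 0)"] multi_order_shift[of j "(0, 0)"]
  by (simp add: has_weak_partial_def multi_order_def[of "(0, 0)"])

lemma has_weak_gradient:
  "w \<in> sobolev 1 D \<Longrightarrow> has_weak_partial D (shift j (0, 0)) w (weak_partial D (shift j (0, 0)) w)"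
  by (rule sobolev_weak_partial) (auto simp: multi_order_def[of "(0, 0)"])

text \<open>\<open>weak_partial U\<close> and \<open>weak_partial D\<close> are separate choices of
  representatives. They agree almost everywhere on U, which makes gradient norms on different sets
  comparable.\<close>

lemma gsq_restrict:
  assumes "open U" "U \<subseteq> D" "w \<in> sobolev 1 D"
  shows "gsq U w = (\<Sum>j\<in>UNIV. nsq U (weak_partial D (shift j (0, 0)) w))"
proof -
  interpret U: bounded_open U by (rule sub_bounded_open[OF assms(1,2)])
  show ?thesis unfolding gsq_def
    using U.weak_partial_eq(3)[OF has_weak_partial_mono[OF assms(1,2) has_weak_gradient[OF assms(3)]]] by simp
qed

lemma gsq_mono:
  assumes "open U" "U \<subseteq> D" "w \<in> sobolev 1 D"
  shows "gsq U w \<le> gsq D w"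
proof -
  have "U \<in> sets lebesgue" using assms(1) by (simp add: borel_open)
  then show ?thesis
    unfolding gsq_restrict[OF assms] gsq_def[of D w]
    using square_integrable_mono(2)[OF _ opn_lebesgue assms(2) gradient_square_integrable[OF assms(3)]]
    by (intro sum_mono) auto
qed

lemma gsq_disjoint:
  assumes "open U" "open V" "U \<inter> V = {}" "U \<union> V \<subseteq> D" "w \<in> sobolev 1 D"
  shows "gsq U w + gsq V w \<le> gsq D w"
proof -
  have l: "U \<in> sets lebesgue" "V \<in> sets lebesgue" using assms by (auto simp: borel_open)
  have "U \<subseteq> D" "V \<subseteq> D" using assms(4) by auto
  then show ?thesis
    unfolding gsq_restrict[OF assms(1) \<open>U \<subseteq> D\<close> assms(5)] gsq_restrict[OF assms(2) \<open>V \<subseteq> D\<close> assms(5)]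
      gsq_def[of D w] sum.distrib[symmetric]
    by (intro sum_mono nsq_disjoint l opn_lebesgue assms(3,4) gradient_square_integrable[OF assms(5)])
qed

lemma sobolev_norm_1_sq:
  assumes "w \<in> sobolev 1 D"
  shows "(sobolev_norm 1 D w)\<^sup>2 = nsq D w + gsq D w"
proof -
  have "{\<alpha>. multi_order \<alpha> \<le> 1} = {(0, 0), shift 1 (0, 0), shift 2 (0, 0)}"
    by (auto simp: multi_order_def shift_def split: if_splits)
  then have "(sobolev_norm 1 D w)\<^sup>2 = nsq D (weak_partial D (0, 0) w) + gsq D w"
    by (simp add: sobolev_norm_sq gsq_def sum_2 shift_def)
  then show ?thesis
    using weak_partial_eq(3)[OF has_weak_partial_0[OF sobolev_square_integrable[OF assms]]] by simp
qed

text \<open>The unknown constant m of the Poincare inequality is estimated on B and reinserted on A.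
  With B = D this bounds the mass of small sets; with A = D it extends a bound from a part to the
  whole. Measures are kept as factors, which avoids division.\<close>

lemma poincare_sets:
  assumes cv: "convex D" and d: "d \<ge> 0" "\<And>x y. x \<in> D \<Longrightarrow> y \<in> D \<Longrightarrow> norm (y - x) \<le> d"
    and w: "w \<in> sobolev 1 D" and A: "A \<in> sets lebesgue" "A \<subseteq> D" and B: "B \<in> sets lebesgue" "B \<subseteq> D"
  shows "measure lebesgue B * nsq A w
    \<le> 24 * d\<^sup>2 * measure lebesgue D * gsq D w + 4 * measure lebesgue A * nsq B w"
proof -
  have ws: "square_integrable D w" by (rule sobolev_square_integrable[OF w])
  have lm: "D \<in> lmeasurable" "A \<in> lmeasurable" "B \<in> lmeasurable"
    using A B opn_lebesgue bdd bounded_subset by (auto intro!: bounded_set_imp_lmeasurable)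
  obtain m where "(LINT x|lebesgue_on D. (w x - m)\<^sup>2)
      \<le> 4 * d\<^sup>2 * (\<Sum>j\<in>UNIV. LINT x|lebesgue_on D. (weak_partial D (shift j (0, 0)) w x)\<^sup>2)"
    using poincare_convex[OF opn cv bdd d ws has_weak_gradient[OF w]] by blast
  then have m: "nsq D (\<lambda>x. w x - m) \<le> 4 * d\<^sup>2 * gsq D w" by (simp add: nsq_def gsq_def)
  define V where "V = nsq D (\<lambda>x. w x - m)"
  have wm: "square_integrable D (\<lambda>x. w x - m)"
    by (rule square_integrable_diff[OF ws square_integrable_const[OF lm(1)]])
  have V: "nsq S (\<lambda>x. w x - m) \<le> V" "square_integrable S (\<lambda>x. w x - m)" "square_integrable S w"
    if "S \<in> sets lebesgue" "S \<subseteq> D" for S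
    using square_integrable_mono[OF that(1) opn_lebesgue that(2) wm]
      square_integrable_mono(1)[OF that(1) opn_lebesgue that(2) ws] by (auto simp: V_def)
  have a: "nsq A w \<le> 2 * V + 2 * (m\<^sup>2 * measure lebesgue A)"
    using nsq_add[OF V(2)[OF A] square_integrable_const[OF lm(2), of m]] V(1)[OF A]
    by (simp add: nsq_const[OF lm(2)])
  have b: "m\<^sup>2 * measure lebesgue B \<le> 2 * V + 2 * nsq B w"
    using nsq_diff[OF V(3)[OF B] V(2)[OF B]] V(1)[OF B] nsq_const[OF lm(3), of m] by simp
  have le: "measure lebesgue A \<le> measure lebesgue D" "measure lebesgue B \<le> measure lebesgue D"
    using A B lm by (auto intro!: measure_mono_fmeasurable)
  have V0: "V \<ge> 0" by (simp add: V_def)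
  have "measure lebesgue B * nsq A w \<le> measure lebesgue B * (2 * V + 2 * (m\<^sup>2 * measure lebesgue A))"
    using a by (intro mult_left_mono) auto
  also have "\<dots> = 2 * (measure lebesgue B * V) + 2 * measure lebesgue A * (m\<^sup>2 * measure lebesgue B)"
    by (simp add: algebra_simps)
  also have "\<dots> \<le> 2 * (measure lebesgue B * V) + 2 * measure lebesgue A * (2 * V + 2 * nsq B w)"
    using b by (intro add_left_mono mult_left_mono) auto
  also have "\<dots> = 2 * (measure lebesgue B * V) + 4 * (measure lebesgue A * V) + 4 * measure lebesgue A * nsq B w"
    by (simp add: algebra_simps)
  \<comment> \<open>Enlarging both measures to that of D gives 6 * V; since V is at most 4 * d^2
    times the gradient term, this is the origin of 24.\<close>
  also have "\<dots> \<le> 2 * (measure lebesgue D * V) + 4 * (measure lebesgue D * V) + 4 * measure lebesgue A * nsq B w"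
    using le V0 by (intro add_mono mult_left_mono mult_right_mono) auto
  also have "\<dots> = 6 * measure lebesgue D * V + 4 * measure lebesgue A * nsq B w" by simp
  also have "\<dots> \<le> 6 * measure lebesgue D * (4 * d\<^sup>2 * gsq D w) + 4 * measure lebesgue A * nsq B w"
    using m by (intro add_right_mono mult_left_mono) (auto simp: V_def)
  finally show ?thesis by (simp add: mult_ac)
qed

end

text \<open>Functions bounded in \<open>H\<^sup>1(D)\<close> cannot concentrate their \<open>L\<^sup>2\<close> norm on sets of small measure.\<close>

definition tight :: "real \<Rightarrow> (real^2) set \<Rightarrow> bool" where
  "tight \<eta> D \<longleftrightarrow> (\<exists>L\<ge>0. \<forall>w\<in>sobolev 1 D. \<forall>S. S \<in> sets lebesgue \<longrightarrow> S \<subseteq> D \<longrightarrow>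
     nsq S w \<le> \<eta> * gsq D w + L * measure lebesgue S * nsq D w)"

lemma nsq_empty [simp]: "nsq {} w = 0"
  by (simp add: nsq_indicator)

text \<open>Take B = D in \<open>poincare_sets\<close> and divide by the measure of D. It survives
  only in L, which may depend on D, whereas the factor of the gradient term depends on the diameter
  alone.\<close>

lemma tight_diameter:
  assumes "bounded_open D" "convex D" and d: "d \<ge> 0" "\<And>x y. x \<in> D \<Longrightarrow> y \<in> D \<Longrightarrow> norm (y - x) \<le> d"
  shows "tight (24 * d\<^sup>2) D"
proof (cases "D = {}")
  case True
  then show ?thesis unfolding tight_def by (intro exI[of _ 0]) auto
next
  case False
  interpret bounded_open D by fact
  have lm: "D \<in> lmeasurable" using bdd opn_lebesgue by (rule bounded_set_imp_lmeasurable)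
  have "measure lebesgue D \<noteq> 0"
    using open_not_negligible[OF opn False] lm negligible_iff_measure by blast
  then have D: "measure lebesgue D > 0" by (simp add: zero_less_measure_iff)
  show ?thesis
    unfolding tight_def
  proof (intro exI[of _ "4 / measure lebesgue D"] conjI ballI allI impI)
    fix w S assume w: "w \<in> sobolev 1 D" and S: "S \<in> sets lebesgue" "S \<subseteq> D"
    have "measure lebesgue D * nsq S w
        \<le> 24 * d\<^sup>2 * measure lebesgue D * gsq D w + 4 * measure lebesgue S * nsq D w"
      by (rule poincare_sets[OF assms(2) d w S opn_lebesgue]) auto
    then show "nsq S w \<le> 24 * d\<^sup>2 * gsq D w + 4 / measure lebesgue D * measure lebesgue S * nsq D w"
      using D by (simp add: field_simps)
  qed simp
qed

text \<open>The gradient terms of disjoint pieces sum to at most that of D, so \<eta> is kept while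
  the constants L are added.\<close>

lemma tight_cut:
  assumes bo: "bounded_open D" and t: "tight \<eta> (D \<inter> {x. x $ j < c})" "tight \<eta> (D \<inter> {x. c < x $ j})"
    and \<eta>: "\<eta> \<ge> 0"
  shows "tight \<eta> D"
proof -
  interpret bounded_open D by fact
  define U where "U = D \<inter> {x. x $ j < c}"
  define V where "V = D \<inter> {x. c < x $ j}"
  have oU: "open U" and oV: "open V"
    unfolding U_def V_def by (intro open_Int opn open_Collect_less continuous_intros)+
  have sub: "U \<subseteq> D" "V \<subseteq> D" and disj: "U \<inter> V = {}" by (auto simp: U_def V_def)
  have l: "U \<in> sets lebesgue" "V \<in> sets lebesgue" using oU oV by (auto simp: borel_open)
  obtain L1 where L1: "L1 \<ge> 0" "\<And>w S. w \<in> sobolev 1 U \<Longrightarrow> S \<in> sets lebesgue \<Longrightarrow> S \<subseteq> U \<Longrightarrow>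
     nsq S w \<le> \<eta> * gsq U w + L1 * measure lebesgue S * nsq U w"
    using t(1) unfolding tight_def U_def[symmetric] by blast
  obtain L2 where L2: "L2 \<ge> 0" "\<And>w S. w \<in> sobolev 1 V \<Longrightarrow> S \<in> sets lebesgue \<Longrightarrow> S \<subseteq> V \<Longrightarrow>
     nsq S w \<le> \<eta> * gsq V w + L2 * measure lebesgue S * nsq V w"
    using t(2) unfolding tight_def V_def[symmetric] by blast
  show ?thesis
    unfolding tight_def
  proof (intro exI[of _ "L1 + L2"] conjI ballI allI impI)
    fix w S assume w: "w \<in> sobolev 1 D" and S: "S \<in> sets lebesgue" "S \<subseteq> D"
    have ws: "square_integrable D w" by (rule sobolev_square_integrable[OF w])
    have sq: "square_integrable A w" if "A \<in> sets lebesgue" "A \<subseteq> D" for A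
      by (rule square_integrable_mono(1)[OF that(1) opn_lebesgue that(2) ws])
    have Sl: "S \<in> lmeasurable" using S bdd bounded_subset by (auto intro!: bounded_set_imp_lmeasurable)
    have N: "negligible {x::real^2. x $ j = c}"
      unfolding cart_eq_inner_axis by (rule negligible_standard_hyperplane) simp
    have "nsq S w \<le> (\<Sum>b\<in>UNIV. nsq (if b then S \<inter> U else S \<inter> V) w)"
      by (rule nsq_cover[OF S(1) sq[OF S] _ _ N])
         (use S l sub in \<open>auto simp: U_def V_def intro!: sq\<close>)
    then have "nsq S w \<le> nsq (S \<inter> U) w + nsq (S \<inter> V) w" by (simp add: UNIV_bool)
    also have "\<dots> \<le> (\<eta> * gsq U w + L1 * measure lebesgue (S \<inter> U) * nsq U w)
        + (\<eta> * gsq V w + L2 * measure lebesgue (S \<inter> V) * nsq V w)"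
      using S l sobolev_domain_mono(1)[OF oU sub(1) w] sobolev_domain_mono(1)[OF oV sub(2) w]
      by (intro add_mono L1 L2) auto
    also have "\<dots> \<le> (\<eta> * gsq U w + L1 * measure lebesgue S * nsq D w)
        + (\<eta> * gsq V w + L2 * measure lebesgue S * nsq D w)"
      using L1(1) L2(1) Sl S l square_integrable_mono(2)[OF _ opn_lebesgue _ ws] sub
      by (intro add_mono order_refl mult_mono mult_left_mono measure_mono_fmeasurable mult_nonneg_nonneg) auto
    also have "\<dots> = \<eta> * (gsq U w + gsq V w) + (L1 + L2) * measure lebesgue S * nsq D w"
      by (simp add: algebra_simps)
    also have "\<dots> \<le> \<eta> * gsq D w + (L1 + L2) * measure lebesgue S * nsq D w"
      using gsq_disjoint[OF oU oV disj _ w] sub \<eta> by (intro add_right_mono mult_left_mono) auto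
    finally show "nsq S w \<le> \<eta> * gsq D w + (L1 + L2) * measure lebesgue S * nsq D w" .
  qed (use L1 L2 in simp)
qed

text \<open>Cutting \<open>D\<close> into pieces does not affect the factor in front of the gradient term, which the
  Poincare inequality makes small for pieces of small diameter.\<close>

lemma tight_bisection:
  assumes "bounded_open D" "convex D" "\<And>x i. x \<in> D \<Longrightarrow> a $ i \<le> x $ i \<and> x $ i \<le> a $ i + s" "s \<ge> 0"
  shows "tight (96 * s\<^sup>2 / 4 ^ n) D"
  using assms
proof (induction n arbitrary: D a s)
  case 0
  \<comment> \<open>The l1 bound for the diameter of a square of side s turns 24 * d^2 into 24 * (2
    * s)^2 = 96 * s^2.\<close>
  have "norm (y - x) \<le> 2 * s" if "x \<in> D" "y \<in> D" for x y
  proof -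
    have "norm (y - x) \<le> \<bar>(y - x) $ 1\<bar> + \<bar>(y - x) $ 2\<bar>"
      using norm_le_l1_cart[of "y - x"] by (simp add: sum_2)
    also have "\<dots> \<le> s + s"
      using 0(3)[OF that(1), of 1] 0(3)[OF that(2), of 1] 0(3)[OF that(1), of 2] 0(3)[OF that(2), of 2]
      by (intro add_mono) auto
    finally show ?thesis by simp
  qed
  from tight_diameter[OF 0(1,2) _ this] show ?case using 0(4) by (simp add: power_mult_distrib)
next
  case (Suc n)
  have 4: "96 * (s / 2)\<^sup>2 / 4 ^ n = 96 * s\<^sup>2 / 4 ^ Suc n" by (simp add: power_divide)
  have cvx: "convex {x::real^2. x $ i < c}" "convex {x::real^2. c < x $ i}" for i c
    using convex_halfspace_lt[of "axis i 1 :: real^2" c] convex_halfspace_gt[of c "axis i 1 :: real^2"]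
    by (simp_all add: inner_axis' inner_axis inner_real_def)
  have op: "open {x::real^2. x $ i < c}" "open {x::real^2. c < x $ i}" for i c
    by (intro open_Collect_less continuous_intros)+
  have bo: "bounded_open (A \<inter> B)" if "bounded_open A" "open B" for A B
    using that by (auto simp: bounded_open_def bounded_Int)
  have vec: "vector [p, q] $ i \<le> x $ i \<and> x $ i \<le> vector [p, q] $ i + t"
    if "p \<le> x $ 1 \<and> x $ 1 \<le> p + t" "q \<le> x $ 2 \<and> x $ 2 \<le> q + t" for p q t :: real and x :: "real^2" and i
    using that exhaust_2[of i] by (elim disjE) simp_all
  \<comment> \<open>One step quarters the square. The final cut is in coordinate 2, and
    \<open>row\<close> treats each resulting strip of height s / 2 by a cut in coordinate 1; both
    quarters of a strip then have side s / 2.\<close>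
  have row: "tight (96 * s\<^sup>2 / 4 ^ Suc n) A"
    if A: "bounded_open A" "convex A" "\<And>x. x \<in> A \<Longrightarrow> b \<le> x $ 2 \<and> x $ 2 \<le> b + s / 2"
      "\<And>x. x \<in> A \<Longrightarrow> a $ 1 \<le> x $ 1 \<and> x $ 1 \<le> a $ 1 + s" for A b
  proof (rule tight_cut[OF A(1), where j=1 and c="a $ 1 + s / 2"])
    show "tight (96 * s\<^sup>2 / 4 ^ Suc n) (A \<inter> {x. x $ 1 < a $ 1 + s / 2})"
      unfolding 4[symmetric]
    proof (rule Suc.IH[where a="vector [a $ 1, b]"])
      fix x i assume "x \<in> A \<inter> {x. x $ 1 < a $ 1 + s / 2}"
      then show "vector [a $ 1, b] $ i \<le> x $ i \<and> x $ i \<le> vector [a $ 1, b] $ i + s / 2"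
        using A(3,4)[of x] by (intro vec) auto
    qed (use A cvx op Suc.prems(4) in \<open>auto intro!: bo convex_Int\<close>)
    show "tight (96 * s\<^sup>2 / 4 ^ Suc n) (A \<inter> {x. a $ 1 + s / 2 < x $ 1})"
      unfolding 4[symmetric]
    proof (rule Suc.IH[where a="vector [a $ 1 + s / 2, b]"])
      fix x i assume "x \<in> A \<inter> {x. a $ 1 + s / 2 < x $ 1}"
      then show "vector [a $ 1 + s / 2, b] $ i \<le> x $ i \<and> x $ i \<le> vector [a $ 1 + s / 2, b] $ i + s / 2"
        using A(3,4)[of x] by (intro vec) auto
    qed (use A cvx op Suc.prems(4) in \<open>auto intro!: bo convex_Int\<close>)
  qed simp
  show ?case
  proof (rule tight_cut[OF Suc.prems(1), where j=2 and c="a $ 2 + s / 2"])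
    show "tight (96 * s\<^sup>2 / 4 ^ Suc n) (D \<inter> {x. x $ 2 < a $ 2 + s / 2})"
      by (rule row[where b="a $ 2"]) (use Suc.prems cvx op in \<open>auto intro!: bo convex_Int simp: less_imp_le\<close>)
    show "tight (96 * s\<^sup>2 / 4 ^ Suc n) (D \<inter> {x. a $ 2 + s / 2 < x $ 2})"
    proof (rule row[where b="a $ 2 + s / 2"])
      fix x assume "x \<in> D \<inter> {x. a $ 2 + s / 2 < x $ 2}"
      then show "a $ 2 + s / 2 \<le> x $ 2 \<and> x $ 2 \<le> a $ 2 + s / 2 + s / 2"
        using Suc.prems(3)[of x 2] by auto
    qed (use Suc.prems cvx op in \<open>auto intro!: bo convex_Int\<close>)
  qed simp
qed

lemma tight_weaken: "tight \<eta> D \<Longrightarrow> \<eta> \<le> \<eta>' \<Longrightarrow> tight \<eta>' D"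
  unfolding tight_def by (meson add_right_mono gsq_nonneg mult_right_mono order_trans)

lemma tight_convex:
  assumes "bounded_open D" "convex D" "\<eta> > 0"
  shows "tight \<eta> D"
proof -
  interpret bounded_open D by fact
  obtain R where R: "\<And>x. x \<in> D \<Longrightarrow> norm x \<le> R" using bdd by (auto simp: bounded_iff)
  define s where "s = 2 * \<bar>R\<bar>"
  have "(\<lambda>n. 96 * s\<^sup>2 * (1 / 4) ^ n) \<longlonglongrightarrow> 96 * s\<^sup>2 * 0"
    by (intro tendsto_intros LIMSEQ_power_zero) auto
  then have "\<forall>\<^sub>F n in sequentially. 96 * s\<^sup>2 * (1 / 4) ^ n < \<eta>"
    using assms(3) by (intro order_tendstoD(2)) auto
  then obtain n where n: "96 * s\<^sup>2 * (1 / 4) ^ n < \<eta>"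
    using eventually_happens'[OF sequentially_bot] by blast
  have "tight (96 * s\<^sup>2 / 4 ^ n) D"
  proof (rule tight_bisection[OF assms(1,2), where a="\<chi> i. - \<bar>R\<bar>"])
    fix x i assume "x \<in> D"
    then have "\<bar>x $ i\<bar> \<le> R" using R component_le_norm_cart[of x i] by (meson order_trans)
    then show "(\<chi> i. - \<bar>R\<bar>) $ i \<le> x $ i \<and> x $ i \<le> (\<chi> i. - \<bar>R\<bar>) $ i + s" by (auto simp: s_def)
  qed (simp add: s_def)
  then show ?thesis by (rule tight_weaken) (use n in \<open>simp add: power_one_over field_simps\<close>)
qed

lemma tight_finite_union:
  assumes bo: "bounded_open \<Omega>" and fin: "finite I"
    and U: "\<And>i. i \<in> I \<Longrightarrow> open (U i) \<and> convex (U i) \<and> U i \<subseteq> \<Omega>"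
    and N: "negligible N" "\<Omega> \<subseteq> (\<Union>i\<in>I. U i) \<union> N" and \<eta>: "\<eta> > 0"
  shows "tight \<eta> \<Omega>"
proof -
  interpret bounded_open \<Omega> by fact
  \<comment> \<open>The pieces may overlap, so each gradient term is bounded by that of \<Omega> and
    their number is divided out in advance; the + 1 covers an empty index set.\<close>
  define \<eta>' where "\<eta>' = \<eta> / (real (card I) + 1)"
  have \<eta>': "\<eta>' > 0" using \<eta> by (simp add: \<eta>'_def add_nonneg_pos)
  have "\<forall>i\<in>I. \<exists>L. L \<ge> 0 \<and> (\<forall>w\<in>sobolev 1 (U i). \<forall>S. S \<in> sets lebesgue \<longrightarrow> S \<subseteq> U i \<longrightarrow>
     nsq S w \<le> \<eta>' * gsq (U i) w + L * measure lebesgue S * nsq (U i) w)"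
    using tight_convex[OF sub_bounded_open _ \<eta>'] U unfolding tight_def by blast
  then obtain L where L: "\<And>i. i \<in> I \<Longrightarrow> L i \<ge> 0"
    "\<And>i w S. i \<in> I \<Longrightarrow> w \<in> sobolev 1 (U i) \<Longrightarrow> S \<in> sets lebesgue \<Longrightarrow> S \<subseteq> U i \<Longrightarrow>
     nsq S w \<le> \<eta>' * gsq (U i) w + L i * measure lebesgue S * nsq (U i) w"
    by (metis bchoice)
  show ?thesis
    unfolding tight_def
  proof (intro exI[of _ "sum L I"] conjI ballI allI impI)
    show "0 \<le> sum L I" using L(1) by (rule sum_nonneg)
    fix w S assume w: "w \<in> sobolev 1 \<Omega>" and S: "S \<in> sets lebesgue" "S \<subseteq> \<Omega>"
    have ws: "square_integrable \<Omega> w" by (rule sobolev_square_integrable[OF w])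
    have sq: "square_integrable A w" if "A \<in> sets lebesgue" "A \<subseteq> \<Omega>" for A
      by (rule square_integrable_mono(1)[OF that(1) opn_lebesgue that(2) ws])
    have Sl: "S \<in> lmeasurable" using S bdd bounded_subset by (auto intro!: bounded_set_imp_lmeasurable)
    have Ul: "U i \<in> sets lebesgue" if "i \<in> I" for i using U[OF that] by (simp add: borel_open)
    have "nsq S w \<le> (\<Sum>i\<in>I. nsq (S \<inter> U i) w)"
      by (rule nsq_cover[OF S(1) sq[OF S] fin _ N(1)]) (use S Ul N(2) in \<open>auto intro!: sq\<close>)
    also have "\<dots> \<le> (\<Sum>i\<in>I. \<eta>' * gsq \<Omega> w + L i * measure lebesgue S * nsq \<Omega> w)"
    proof (rule sum_mono)
      fix i assume i: "i \<in> I"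
      have "nsq (S \<inter> U i) w \<le> \<eta>' * gsq (U i) w + L i * measure lebesgue (S \<inter> U i) * nsq (U i) w"
        using U[OF i] by (intro L(2)[OF i] sobolev_domain_mono(1)[OF _ _ w] sets.Int S Ul i) auto
      also have "\<dots> \<le> \<eta>' * gsq \<Omega> w + L i * measure lebesgue S * nsq \<Omega> w"
        using U[OF i] L(1)[OF i] \<eta>' Sl S Ul[OF i] square_integrable_mono(2)[OF Ul[OF i] opn_lebesgue _ ws]
        by (intro add_mono mult_mono mult_left_mono gsq_mono w measure_mono_fmeasurable mult_nonneg_nonneg) auto
      finally show "nsq (S \<inter> U i) w \<le> \<eta>' * gsq \<Omega> w + L i * measure lebesgue S * nsq \<Omega> w" .
    qed
    also have "\<dots> = (real (card I) * \<eta>') * gsq \<Omega> w + sum L I * measure lebesgue S * nsq \<Omega> w"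
      by (simp add: sum.distrib sum_distrib_right)
    also have "\<dots> \<le> \<eta> * gsq \<Omega> w + sum L I * measure lebesgue S * nsq \<Omega> w"
    proof (intro add_right_mono mult_right_mono)
      show "real (card I) * \<eta>' \<le> \<eta>" using \<eta> by (simp add: \<eta>'_def field_simps)
    qed simp
    finally show "nsq S w \<le> \<eta> * gsq \<Omega> w + sum L I * measure lebesgue S * nsq \<Omega> w" .
  qed
qed

lemma open_measure_pos: "open A \<Longrightarrow> A \<noteq> {} \<Longrightarrow> bounded A \<Longrightarrow> 0 < measure lebesgue A" for A :: "(real^2) set"
  using open_not_negligible[of A] bounded_set_imp_lmeasurable[of A] negligible_iff_measure[of A]
  by (simp add: borel_open zero_less_measure_iff)

lemma norm_ball_diff: "x \<in> ball c r \<Longrightarrow> y \<in> ball c r \<Longrightarrow> norm (y - x) \<le> 2 * r" for x y c :: "real^2"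
  using norm_triangle_ineq4[of "y - c" "x - c"] by (simp add: dist_norm norm_minus_commute)

section \<open>Propagation of the Poincare inequality along balls and up to the boundary\<close>

context averaged
begin

text \<open>The Poincare inequality with the L2 norm only on S but the gradient on all of D, the
  form in which it passes from one ball to the next.\<close>

definition controlled :: "(real^2) set \<Rightarrow> bool" where
  "controlled S \<longleftrightarrow> (\<exists>C\<ge>0. \<forall>w\<in>sobolev 1 D. (LINT x|lebesgue_on D. w x * \<phi> x) = 0 \<longrightarrow>
     nsq S w \<le> C * gsq D w)"

lemma controlled_mono:
  assumes "controlled T" "S \<in> sets lebesgue" "T \<in> sets lebesgue" "S \<subseteq> T" "T \<subseteq> D"
  shows "controlled S"
proof -
  have "nsq S w \<le> nsq T w" if "w \<in> sobolev 1 D" for w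
    by (intro square_integrable_mono(2)[OF assms(2,3,4)]
        square_integrable_mono(1)[OF assms(3) opn_lebesgue assms(5)] sobolev_square_integrable[OF that])
  with assms(1) show ?thesis unfolding controlled_def by (meson order_trans)
qed

text \<open>On the ball carrying \<phi>, the constant m of the Poincare inequality can be bounded by
  the deviation from it, because the \<phi>-weighted mean of w is 0.\<close>

lemma controlled_start:
  assumes r: "r > 0" "ball c r \<subseteq> D" and out: "\<And>x. x \<notin> ball c r \<Longrightarrow> \<phi> x = 0"
  shows "controlled (ball c r)"
proof -
  define B where "B = ball c r"
  have oB: "open B" and BD: "B \<subseteq> D" using r by (auto simp: B_def)
  interpret B: bounded_open B by (rule sub_bounded_open[OF oB BD])
  have lm: "B \<in> lmeasurable" using B.bdd B.opn_lebesgue by (rule bounded_set_imp_lmeasurable)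
  have \<phi>B: "square_integrable B \<phi>" by (rule square_integrable_mono(1)[OF B.opn_lebesgue opn_lebesgue BD test_sq[OF \<phi>]])
  have Beq: "(LINT x|lebesgue_on B. f x * \<phi> x) = (LINT x|lebesgue_on D. f x * \<phi> x)" for f
    by (rule integral_lebesgue_on_zero_outside[OF opn oB BD]) (use out in \<open>auto simp: B_def\<close>)
  define C where "C = (2 + 2 * (nsq B \<phi> * measure lebesgue B)) * (4 * (2 * r)\<^sup>2)"
  have "nsq B w \<le> C * gsq D w" if w: "w \<in> sobolev 1 D" and 0: "(LINT x|lebesgue_on D. w x * \<phi> x) = 0" for w
  proof -
    have wB: "w \<in> sobolev 1 B" by (rule sobolev_domain_mono(1)[OF oB BD w])
    have ws: "square_integrable B w" by (rule B.sobolev_square_integrable[OF wB])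
    obtain m where "(LINT x|lebesgue_on B. (w x - m)\<^sup>2)
      \<le> 4 * (2 * r)\<^sup>2 * (\<Sum>j\<in>UNIV. LINT x|lebesgue_on B. (weak_partial B (shift j (0, 0)) w x)\<^sup>2)"
      using poincare_convex[OF oB _ B.bdd _ _ ws B.has_weak_gradient[OF wB], of "2 * r"]
        norm_ball_diff[of _ c r] r(1) by (auto simp: B_def)
    then have "nsq B (\<lambda>x. w x - m) \<le> 4 * (2 * r)\<^sup>2 * gsq B w" by (simp add: nsq_def gsq_def)
    also have "\<dots> \<le> 4 * (2 * r)\<^sup>2 * gsq D w" using gsq_mono[OF oB BD w] by (intro mult_left_mono) auto
    finally have V: "nsq B (\<lambda>x. w x - m) \<le> 4 * (2 * r)\<^sup>2 * gsq D w" .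
    have wm: "square_integrable B (\<lambda>x. w x - m)"
      by (rule square_integrable_diff[OF ws square_integrable_const[OF lm]])
    \<comment> \<open>As \<phi> has integral 1 and w has mean 0, this integral equals - m, and
      Cauchy-Schwarz bounds it by the deviation of w from m.\<close>
    have "(LINT x|lebesgue_on B. (w x - m) * \<phi> x)
        = (LINT x|lebesgue_on B. w x * \<phi> x) - m * (LINT x|lebesgue_on B. 1 * \<phi> x)"
      using square_integrable_mult[OF ws \<phi>B] square_integrable_mult[OF square_integrable_const[OF lm, of 1] \<phi>B]
      by (simp add: left_diff_distrib)
    also have "\<dots> = - m" unfolding Beq using 0 \<phi>1 by simp
    finally have "m\<^sup>2 \<le> nsq B (\<lambda>x. w x - m) * nsq B \<phi>"
      using Cauchy_Schwarz_nsq[OF wm \<phi>B] by simp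
    then have m2: "m\<^sup>2 * measure lebesgue B \<le> nsq B (\<lambda>x. w x - m) * nsq B \<phi> * measure lebesgue B"
      by (intro mult_right_mono) auto
    have "nsq B w \<le> 2 * nsq B (\<lambda>x. w x - m) + 2 * (m\<^sup>2 * measure lebesgue B)"
      using nsq_add[OF wm square_integrable_const[OF lm, of m]] by (simp add: nsq_const[OF lm])
    also have "\<dots> \<le> (2 + 2 * (nsq B \<phi> * measure lebesgue B)) * nsq B (\<lambda>x. w x - m)"
      using m2 by (simp add: algebra_simps)
    also have "\<dots> \<le> C * gsq D w"
      unfolding C_def mult.assoc[of _ _ "gsq D w"] using V by (intro mult_left_mono) (auto simp: add_nonneg_nonneg)
    finally show ?thesis .
  qed
  moreover have "C \<ge> 0" by (simp add: C_def)
  ultimately show ?thesis unfolding controlled_def B_def by blast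
qed

text \<open>On the overlap w is already controlled, and the overlap is open and nonempty, hence of
  positive measure; \<open>poincare_sets\<close> carries the bound to the whole new ball.\<close>

lemma controlled_step:
  assumes ctl: "controlled (ball c r)" and c: "ball c r \<subseteq> D" and d: "ball d s \<subseteq> D" "s > 0"
    and meet: "ball c r \<inter> ball d s \<noteq> {}"
  shows "controlled (ball d s)"
proof -
  define B where "B = ball d s"
  define A where "A = ball c r \<inter> B"
  have oB: "open B" and BD: "B \<subseteq> D" using d by (auto simp: B_def)
  have oA: "open A" by (simp add: A_def B_def open_Int)
  interpret B: bounded_open B by (rule sub_bounded_open[OF oB BD])
  have lA: "A \<in> sets lebesgue" using oA by (simp add: borel_open)
  have A: "measure lebesgue A > 0"
    using meet B.bdd by (intro open_measure_pos oA) (auto simp: A_def B_def)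
  have "controlled A"
    by (rule controlled_mono[OF ctl lA]) (use c in \<open>auto simp: A_def\<close>)
  then obtain C where C: "C \<ge> 0" "\<And>w. w \<in> sobolev 1 D \<Longrightarrow> (LINT x|lebesgue_on D. w x * \<phi> x) = 0 \<Longrightarrow>
     nsq A w \<le> C * gsq D w" unfolding controlled_def by blast
  define K where "K = (24 * (2 * s)\<^sup>2 * measure lebesgue B + 4 * measure lebesgue B * C) / measure lebesgue A"
  have "nsq B w \<le> K * gsq D w" if w: "w \<in> sobolev 1 D" and 0: "(LINT x|lebesgue_on D. w x * \<phi> x) = 0" for w
  proof -
    have wB: "w \<in> sobolev 1 B" by (rule sobolev_domain_mono(1)[OF oB BD w])
    have "measure lebesgue A * nsq B w \<le> 24 * (2 * s)\<^sup>2 * measure lebesgue B * gsq B w + 4 * measure lebesgue B * nsq A w"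
      by (rule B.poincare_sets[OF _ _ _ wB B.opn_lebesgue _ lA])
         (use d norm_ball_diff[of _ d s] in \<open>auto simp: B_def A_def\<close>)
    also have "\<dots> \<le> 24 * (2 * s)\<^sup>2 * measure lebesgue B * gsq D w + 4 * measure lebesgue B * (C * gsq D w)"
      using gsq_mono[OF oB BD w] C(2)[OF w 0] by (intro add_mono mult_left_mono) auto
    finally show ?thesis using A by (simp add: K_def field_simps)
  qed
  moreover have "K \<ge> 0" using C(1) by (simp add: K_def)
  ultimately show ?thesis unfolding controlled_def B_def by blast
qed

text \<open>Having a controlled ball around x is a locally constant property of x: inside one ball
  of D it passes, through that ball, from any centre to any other. Connectedness thus takes the
  place of an explicit chain.\<close>

lemma controlled_ball:
  assumes con: "connected D" and r: "r > 0" "ball c r \<subseteq> D" and out: "\<And>x. x \<notin> ball c r \<Longrightarrow> \<phi> x = 0"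
    and s: "s > 0" "ball d s \<subseteq> D"
  shows "controlled (ball d s)"
proof -
  define P where "P x \<longleftrightarrow> (\<exists>t>0. ball x t \<subseteq> D \<and> controlled (ball x t))" for x
  have "P d"
  proof (rule connected_induction_simple[OF con, where a=c])
    show "P c" unfolding P_def using r controlled_start[OF r out] by blast
    show "c \<in> D" "d \<in> D" using r s by auto
    fix x assume "x \<in> D"
    then obtain e where e: "e > 0" "ball x e \<subseteq> D" using opn open_contains_ball by blast
    show "\<exists>T. openin (top_of_set D) T \<and> x \<in> T \<and> (\<forall>y\<in>T. \<forall>z\<in>T. P y \<longrightarrow> P z)"
    proof (intro exI[of _ "ball x e"] conjI ballI impI)
      show "openin (top_of_set D) (ball x e)" using e(2) by (intro open_subset) auto
      fix y z assume y: "y \<in> ball x e" and z: "z \<in> ball x e" and "P y"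
      then obtain t where t: "t > 0" "ball y t \<subseteq> D" "controlled (ball y t)" unfolding P_def by blast
      have "y \<in> ball y t \<inter> ball x e" using t y by simp
      then have "ball y t \<inter> ball x e \<noteq> {}" by blast
      then have cx: "controlled (ball x e)" by (rule controlled_step[OF t(3,2) e(2,1)])
      obtain u where u: "u > 0" "ball z u \<subseteq> ball x e" using z open_ball[of x e] open_contains_ball by blast
      have "controlled (ball z u)" by (rule controlled_mono[OF cx _ _ u(2) e(2)]) auto
      then show "P z" unfolding P_def using u e(2) by blast
    qed (use e in auto)
  qed
  then obtain t where t: "t > 0" "ball d t \<subseteq> D" "controlled (ball d t)" unfolding P_def by blast
  \<comment> \<open>The induction delivers some radius t; one more step reaches the prescribed
    s.\<close>
  have "d \<in> ball d t \<inter> ball d s" using t s by simp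
  then have "ball d t \<inter> ball d s \<noteq> {}" by blast
  then show ?thesis by (rule controlled_step[OF t(3,2) s(2,1)])
qed

lemma controlled_compact:
  assumes con: "connected D" and r: "r > 0" "ball c r \<subseteq> D" and out: "\<And>x. x \<notin> ball c r \<Longrightarrow> \<phi> x = 0"
    and K: "compact K" "K \<subseteq> D"
  shows "controlled K"
proof -
  have "\<forall>x\<in>K. \<exists>s>0. ball x s \<subseteq> D" using K(2) opn open_contains_ball by blast
  then obtain s where s: "\<And>x. x \<in> K \<Longrightarrow> s x > 0 \<and> ball x (s x) \<subseteq> D" by (metis bchoice)
  obtain I where I: "I \<subseteq> K" "finite I" "K \<subseteq> (\<Union>x\<in>I. ball x (s x))"
    by (rule compactE_image[OF K(1), of K "\<lambda>x. ball x (s x)"]) (use s in auto)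
  have "\<forall>x\<in>I. \<exists>C\<ge>0. \<forall>w\<in>sobolev 1 D. (LINT x|lebesgue_on D. w x * \<phi> x) = 0 \<longrightarrow>
     nsq (ball x (s x)) w \<le> C * gsq D w"
    using controlled_ball[OF con r out] s I(1) unfolding controlled_def by blast
  from bchoice[OF this] obtain C where "\<forall>x\<in>I. C x \<ge> 0 \<and> (\<forall>w\<in>sobolev 1 D.
     (LINT x|lebesgue_on D. w x * \<phi> x) = 0 \<longrightarrow> nsq (ball x (s x)) w \<le> C x * gsq D w)" by blast
  then have C: "\<And>x. x \<in> I \<Longrightarrow> C x \<ge> 0" "\<And>x w. x \<in> I \<Longrightarrow> w \<in> sobolev 1 D \<Longrightarrow>
     (LINT x|lebesgue_on D. w x * \<phi> x) = 0 \<Longrightarrow> nsq (ball x (s x)) w \<le> C x * gsq D w"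
    by blast+
  have "nsq K w \<le> sum C I * gsq D w" if w: "w \<in> sobolev 1 D" and 0: "(LINT x|lebesgue_on D. w x * \<phi> x) = 0" for w
  proof -
    have sq: "square_integrable A w" if "A \<in> sets lebesgue" "A \<subseteq> D" for A
      by (rule square_integrable_mono(1)[OF that(1) opn_lebesgue that(2) sobolev_square_integrable[OF w]])
    have "nsq K w \<le> (\<Sum>x\<in>I. nsq (ball x (s x)) w)"
    proof (rule nsq_cover[OF _ _ I(2), where N="{}"])
      show "K \<in> sets lebesgue" using K(1) by (simp add: borel_compact)
      then show "square_integrable K w" using K(2) by (rule sq)
      show "ball x (s x) \<in> sets lebesgue \<and> square_integrable (ball x (s x)) w" if "x \<in> I" for x
        using that s I(1) by (auto intro!: sq)
    qed (use I in auto)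
    also have "\<dots> \<le> (\<Sum>x\<in>I. C x * gsq D w)" by (intro sum_mono C(2) w 0)
    finally show ?thesis by (simp add: sum_distrib_right)
  qed
  moreover have "sum C I \<ge> 0" using C(1) by (rule sum_nonneg)
  ultimately show ?thesis unfolding controlled_def by blast
qed

text \<open>\<open>controlled_compact\<close> leaves a remainder of small measure near the boundary.
  There w is replaced by its extension F, because tightness is known for \<Omega>, and the extension
  bound leads back to norms on D.\<close>

lemma poincare_subdomain:
  assumes con: "connected D" and r: "r > 0" "ball c r \<subseteq> D" and out: "\<And>x. x \<notin> ball c r \<Longrightarrow> \<phi> x = 0"
    and \<Omega>: "bounded_open \<Omega>" "D \<subseteq> \<Omega>" and tight: "\<And>\<eta>. \<eta> > 0 \<Longrightarrow> tight \<eta> \<Omega>"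
    and E: "E \<ge> 0" "\<And>w. w \<in> sobolev 1 D \<Longrightarrow> \<exists>F\<in>sobolev 1 \<Omega>. (AE x in lebesgue_on D. F x = w x) \<and>
      (sobolev_norm 1 \<Omega> F)\<^sup>2 \<le> E * (sobolev_norm 1 D w)\<^sup>2"
  shows "controlled D"
proof -
  interpret \<Omega>: bounded_open \<Omega> by fact
  \<comment> \<open>Chosen so that \<eta> * E stays below 1/2, which allows absorption at the end; E
    + 1 keeps the denominator positive.\<close>
  define \<eta> where "\<eta> = 1 / (4 * (E + 1))"
  have \<eta>: "\<eta> > 0" using E(1) by (simp add: \<eta>_def)
  obtain L where L: "L \<ge> 0" "\<And>w S. w \<in> sobolev 1 \<Omega> \<Longrightarrow> S \<in> sets lebesgue \<Longrightarrow> S \<subseteq> \<Omega> \<Longrightarrow>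
     nsq S w \<le> \<eta> * gsq \<Omega> w + L * measure lebesgue S * nsq \<Omega> w"
    using tight[OF \<eta>] unfolding tight_def by blast
  \<comment> \<open>Makes L times the measure of the remainder at most \<eta>, so that gradient and
    L2 term of F carry the same factor and combine to its H1 norm.\<close>
  define \<delta> where "\<delta> = \<eta> / (L + 1)"
  have \<delta>: "\<delta> > 0" "L * \<delta> \<le> \<eta>" using \<eta> L(1) by (auto simp: \<delta>_def field_simps add_nonneg_pos)
  obtain K where K: "closed K" "K \<subseteq> D" "D - K \<in> lmeasurable" "emeasure lebesgue (D - K) < ennreal \<delta>"
    using sets_lebesgue_inner_closed[OF opn_lebesgue \<delta>(1)] by blast
  have cK: "compact K" using K(1,2) bdd bounded_subset compact_eq_bounded_closed by blast
  have lK: "K \<in> sets lebesgue" using cK by (simp add: borel_compact)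
  have "measure lebesgue (D - K) < \<delta>"
  proof -
    have "emeasure lebesgue (D - K) = ennreal (measure lebesgue (D - K))"
      using fmeasurableD2[OF K(3)] by (intro emeasure_eq_ennreal_measure) simp
    then show ?thesis using K(4) by (simp add: ennreal_less_iff)
  qed
  then have mK: "L * measure lebesgue (D - K) \<le> \<eta>"
    using L(1) \<delta>(2) mult_left_mono[of "measure lebesgue (D - K)" \<delta> L] by linarith
  obtain C where C: "C \<ge> 0" "\<And>w. w \<in> sobolev 1 D \<Longrightarrow> (LINT x|lebesgue_on D. w x * \<phi> x) = 0 \<Longrightarrow>
     nsq K w \<le> C * gsq D w"
    using controlled_compact[OF con r out cK K(2)] unfolding controlled_def by blast
  have "nsq D w \<le> (2 * C + 1) * gsq D w" if w: "w \<in> sobolev 1 D" and 0: "(LINT x|lebesgue_on D. w x * \<phi> x) = 0" for w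
  proof -
    have ws: "square_integrable D w" by (rule sobolev_square_integrable[OF w])
    obtain F where F: "F \<in> sobolev 1 \<Omega>" "AE x in lebesgue_on D. F x = w x"
      "(sobolev_norm 1 \<Omega> F)\<^sup>2 \<le> E * (sobolev_norm 1 D w)\<^sup>2" using E(2)[OF w] by blast
    have lS: "D - K \<in> sets lebesgue" using K(3) by (rule fmeasurableD)
    have wS: "square_integrable (D - K) w" by (rule square_integrable_mono(1)[OF lS opn_lebesgue _ ws]) auto
    have "nsq D w \<le> (\<Sum>b\<in>UNIV. nsq (if b then K else D - K) w)"
      by (rule nsq_cover[OF opn_lebesgue ws _ _ negligible_empty])
         (use lK lS K(2) wS square_integrable_mono(1)[OF lK opn_lebesgue K(2) ws] in auto)
    then have "nsq D w \<le> nsq K w + nsq (D - K) w" by (simp add: UNIV_bool)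
    also have "nsq (D - K) w = nsq (D - K) F"
    proof (rule nsq_cong_AE)
      show "w \<in> borel_measurable (lebesgue_on (D - K))" using wS by (rule square_integrable_measurable)
      have "square_integrable (D - K) F"
        using \<Omega>(2) by (intro square_integrable_mono(1)[OF lS \<Omega>.opn_lebesgue _ \<Omega>.sobolev_square_integrable[OF F(1)]]) auto
      then show "F \<in> borel_measurable (lebesgue_on (D - K))" by (rule square_integrable_measurable)
      have "AE x in lebesgue. x \<in> D \<longrightarrow> F x = w x"
        using F(2) opn_lebesgue by (simp add: AE_restrict_space_iff)
      then have "AE x in lebesgue. x \<in> D - K \<longrightarrow> w x = F x" by eventually_elim auto
      then show "AE x in lebesgue_on (D - K). w x = F x"
        using lS by (simp add: AE_restrict_space_iff)
    qed
    also have "nsq (D - K) F \<le> \<eta> * gsq \<Omega> F + L * measure lebesgue (D - K) * nsq \<Omega> F"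
      using \<Omega>(2) by (intro L(2) F(1) lS) auto
    also have "\<dots> \<le> \<eta> * gsq \<Omega> F + \<eta> * nsq \<Omega> F"
      using mK by (intro add_left_mono mult_right_mono) auto
    also have "\<dots> = \<eta> * (sobolev_norm 1 \<Omega> F)\<^sup>2"
      unfolding \<Omega>.sobolev_norm_1_sq[OF F(1)] by (simp add: algebra_simps)
    also have "\<dots> \<le> \<eta> * (E * (sobolev_norm 1 D w)\<^sup>2)" using F(3) \<eta> by (intro mult_left_mono) auto
    also have "\<dots> = (\<eta> * E) * (nsq D w + gsq D w)" unfolding sobolev_norm_1_sq[OF w] by simp
    also have "\<dots> \<le> (1 / 2) * (nsq D w + gsq D w)"
    proof (rule mult_right_mono)
      show "\<eta> * E \<le> 1 / 2" using E(1) by (simp add: \<eta>_def field_simps)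
    qed simp
    \<comment> \<open>The half of \<open>nsq D w\<close> on the right is absorbed by the left-hand
      side, whence the constant 2 * C + 1.\<close>
    finally have "nsq D w \<le> C * gsq D w + (1 / 2) * (nsq D w + gsq D w)" using C(2)[OF w 0] by simp
    then show ?thesis by (simp add: algebra_simps)
  qed
  moreover have "2 * C + 1 \<ge> 0" using C(1) by simp
  ultimately show ?thesis unfolding controlled_def by blast
qed

end

section \<open>Extension operators reproducing quadratics\<close>

lemma averaging_function_exists:
  assumes D: "open D" "bounded D" "D \<noteq> {}"
  obtains \<phi> c r where "averaged D \<phi>" "r > 0" "ball c r \<subseteq> D" "\<And>x. x \<notin> ball c r \<Longrightarrow> \<phi> x = 0"
proof -
  obtain c where "c \<in> D" using D(3) by blast
  then obtain r where r: "r > 0" "ball c r \<subseteq> D" using D(1) open_contains_ball by blast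
  \<comment> \<open>The support of the kernel has radius 2 * (r / 4) = r / 2, well inside the
    ball.\<close>
  define \<phi> where "\<phi> = (\<lambda>z. moll (r / 4) (c - z))"
  have out: "\<phi> x = 0" if "x \<notin> ball c r" for x
    unfolding \<phi>_def using that r(1) by (intro moll_zero) (auto simp: dist_norm)
  have "cball c (2 * (r / 4)) \<subseteq> D"
    using r by (auto simp: subset_iff)
  then have t: "test_function D \<phi>"
    unfolding \<phi>_def using r(1) by (intro test_function_moll) auto
  have "(LINT x|lebesgue_on D. \<phi> x) = (LINT x|lborel. \<phi> x)"
    by (rule integral_lebesgue_on_borel(2)[OF D(1) borel_test[OF t] test_function_zero[OF t]])
  also have "\<dots> = 1"
    unfolding \<phi>_def using r(1) by (intro integral_moll_diff) auto
  finally have "averaged D \<phi>"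
    using D t by unfold_locales
  then show ?thesis using r out by (rule that)
qed

text \<open>The decomposition of \<open>E w\<close> is an equality of functions, not only almost
  everywhere, since nodal interpolation reads point values. The error estimate will see v alone, and
  the norm of v is bounded by the seminorm of w.\<close>

lemma quadratic_preserving_extension:
  assumes \<Omega>: "bounded_open \<Omega>" and tight: "\<And>\<eta>. \<eta> > 0 \<Longrightarrow> tight \<eta> \<Omega>"
    and D: "open D" "connected D" "D \<noteq> {}" "D \<subseteq> \<Omega>" and E0: "extension_operator \<Omega> D E0"
  shows "\<exists>E C. extension_operator \<Omega> D E \<and> C \<ge> 0 \<and>
    (\<forall>w\<in>sobolev 3 D. \<exists>p v. p \<in> quadratics \<and> v \<in> sobolev 3 \<Omega> \<and> continuous_on (closure \<Omega>) v \<and>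
       E w = (\<lambda>x. v x + p x) \<and> (AE x in lebesgue_on D. w x = v x + p x) \<and>
       sobolev_norm 3 \<Omega> v \<le> C * sobolev_seminorm 3 D w)"
proof -
  interpret \<Omega>: bounded_open \<Omega> by fact
  obtain \<phi> c r where av: "averaged D \<phi>" and r: "r > 0" "ball c r \<subseteq> D" "\<And>x. x \<notin> ball c r \<Longrightarrow> \<phi> x = 0"
    using averaging_function_exists[OF D(1) bounded_subset[OF \<Omega>.bdd D(4)] D(3)] by metis
  interpret averaged D \<phi> by fact
  have E0lin: "AE x in lebesgue_on \<Omega>. E0 (\<lambda>y. a * v y + b * w y) x = a * E0 v x + b * E0 w x"
    if "v \<in> sobolev 0 D" "w \<in> sobolev 0 D" for a b v w
    using E0 that by (simp add: extension_operator_def)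
  have E0ext: "AE x in lebesgue_on D. E0 w x = w x" if "w \<in> sobolev 0 D" for w
    using E0 that by (simp add: extension_operator_def)
  have E0cont: "continuous_on (closure \<Omega>) (E0 w)" if "w \<in> sobolev 3 D" for w
    using E0 that by (simp add: extension_operator_def)
  obtain C0 where C0: "\<And>s w. s \<le> 3 \<Longrightarrow> w \<in> sobolev s D \<Longrightarrow> E0 w \<in> sobolev s \<Omega>"
    "\<And>s w. s \<le> 3 \<Longrightarrow> w \<in> sobolev s D \<Longrightarrow> sobolev_norm s \<Omega> (E0 w) \<le> C0 * sobolev_norm s D w"
    using E0 unfolding extension_operator_def by blast
  have C0sq: "(sobolev_norm s \<Omega> (E0 w))\<^sup>2 \<le> C0\<^sup>2 * (sobolev_norm s D w)\<^sup>2"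
    if "s \<le> 3" "w \<in> sobolev s D" for s w
    unfolding power_mult_distrib[symmetric]
    by (intro power_mono C0(2) that sobolev_norm_nonneg)
  have lev0: "w \<in> sobolev 0 D" if "w \<in> sobolev s D" for s w
    using that sobolev_level_mono[of 0 s] by auto
  have pS: "proj w \<in> sobolev s D" "proj w \<in> sobolev s \<Omega>" for s w
    by (intro smooth_sobolev \<Omega>.smooth_sobolev smooth_quadratics proj_quadratics)+
  define R where "R w = (\<lambda>y. w y - proj w y)" for w
  have RS: "R w \<in> sobolev s D" if "w \<in> sobolev s D" for s w
    unfolding R_def by (rule sobolev_diff(1)[OF that pS(1)])
  define E where "E w = (\<lambda>x. E0 (R w) x + proj w x)" for w
  \<comment> \<open>The given operator is used at level s = 1, to extend functions across the
    boundary of D.\<close>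
  have "controlled D"
  proof (rule poincare_subdomain[OF D(2) r(1,2) _ \<Omega> D(4)])
    show "\<phi> x = 0" if "x \<notin> ball c r" for x using that by (rule r(3))
    show "tight \<eta> \<Omega>" if "\<eta> > 0" for \<eta> using that by (rule tight)
    show "0 \<le> C0\<^sup>2" by simp
    fix w assume w: "w \<in> sobolev 1 D"
    show "\<exists>F\<in>sobolev 1 \<Omega>. (AE x in lebesgue_on D. F x = w x) \<and>
        (sobolev_norm 1 \<Omega> F)\<^sup>2 \<le> C0\<^sup>2 * (sobolev_norm 1 D w)\<^sup>2"
      using C0(1)[OF _ w] E0ext[OF lev0[OF w]] C0sq[OF _ w] by auto
  qed
  then obtain P where P: "P \<ge> 0" "\<And>w. w \<in> sobolev 1 D \<Longrightarrow> (LINT x|lebesgue_on D. w x * \<phi> x) = 0 \<Longrightarrow>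
      nsq D w \<le> P * gsq D w" unfolding controlled_def by blast
  obtain B where B: "B \<ge> 0" "\<And>w. w \<in> sobolev 3 D \<Longrightarrow>
      (sobolev_norm 3 D (R w))\<^sup>2 \<le> B * (sobolev_seminorm 3 D w)\<^sup>2"
    using sobolev_proj_estimate[OF P[unfolded gsq_def]] unfolding R_def by blast
  have "\<exists>K\<ge>0. \<forall>w\<in>sobolev s D. (sobolev_norm s \<Omega> (E w))\<^sup>2 \<le> K * (sobolev_norm s D w)\<^sup>2" if s: "s \<le> 3" for s
  proof -
    obtain K1 where K1: "K1 \<ge> 0" "\<And>w. square_integrable D w \<Longrightarrow> (sobolev_norm s D (proj w))\<^sup>2 \<le> K1 * nsq D w"
      using proj_bound[OF bounded_open_axioms] by blast
    obtain K2 where K2: "K2 \<ge> 0" "\<And>w. square_integrable D w \<Longrightarrow> (sobolev_norm s \<Omega> (proj w))\<^sup>2 \<le> K2 * nsq D w"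
      using proj_bound[OF \<Omega>] by blast
    define K where "K = 2 * (C0\<^sup>2 * (2 + 2 * K1)) + 2 * K2"
    have "(sobolev_norm s \<Omega> (E w))\<^sup>2 \<le> K * (sobolev_norm s D w)\<^sup>2" if w: "w \<in> sobolev s D" for w
    proof -
      have sq: "square_integrable D w" by (rule sobolev_square_integrable[OF w])
      have n: "nsq D w \<le> (sobolev_norm s D w)\<^sup>2" by (rule nsq_le_norm[OF w])
      have p1: "(sobolev_norm s D (proj w))\<^sup>2 \<le> K1 * (sobolev_norm s D w)\<^sup>2"
        using K1(2)[OF sq] mult_left_mono[OF n K1(1)] by linarith
      have p2: "(sobolev_norm s \<Omega> (proj w))\<^sup>2 \<le> K2 * (sobolev_norm s D w)\<^sup>2"
        using K2(2)[OF sq] mult_left_mono[OF n K2(1)] by linarith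
      have "(sobolev_norm s D (R w))\<^sup>2 \<le> 2 * (sobolev_norm s D w)\<^sup>2 + 2 * (sobolev_norm s D (proj w))\<^sup>2"
        unfolding R_def by (rule sobolev_diff(2)[OF w pS(1)])
      also have "\<dots> \<le> (2 + 2 * K1) * (sobolev_norm s D w)\<^sup>2" using p1 by (simp add: algebra_simps)
      finally have Rn: "(sobolev_norm s D (R w))\<^sup>2 \<le> (2 + 2 * K1) * (sobolev_norm s D w)\<^sup>2" .
      have "(sobolev_norm s \<Omega> (E w))\<^sup>2 \<le> 2 * (sobolev_norm s \<Omega> (E0 (R w)))\<^sup>2 + 2 * (sobolev_norm s \<Omega> (proj w))\<^sup>2"
        unfolding E_def by (rule \<Omega>.sobolev_add(2)[OF C0(1)[OF s RS[OF w]] pS(2)])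
      also have "\<dots> \<le> 2 * (C0\<^sup>2 * (sobolev_norm s D (R w))\<^sup>2) + 2 * (K2 * (sobolev_norm s D w)\<^sup>2)"
        using C0sq[OF s RS[OF w]] p2 by linarith
      also have "\<dots> \<le> 2 * (C0\<^sup>2 * ((2 + 2 * K1) * (sobolev_norm s D w)\<^sup>2)) + 2 * (K2 * (sobolev_norm s D w)\<^sup>2)"
        using Rn by (intro add_right_mono mult_left_mono) auto
      also have "\<dots> = K * (sobolev_norm s D w)\<^sup>2" by (simp add: K_def algebra_simps)
      finally show ?thesis .
    qed
    moreover have "K \<ge> 0" using K1(1) K2(1) by (simp add: K_def)
    ultimately show ?thesis by blast
  qed
  then have "\<forall>s\<in>{..3}. \<exists>K. K \<ge> 0 \<and> (\<forall>w\<in>sobolev s D. (sobolev_norm s \<Omega> (E w))\<^sup>2 \<le> K * (sobolev_norm s D w)\<^sup>2)"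
    by auto
  from bchoice[OF this] obtain K where "\<forall>s\<in>{..3::nat}. K s \<ge> 0 \<and>
      (\<forall>w\<in>sobolev s D. (sobolev_norm s \<Omega> (E w))\<^sup>2 \<le> K s * (sobolev_norm s D w)\<^sup>2)" by blast
  then have K: "\<And>s. s \<le> 3 \<Longrightarrow> K s \<ge> 0"
    "\<And>s w. s \<le> 3 \<Longrightarrow> w \<in> sobolev s D \<Longrightarrow> (sobolev_norm s \<Omega> (E w))\<^sup>2 \<le> K s * (sobolev_norm s D w)\<^sup>2"
    by auto
  \<comment> \<open>\<open>extension_operator\<close> asks for one constant valid for all s up to 3,
    so the four constants are added up.\<close>
  define KK where "KK = (\<Sum>s\<le>3. K s)"
  have bound: "sobolev_norm s \<Omega> (E w) \<le> sqrt KK * sobolev_norm s D w" if s: "s \<le> 3" and w: "w \<in> sobolev s D" for s w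
  proof (rule power2_le_imp_le)
    have "K s \<le> KK" unfolding KK_def by (rule member_le_sum) (use s K(1) in auto)
    then have "K s * (sobolev_norm s D w)\<^sup>2 \<le> KK * (sobolev_norm s D w)\<^sup>2" by (intro mult_right_mono) auto
    moreover have "KK \<ge> 0" unfolding KK_def by (rule sum_nonneg) (use K(1) in auto)
    ultimately show "(sobolev_norm s \<Omega> (E w))\<^sup>2 \<le> (sqrt KK * sobolev_norm s D w)\<^sup>2"
      using K(2)[OF s w] by (simp add: power_mult_distrib)
    show "0 \<le> sqrt KK * sobolev_norm s D w" using \<open>KK \<ge> 0\<close> sobolev_norm_nonneg by simp
  qed
  have Eext: "AE x in lebesgue_on D. E w x = w x" if w: "w \<in> sobolev 0 D" for w
    using E0ext[OF RS[OF w]] by eventually_elim (simp add: E_def R_def)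
  have ext: "extension_operator \<Omega> D E"
    unfolding extension_operator_def
  proof (intro conjI allI ballI)
    fix a b v w assume vw: "v \<in> sobolev 0 D" "w \<in> sobolev 0 D"
    have pl: "proj (\<lambda>y. a * v y + b * w y) x = a * proj v x + b * proj w x" for x
      by (rule proj_lincomb[OF vw[THEN sobolev_square_integrable]])
    have Rl: "R (\<lambda>y. a * v y + b * w y) = (\<lambda>y. a * R v y + b * R w y)"
      by (auto simp: R_def pl fun_eq_iff algebra_simps)
    show "AE x in lebesgue_on \<Omega>. E (\<lambda>y. a * v y + b * w y) x = a * E v x + b * E w x"
      using E0lin[OF RS[OF vw(1)] RS[OF vw(2)], of a b]
      by eventually_elim (simp add: E_def Rl pl algebra_simps)
  next
    fix w assume "w \<in> sobolev 0 D"
    then show "AE x in lebesgue_on D. E w x = w x" by (rule Eext)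
  next
    have "E w \<in> sobolev s \<Omega>" if "s \<le> 3" "w \<in> sobolev s D" for s w
      unfolding E_def by (rule \<Omega>.sobolev_add(1)[OF C0(1)[OF that(1) RS[OF that(2)]] pS(2)])
    then show "\<exists>C. \<forall>s\<le>3. \<forall>w\<in>sobolev s D. E w \<in> sobolev s \<Omega> \<and>
        sobolev_norm s \<Omega> (E w) \<le> C * sobolev_norm s D w"
      using bound by blast
  next
    fix w assume "w \<in> sobolev 3 D"
    then show "continuous_on (closure \<Omega>) (E w)"
      unfolding E_def
      by (intro continuous_on_add E0cont RS smooth_continuous smooth_quadratics proj_quadratics)
  qed
  have main: "\<exists>p v. p \<in> quadratics \<and> v \<in> sobolev 3 \<Omega> \<and> continuous_on (closure \<Omega>) v \<and>
       E w = (\<lambda>x. v x + p x) \<and> (AE x in lebesgue_on D. w x = v x + p x) \<and>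
       sobolev_norm 3 \<Omega> v \<le> sqrt (C0\<^sup>2 * B) * sobolev_seminorm 3 D w" if w: "w \<in> sobolev 3 D" for w
  proof (rule exI[of _ "proj w"], rule exI[of _ "E0 (R w)"], intro conjI)
    show "sobolev_norm 3 \<Omega> (E0 (R w)) \<le> sqrt (C0\<^sup>2 * B) * sobolev_seminorm 3 D w"
    proof (rule power2_le_imp_le)
      have "(sobolev_norm 3 \<Omega> (E0 (R w)))\<^sup>2 \<le> C0\<^sup>2 * (B * (sobolev_seminorm 3 D w)\<^sup>2)"
        by (rule order_trans[OF C0sq[OF order_refl RS[OF w]] mult_left_mono[OF B(2)[OF w]]]) simp
      then show "(sobolev_norm 3 \<Omega> (E0 (R w)))\<^sup>2 \<le> (sqrt (C0\<^sup>2 * B) * sobolev_seminorm 3 D w)\<^sup>2"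
        using B(1) by (simp add: power_mult_distrib mult.assoc)
      show "0 \<le> sqrt (C0\<^sup>2 * B) * sobolev_seminorm 3 D w" using B(1) sobolev_norm_nonneg(2)[of 3 D w] by simp
    qed
    show "AE x in lebesgue_on D. w x = E0 (R w) x + proj w x"
      using Eext[OF lev0[OF w]] by eventually_elim (simp add: E_def)
  qed (use w in \<open>auto simp: E_def intro: proj_quadratics C0(1) RS E0cont\<close>)
  show ?thesis
  proof (intro exI[of _ E] exI[of _ "sqrt (C0\<^sup>2 * B)"] conjI ballI)
    show "0 \<le> sqrt (C0\<^sup>2 * B)" using B(1) by simp
  qed (use ext main in auto)
qed

section \<open>Finite elements and gradient recovery\<close>

text \<open>What a set of elements inherits from a triangulation of the whole domain; unlike
  \<open>triangulation_of\<close> it says nothing about the union and so applies to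
  submeshes.\<close>

definition simplicial_mesh :: "(real^2) set set \<Rightarrow> bool" where
  "simplicial_mesh M \<longleftrightarrow> finite M \<and> (\<forall>T\<in>M. 2 simplex T) \<and>
     (\<forall>T\<in>M. \<forall>T'\<in>M. (T \<inter> T') face_of T \<and> (T \<inter> T') face_of T')"

lemma simplicial_mesh_subset: "simplicial_mesh M \<Longrightarrow> M' \<subseteq> M \<Longrightarrow> simplicial_mesh M'"
  unfolding simplicial_mesh_def by (meson finite_subset subsetD)

lemma triangulation_of_simplicial_mesh:
  assumes "triangulation_of \<Omega> \<T>"
  shows "simplicial_mesh \<T>"
proof -
  have 1: "(T \<inter> T') face_of T" if "T \<in> \<T>" "T' \<in> \<T>" for T T'
    using assms that by (auto simp: triangulation_of_def triangulation_def)
  have "(T \<inter> T') face_of T'" if "T \<in> \<T>" "T' \<in> \<T>" for T T'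
    using 1[OF that(2,1)] by (simp add: Int_commute)
  with 1 show ?thesis
    using assms unfolding simplicial_mesh_def triangulation_of_def triangulation_def by blast
qed

section \<open>Continuous piecewise affine functions and nodal interpolation\<close>

lemma simplex_compact_convex: "2 simplex T \<Longrightarrow> compact T" "2 simplex T \<Longrightarrow> convex T" for T :: "(real^2) set"
  using compact_simplex convex_simplex by blast+

lemma affine_eq_on_hull:
  fixes b b' :: "'a::real_inner"
  assumes "\<And>x. x \<in> S \<Longrightarrow> a + b \<bullet> x = a' + b' \<bullet> x" "y \<in> convex hull S"
  shows "a + b \<bullet> y = a' + b' \<bullet> y"
proof -
  have eq: "{x. a + b \<bullet> x = a' + b' \<bullet> x} = {x. (b - b') \<bullet> x = a' - a}"
    by (auto simp: inner_diff_left)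
  have "convex {x. a + b \<bullet> x = a' + b' \<bullet> x}"
    unfolding eq by (rule convex_hyperplane)
  moreover have "S \<subseteq> {x. a + b \<bullet> x = a' + b' \<bullet> x}" using assms(1) by auto
  ultimately show ?thesis using hull_minimal[of S _ convex] assms(2) by blast
qed

text \<open>By Krein-Milman the extreme points suffice. This covers triangles as well as their
  common faces of any dimension.\<close>

lemma affine_eq_on_compact_convex:
  fixes b b' :: "real^2"
  assumes "compact F" "convex F" "\<And>x. x extreme_point_of F \<Longrightarrow> a + b \<bullet> x = a' + b' \<bullet> x" "y \<in> F"
  shows "a + b \<bullet> y = a' + b' \<bullet> y"
  using affine_eq_on_hull[of "{x. x extreme_point_of F}" a b a' b' y]
    Krein_Milman_Minkowski[OF assms(1,2)] assms(3,4) by auto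

lemma fe_space_unique:
  assumes M: "simplicial_mesh M" and v: "v \<in> fe_space M" "v' \<in> fe_space M"
    and eq: "\<And>z. z \<in> mesh_vertices M \<Longrightarrow> v z = v' z"
  shows "v = v'"
proof
  fix x
  show "v x = v' x"
  proof (cases "x \<in> \<Union>M")
    case True
    then obtain T where T: "T \<in> M" "x \<in> T" by blast
    obtain a b where ab: "\<And>x. x \<in> T \<Longrightarrow> v x = a + b \<bullet> x" using v(1) T(1) unfolding fe_space_def by blast
    obtain a' b' where ab': "\<And>x. x \<in> T \<Longrightarrow> v' x = a' + b' \<bullet> x" using v(2) T(1) unfolding fe_space_def by blast
    have s: "2 simplex T" using M T(1) by (simp add: simplicial_mesh_def)
    have "a + b \<bullet> x = a' + b' \<bullet> x"
    proof (rule affine_eq_on_compact_convex[OF simplex_compact_convex(1)[OF s] simplex_compact_convex(2)[OF s] _ T(2)])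
      fix z assume z: "z extreme_point_of T"
      then have "z \<in> T" "z \<in> mesh_vertices M" using T(1) by (auto simp: mesh_vertices_def extreme_point_of_def)
      then show "a + b \<bullet> z = a' + b' \<bullet> z" using ab ab' eq by metis
    qed
    then show ?thesis using ab ab' T(2) by simp
  next
    case False
    then show ?thesis using v by (simp add: fe_space_def)
  qed
qed

lemma linear_functional_inner:
  fixes g :: "'a::euclidean_space \<Rightarrow> real"
  assumes "linear g"
  obtains b where "\<And>x. g x = b \<bullet> x"
proof -
  have "g x = (\<Sum>i\<in>Basis. g i *\<^sub>R i) \<bullet> x" for x
  proof -
    have "g x = g (\<Sum>i\<in>Basis. (x \<bullet> i) *\<^sub>R i)" by (simp add: euclidean_representation)
    also have "\<dots> = (\<Sum>i\<in>Basis. (x \<bullet> i) * g i)"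
      by (simp add: linear_sum[OF assms] linear_cmul[OF assms])
    finally show ?thesis
      unfolding inner_sum_left by (simp add: inner_commute[of x] mult.commute)
  qed
  then show ?thesis using that by blast
qed

text \<open>Translating one vertex to the origin makes the others linearly independent, so
  prescribed values there extend to a linear functional.\<close>

lemma affine_interpolation:
  fixes f :: "'a::euclidean_space \<Rightarrow> real"
  assumes "n simplex T"
  obtains a b where "\<And>z. z extreme_point_of T \<Longrightarrow> a + b \<bullet> z = f z"
proof -
  obtain C where C: "\<not> affine_dependent C" "T = convex hull C"
    using assms unfolding simplex_def by blast
  have ext: "z extreme_point_of T \<Longrightarrow> z \<in> C" for z
    unfolding C(2) by (rule extreme_point_of_convex_hull)
  show ?thesis
  proof (cases "C = {}")
    case True
    then show ?thesis using ext that[of 0 0] by blast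
  next
    case False
    then obtain p where p: "p \<in> C" by blast
    have "independent ((\<lambda>x. - p + x) ` (C - {p}))"
      using C(1) affine_dependent_iff_dependent2[OF p] by simp
    from linear_independent_extend[OF this, of "\<lambda>x. f (p + x) - f p"]
    obtain g where g: "linear g" "\<And>x. x \<in> (\<lambda>x. - p + x) ` (C - {p}) \<Longrightarrow> g x = f (p + x) - f p" by blast
    obtain b where b: "\<And>x. g x = b \<bullet> x" using linear_functional_inner[OF g(1)] by blast
    show ?thesis
    proof (rule that[of "f p - b \<bullet> p" b])
      fix z assume "z extreme_point_of T"
      then have "z \<in> C" by (rule ext)
      show "f p - b \<bullet> p + b \<bullet> z = f z"
      proof (cases "z = p")
        case False
        then have "g (- p + z) = f z - f p" using g(2)[of "- p + z"] \<open>z \<in> C\<close> by auto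
        then show ?thesis by (simp add: b inner_diff_right)
      qed simp
    qed
  qed
qed

lemma fe_space_exists:
  assumes M: "simplicial_mesh M"
  obtains v where "v \<in> fe_space M" "\<And>z. z \<in> mesh_vertices M \<Longrightarrow> v z = f z"
proof -
  have "\<forall>T\<in>M. \<exists>ab. \<forall>z. z extreme_point_of T \<longrightarrow> fst ab + snd ab \<bullet> z = f z"
  proof
    fix T assume "T \<in> M"
    then have "2 simplex T" using M by (simp add: simplicial_mesh_def)
    then obtain a b where "\<And>z. z extreme_point_of T \<Longrightarrow> a + b \<bullet> z = f z"
      using affine_interpolation by blast
    then show "\<exists>ab. \<forall>z. z extreme_point_of T \<longrightarrow> fst ab + snd ab \<bullet> z = f z"
      by (intro exI[of _ "(a, b)"]) simp
  qed
  from bchoice[OF this] obtain ab where ab: "\<And>T z. T \<in> M \<Longrightarrow> z extreme_point_of T \<Longrightarrow>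
      fst (ab T) + snd (ab T) \<bullet> z = f z" by blast
  define A where "A T x = fst (ab T) + snd (ab T) \<bullet> x" for T and x :: "real^2"
  \<comment> \<open>The intersection is a face of both triangles, so its extreme points are vertices
    of both, where the two affine functions take the same prescribed values.\<close>
  have glue: "A T x = A T' x" if T: "T \<in> M" "T' \<in> M" and x: "x \<in> T" "x \<in> T'" for T T' x
    unfolding A_def
  proof (rule affine_eq_on_compact_convex[where F="T \<inter> T'"])
    have s: "2 simplex T" "2 simplex T'" using M T by (auto simp: simplicial_mesh_def)
    show "compact (T \<inter> T')" "convex (T \<inter> T')"
      using simplex_compact_convex[OF s(1)] simplex_compact_convex[OF s(2)]
      by (auto intro: compact_Int convex_Int)
    fix z assume z: "z extreme_point_of T \<inter> T'"
    have F: "(T \<inter> T') face_of T" "(T \<inter> T') face_of T'" using M T by (auto simp: simplicial_mesh_def)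
    have "z extreme_point_of T" "z extreme_point_of T'"
      using z extreme_point_of_face[OF F(1), of z] extreme_point_of_face[OF F(2), of z] by auto
    then show "fst (ab T) + snd (ab T) \<bullet> z = fst (ab T') + snd (ab T') \<bullet> z"
      using ab T by simp
  qed (use x in auto)
  \<comment> \<open>By \<open>glue\<close> the chosen element does not influence the value; the 0
    outside follows the convention of \<open>fe_space\<close>.\<close>
  define v where "v x = (if x \<in> \<Union>M then A (SOME T. T \<in> M \<and> x \<in> T) x else 0)" for x
  have vT: "v x = A T x" if "T \<in> M" "x \<in> T" for T x
  proof -
    define U where "U = (SOME T. T \<in> M \<and> x \<in> T)"
    have U: "U \<in> M \<and> x \<in> U"
      unfolding U_def by (rule someI[of "\<lambda>T. T \<in> M \<and> x \<in> T" T]) (use that in simp)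
    have "x \<in> \<Union>M" using that by blast
    then have "v x = A U x" unfolding v_def U_def by (rule if_P)
    then show ?thesis using glue[of U T x] U that by simp
  qed
  have "continuous_on (\<Union>T\<in>M. T) v"
  proof (rule continuous_on_closed_Union)
    show "finite M" using M by (simp add: simplicial_mesh_def)
    fix T assume T: "T \<in> M"
    show "closed T" using M T simplex_compact_convex(1) compact_imp_closed by (auto simp: simplicial_mesh_def)
    have "continuous_on T (A T)" unfolding A_def by (intro continuous_intros)
    then show "continuous_on T v" using vT[OF T] by (simp cong: continuous_on_cong)
  qed
  then have "v \<in> fe_space M"
    unfolding fe_space_def using vT by (auto simp: A_def) (auto simp: v_def)
  moreover have "v z = f z" if z: "z \<in> mesh_vertices M" for z
  proof -
    obtain T where T: "T \<in> M" "z extreme_point_of T" using z unfolding mesh_vertices_def by blast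
    then have "z \<in> T" by (simp add: extreme_point_of_def)
    then show ?thesis using vT[OF T(1)] ab[OF T] by (simp add: A_def)
  qed
  ultimately show ?thesis by (rule that)
qed

lemma nodal_interp:
  assumes M: "simplicial_mesh M"
  shows "nodal_interp M f \<in> fe_space M" "z \<in> mesh_vertices M \<Longrightarrow> nodal_interp M f z = f z"
proof -
  have "\<exists>!v. v \<in> fe_space M \<and> (\<forall>z \<in> mesh_vertices M. v z = f z)"
  proof (rule ex_ex1I)
    show "\<exists>v. v \<in> fe_space M \<and> (\<forall>z \<in> mesh_vertices M. v z = f z)"
      using fe_space_exists[OF M, of f] by metis
  qed (use fe_space_unique[OF M] in auto)
  from theI'[OF this] show "nodal_interp M f \<in> fe_space M"
    "z \<in> mesh_vertices M \<Longrightarrow> nodal_interp M f z = f z"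
    unfolding nodal_interp_def by blast+
qed

lemma nodal_interp_eqI:
  assumes M: "simplicial_mesh M" and "v \<in> fe_space M" "\<And>z. z \<in> mesh_vertices M \<Longrightarrow> v z = f z"
  shows "nodal_interp M f = v"
  using fe_space_unique[OF M nodal_interp(1)[OF M] assms(2), of f] nodal_interp(2)[OF M] assms(3) by simp

lemma mesh_vertices_subset: "z \<in> mesh_vertices M \<Longrightarrow> z \<in> \<Union>M"
  by (auto simp: mesh_vertices_def extreme_point_of_def)

text \<open>Piecewise affine interpolation is exact for affine functions. It is applied to the
  partial derivatives of a quadratic, which are affine.\<close>

lemma nodal_interp_add_affine:
  assumes M: "simplicial_mesh M" and g: "\<And>z. z \<in> mesh_vertices M \<Longrightarrow> g z = f z + (a + b \<bullet> z)"
    and x: "x \<in> \<Union>M"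
  shows "nodal_interp M g x = nodal_interp M f x + (a + b \<bullet> x)"
proof -
  \<comment> \<open>The affine part has to be cut off outside the mesh to stay in
    \<open>fe_space\<close>; hence the restriction of x to the union of M.\<close>
  define v where "v x = (if x \<in> \<Union>M then nodal_interp M f x + (a + b \<bullet> x) else 0)" for x
  have If: "continuous_on (\<Union>M) (nodal_interp M f)"
    "\<And>T. T \<in> M \<Longrightarrow> \<exists>a b. \<forall>x\<in>T. nodal_interp M f x = a + b \<bullet> x"
    using nodal_interp(1)[OF M, of f] by (auto simp: fe_space_def)
  have "v \<in> fe_space M"
    unfolding fe_space_def
  proof (intro CollectI conjI ballI allI impI)
    have "continuous_on (\<Union>M) (\<lambda>x. nodal_interp M f x + (a + b \<bullet> x))"
      by (intro continuous_intros If(1))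
    then show "continuous_on (\<Union>M) v"
      by (rule continuous_on_eq) (simp add: v_def)
    fix T assume T: "T \<in> M"
    obtain a' b' where "\<forall>x\<in>T. nodal_interp M f x = a' + b' \<bullet> x" using If(2)[OF T] by blast
    then have "\<forall>x\<in>T. v x = (a' + a) + (b' + b) \<bullet> x"
      using T by (auto simp: v_def inner_add_left)
    then show "\<exists>a b. \<forall>x\<in>T. v x = a + b \<bullet> x" by blast
  qed (simp add: v_def)
  moreover have "v z = g z" if "z \<in> mesh_vertices M" for z
    using mesh_vertices_subset[OF that] nodal_interp(2)[OF M that] g[OF that] by (simp add: v_def)
  ultimately have "nodal_interp M g = v" by (rule nodal_interp_eqI[OF M])
  then show ?thesis using x by (simp add: v_def)
qed

section \<open>Quadratic least-squares fits and the recovered gradient\<close>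

lemma quadratics_diff: "p \<in> quadratics \<Longrightarrow> q \<in> quadratics \<Longrightarrow> (\<lambda>x. p x - q x) \<in> quadratics"
  and quadratics_add: "p \<in> quadratics \<Longrightarrow> q \<in> quadratics \<Longrightarrow> (\<lambda>x. p x + q x) \<in> quadratics"
  using quadratics_lincomb[of p q 1 "-1"] quadratics_lincomb[of p q 1 1] by simp_all

text \<open>Replacing a competitor r by r - q leaves all residuals unchanged, because q itself is an
  admissible polynomial.\<close>

lemma is_quadratic_fit_add:
  assumes "is_quadratic_fit S f p" "q \<in> quadratics" "\<And>x. x \<in> S \<Longrightarrow> g x = f x + q x"
  shows "is_quadratic_fit S g (\<lambda>x. p x + q x)"
  unfolding is_quadratic_fit_def
proof (intro conjI ballI)
  show "(\<lambda>x. p x + q x) \<in> quadratics"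
    using assms by (intro quadratics_add) (auto simp: is_quadratic_fit_def)
  fix r assume "r \<in> quadratics"
  then have "(\<lambda>x. r x - q x) \<in> quadratics" using assms(2) by (rule quadratics_diff)
  then have "(\<Sum>x\<in>S. (p x - f x)\<^sup>2) \<le> (\<Sum>x\<in>S. (r x - q x - f x)\<^sup>2)"
    using assms(1) by (simp add: is_quadratic_fit_def)
  also have "(\<Sum>x\<in>S. (r x - q x - f x)\<^sup>2) = (\<Sum>x\<in>S. (r x - g x)\<^sup>2)"
    by (intro sum.cong) (auto simp: assms(3) algebra_simps)
  also have "(\<Sum>x\<in>S. (p x - f x)\<^sup>2) = (\<Sum>x\<in>S. (p x + q x - g x)\<^sup>2)"
    by (intro sum.cong) (auto simp: assms(3) algebra_simps)
  finally show "(\<Sum>x\<in>S. (p x + q x - g x)\<^sup>2) \<le> (\<Sum>x\<in>S. (r x - g x)\<^sup>2)" .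
qed

lemma quadratic_fit_add:
  assumes ex1: "\<And>f. \<exists>!p. is_quadratic_fit S f p" and q: "q \<in> quadratics"
    and g: "\<And>x. x \<in> S \<Longrightarrow> g x = f x + q x"
  shows "quadratic_fit S g = (\<lambda>x. quadratic_fit S f x + q x)" "quadratic_fit S f \<in> quadratics"
proof -
  have fit: "is_quadratic_fit S h (quadratic_fit S h)" for h
    unfolding quadratic_fit_def by (rule theI'[OF ex1])
  show "quadratic_fit S g = (\<lambda>x. quadratic_fit S f x + q x)"
    using ex1[of g] fit[of g] is_quadratic_fit_add[OF fit[of f] q g] by blast
  show "quadratic_fit S f \<in> quadratics" using fit[of f] by (simp add: is_quadratic_fit_def)
qed

lemma partial_add:
  assumes "f differentiable_on UNIV" "g differentiable_on UNIV"
  shows "partial j (\<lambda>x. f x + g x) = (\<lambda>x. partial j f x + partial j g x)"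
proof -
  have d: "((\<lambda>x. f x + g x) has_derivative
      (\<lambda>h. frechet_derivative f (at x) h + frechet_derivative g (at x) h)) (at x)" for x
    by (intro has_derivative_add has_derivative_partial assms)
  show ?thesis unfolding partial_eqI[OF d] by (simp add: partial_def)
qed

lemma partial_quadratics_affine:
  assumes "p \<in> quadratics"
  obtains a b where "\<And>x. partial j p x = a + b \<bullet> x"
proof -
  obtain a b c d e f where p: "p = quad a b c d e f" using assms unfolding quadratics_iff by blast
  have lin: "quad a b c 0 0 0 x = a + vector [b, c] \<bullet> x" for a b c x
    by (simp add: quad_def inner_vec_def sum_2 vector_2)
  show ?thesis
  proof (cases "j = 1")
    case True
    then show ?thesis using that[of b "vector [2 * d, e]"] by (simp add: p lin)
  next
    case False
    then have "j = 2" using exhaust_2 by auto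
    then show ?thesis using that[of c "vector [e, 2 * f]"] by (simp add: p lin)
  qed
qed

text \<open>Adding q to the sampled values adds q to every local fit by uniqueness. The recovered
  nodal values then change by the derivative of q, an affine function, which the final interpolation
  reproduces at every point of the mesh.\<close>

lemma ppr_gradient_add_quadratic:
  assumes M: "simplicial_mesh M" and P: "ppr_patches M P" and q: "q \<in> quadratics" and x: "x \<in> \<Union>M"
  shows "ppr_gradient M P (nodal_interp M (\<lambda>x. v x + q x)) x $ j
    = ppr_gradient M P (nodal_interp M v) x $ j + partial j q x"
proof -
  obtain a b where ab: "\<And>x. partial j q x = a + b \<bullet> x" using partial_quadratics_affine[OF q] by blast
  let ?F = "\<lambda>v z. quadratic_fit (mesh_vertices (P z)) (nodal_interp M v)"
  have "partial j (?F (\<lambda>x. v x + q x) z) z = partial j (?F v z) z + (a + b \<bullet> z)"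
    if z: "z \<in> mesh_vertices M" for z
  proof -
    have Pz: "P z \<subseteq> M" "\<And>f. \<exists>!p. is_quadratic_fit (mesh_vertices (P z)) f p"
      using P z by (auto simp: ppr_patches_def)
    \<comment> \<open>The sampling points are vertices of M, where interpolants take exact values,
      so q enters the fit itself and not merely its interpolant.\<close>
    have vert: "nodal_interp M (\<lambda>x. v x + q x) y = nodal_interp M v y + q y" if "y \<in> mesh_vertices (P z)" for y
    proof -
      have "y \<in> mesh_vertices M" using that Pz(1) by (auto simp: mesh_vertices_def)
      then show ?thesis using nodal_interp(2)[OF M] by simp
    qed
    have F: "?F (\<lambda>x. v x + q x) z = (\<lambda>x. ?F v z x + q x)" "?F v z \<in> quadratics"
      using quadratic_fit_add[OF Pz(2) q vert] by blast+
    have "partial j (\<lambda>x. ?F v z x + q x) = (\<lambda>x. partial j (?F v z) x + partial j q x)"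
      by (intro partial_add smooth_differentiable smooth_quadratics F(2) q)
    then show ?thesis
      unfolding F(1) by (simp add: ab)
  qed
  from nodal_interp_add_affine[OF M this x] show ?thesis
    by (simp add: ppr_gradient_def ab)
qed

lemma ppr_gradient_square_integrable:
  assumes M: "simplicial_mesh M" and D: "open D" "D \<subseteq> \<Union>M"
  shows "square_integrable D (\<lambda>x. ppr_gradient M P v x $ j)"
proof (rule square_integrable_compact[OF D])
  show "compact (\<Union>M)" using M simplex_compact_convex(1) by (auto simp: simplicial_mesh_def intro!: compact_Union)
  show "continuous_on (\<Union>M) (\<lambda>x. ppr_gradient M P v x $ j)"
    using nodal_interp(1)[OF M] by (simp add: ppr_gradient_def fe_space_def)
qed

lemma L2_norm_on_vec:
  fixes f :: "real^2 \<Rightarrow> real^2"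
  assumes "\<And>j. square_integrable D (\<lambda>x. f x $ j)"
  shows "(L2_norm_on D f)\<^sup>2 = (\<Sum>j\<in>UNIV. nsq D (\<lambda>x. f x $ j))"
proof -
  have "(L2_norm_on D f)\<^sup>2 = (LINT x|lebesgue_on D. (norm (f x))\<^sup>2)"
    by (simp add: L2_norm_on_def)
  also have "\<dots> = (LINT x|lebesgue_on D. (\<Sum>j\<in>UNIV. (f x $ j)\<^sup>2))"
    by (simp add: norm_vec_def L2_set_def sum_nonneg)
  also have "\<dots> = (\<Sum>j\<in>UNIV. nsq D (\<lambda>x. f x $ j))"
    unfolding nsq_def using assms by (intro Bochner_Integration.integral_sum) (simp add: square_integrable_square)
  finally show ?thesis .
qed

section \<open>The recovery error\<close>

text \<open>Near a boundary point the region below the graph is open and disjoint from \<Omega>, so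
  \<Omega> lies on one side only. This places the interiors of triangles and of fictitious domains
  inside \<Omega>.\<close>

lemma lipschitz_domain_interior_closure:
  assumes "open \<Omega>" "lipschitz_boundary \<Omega>"
  shows "interior (closure \<Omega>) = \<Omega>"
proof
  show "\<Omega> \<subseteq> interior (closure \<Omega>)"
    using assms(1) closure_subset by (rule interior_maximal[rotated])
  show "interior (closure \<Omega>) \<subseteq> \<Omega>"
  proof (rule ccontr)
    assume "\<not> interior (closure \<Omega>) \<subseteq> \<Omega>"
    then obtain x where x: "x \<in> interior (closure \<Omega>)" "x \<notin> \<Omega>" by blast
    then have "x \<in> frontier \<Omega>"
      using assms(1) interior_subset by (auto simp: frontier_def interior_open)
    then obtain a b \<gamma> L r where c: "norm a = 1" "norm b = 1" "a \<bullet> b = 0" "r > 0"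
      "L-lipschitz_on UNIV (\<gamma> :: real \<Rightarrow> real)"
      "\<Omega> \<inter> ball x r = {y \<in> ball x r. \<gamma> (y \<bullet> a) < y \<bullet> b}"
      using assms(2) unfolding lipschitz_boundary_def by blast
    obtain e where e: "e > 0" "ball x e \<subseteq> closure \<Omega>"
      using x(1) mem_interior by blast
    define t where "t = min r e / 2"
    have t: "t > 0" "t < r" "t < e" using c(4) e(1) by (auto simp: t_def)
    \<comment> \<open>x lies on or below the graph; moving from x by t against b leads strictly
      below it, within the chart and within the supposed interior of the closure.\<close>
    define y where "y = x - t *\<^sub>R b"
    have yd: "dist x y = t" using t c(2) by (simp add: y_def dist_norm)
    have "x \<notin> {y \<in> ball x r. \<gamma> (y \<bullet> a) < y \<bullet> b}" using x(2) c(6) by blast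
    then have "x \<bullet> b \<le> \<gamma> (x \<bullet> a)" using c(4) by simp
    moreover have "y \<bullet> a = x \<bullet> a" "y \<bullet> b = x \<bullet> b - t"
      using c(2,3) by (simp_all add: y_def inner_diff_left inner_commute[of b a] dot_square_norm)
    ultimately have y: "y \<bullet> b < \<gamma> (y \<bullet> a)" using t(1) by simp
    have "continuous_on UNIV \<gamma>" using c(5) by (rule lipschitz_on_continuous_on)
    then have "continuous_on UNIV (\<lambda>y. \<gamma> (y \<bullet> a))"
      by (rule continuous_on_compose2) (auto intro: continuous_intros)
    then have "open {y. y \<bullet> b < \<gamma> (y \<bullet> a)}"
      by (intro open_Collect_less) (auto intro: continuous_intros)
    then have "open ({y. y \<bullet> b < \<gamma> (y \<bullet> a)} \<inter> ball x r)" by (intro open_Int) auto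
    moreover have "y \<in> {y. y \<bullet> b < \<gamma> (y \<bullet> a)} \<inter> ball x r" using y yd t by simp
    moreover have "y \<in> closure \<Omega>" using e(2) yd t by auto
    ultimately have "\<Omega> \<inter> ({y. y \<bullet> b < \<gamma> (y \<bullet> a)} \<inter> ball x r) \<noteq> {}"
      using open_Int_closure_eq_empty[of "{y. y \<bullet> b < \<gamma> (y \<bullet> a)} \<inter> ball x r" \<Omega>] by blast
    then obtain z where "z \<in> \<Omega> \<inter> ball x r" "z \<bullet> b < \<gamma> (z \<bullet> a)" by blast
    then show False using c(6) by auto
  qed
qed

text \<open>The convex pieces are the open triangles of one mesh; they lie in \<Omega> because it is
  the interior of its closure, and the remaining edges are negligible.\<close>

lemma tight_triangulated:
  assumes bo: "bounded_open \<Omega>" and int: "interior (closure \<Omega>) = \<Omega>" and tr: "triangulation_of \<Omega> \<T>" and \<eta>: "\<eta> > 0"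
  shows "tight \<eta> \<Omega>"
proof -
  have M: "simplicial_mesh \<T>" by (rule triangulation_of_simplicial_mesh[OF tr])
  have U: "\<Union>\<T> = closure \<Omega>" using tr by (simp add: triangulation_of_def)
  have cc: "compact T" "convex T" if "T \<in> \<T>" for T
    using M that simplex_compact_convex by (auto simp: simplicial_mesh_def)
  show ?thesis
  proof (rule tight_finite_union[OF bo _ _ _ _ \<eta>])
    show "finite \<T>" using M by (simp add: simplicial_mesh_def)
    show "open (interior T) \<and> convex (interior T) \<and> interior T \<subseteq> \<Omega>" if "T \<in> \<T>" for T
      using cc(2)[OF that] interior_mono[of T "closure \<Omega>"] that U int by (auto intro: convex_interior)
    show "negligible (\<Union>T\<in>\<T>. frontier T)"
      using M cc by (intro negligible_Union) (auto simp: simplicial_mesh_def intro: negligible_convex_frontier)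
    show "\<Omega> \<subseteq> (\<Union>T\<in>\<T>. interior T) \<union> (\<Union>T\<in>\<T>. frontier T)"
    proof
      fix x assume "x \<in> \<Omega>"
      then have "x \<in> \<Union>\<T>" unfolding U by (rule subsetD[OF closure_subset])
      then obtain T where T: "T \<in> \<T>" "x \<in> T" by blast
      then have "x \<in> interior T \<or> x \<in> frontier T"
        using closure_subset[of T] by (auto simp: frontier_def)
      with T(1) show "x \<in> (\<Union>T\<in>\<T>. interior T) \<union> (\<Union>T\<in>\<T>. frontier T)" by auto
    qed
  qed
qed

lemma weak_grad_nth: "weak_grad D w x $ j = weak_partial D (shift j (0, 0)) w x"
  using exhaust_2[of j] by (auto simp: weak_grad_def vector_2 shift_def)

text \<open>\<open>ppr_estimates\<close> speaks of the fictitious domain, whose interior N lies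
  between D and \<Omega>. It is applied to v; adding p changes the exact and the recovered gradient
  equally, so on D the errors for u and for v coincide.\<close>

lemma recovery_error_subdomain:
  assumes \<Omega>: "bounded_open \<Omega>" "interior (closure \<Omega>) = \<Omega>" and tr: "triangulation_of \<Omega> \<T>"
    and D: "open D" "D \<subseteq> \<Omega>"
    and P: "ppr_patches (submesh D \<T>) P" "ppr_estimates K h (submesh D \<T>) P"
    and u: "u \<in> sobolev 3 D" and p: "p \<in> quadratics" and v: "v \<in> sobolev 3 \<Omega>" "continuous_on (closure \<Omega>) v"
    and uvp: "AE x in lebesgue_on D. u x = v x + p x"
  shows "L2_norm_on D (\<lambda>x. weak_grad D u x -
      ppr_gradient (submesh D \<T>) P (nodal_interp (submesh D \<T>) (\<lambda>x. v x + p x)) x)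
    \<le> \<bar>K\<bar> * h\<^sup>2 * sobolev_norm 3 \<Omega> v"
proof -
  interpret \<Omega>: bounded_open \<Omega> by fact
  interpret D: bounded_open D by (rule \<Omega>.sub_bounded_open[OF D])
  define M where "M = submesh D \<T>"
  define N where "N = interior (\<Union>M)"
  have U: "\<Union>\<T> = closure \<Omega>" using tr by (simp add: triangulation_of_def)
  have MT: "M \<subseteq> \<T>" by (auto simp: M_def submesh_def)
  have M: "simplicial_mesh M"
    by (rule simplicial_mesh_subset[OF triangulation_of_simplicial_mesh[OF tr] MT])
  have "D \<subseteq> \<Union>M"
  proof
    fix x assume x: "x \<in> D"
    then have "x \<in> \<Union>\<T>" using D(2) U closure_subset by blast
    then show "x \<in> \<Union>M" using x closure_subset[of D] by (auto simp: M_def submesh_def)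
  qed
  then have DN: "D \<subseteq> N" unfolding N_def using D(1) by (simp add: interior_maximal)
  have oN: "open N" and NM: "N \<subseteq> \<Union>M" by (auto simp: N_def interior_subset)
  have MC: "\<Union>M \<subseteq> closure \<Omega>" using MT U by blast
  have N\<Omega>: "N \<subseteq> \<Omega>" unfolding N_def using interior_mono[OF MC] \<Omega>(2) by simp
  interpret N: bounded_open N by (rule \<Omega>.sub_bounded_open[OF oN N\<Omega>])
  have vN: "v \<in> sobolev 3 N" by (rule \<Omega>.sobolev_domain_mono(1)[OF oN N\<Omega> v(1)])
  have vN1: "v \<in> sobolev 1 N" and uD1: "u \<in> sobolev 1 D"
    using vN u N.sobolev_level_mono[of 1 3] D.sobolev_level_mono[of 1 3] by auto
  define G where "G = ppr_gradient M P (nodal_interp M v)"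
  define F where "F = ppr_gradient M P (nodal_interp M (\<lambda>x. v x + p x))"
  have "L2_norm_on N (\<lambda>x. weak_grad N v x - G x) \<le> K * h\<^sup>2 * sobolev_norm 3 N v"
    using P(2) vN continuous_on_subset[OF v(2) MC] unfolding ppr_estimates_def N_def G_def M_def by blast
  \<comment> \<open>K is an arbitrary real number; its absolute value is taken so that the norm on N
    may be enlarged to the one on \<Omega>.\<close>
  also have "\<dots> \<le> \<bar>K\<bar> * h\<^sup>2 * sobolev_norm 3 \<Omega> v"
    using \<Omega>.sobolev_domain_mono(2)[OF oN N\<Omega> v(1)] sobolev_norm_nonneg(1)[of 3 N v]
    by (intro mult_mono) auto
  finally have est: "L2_norm_on N (\<lambda>x. weak_grad N v x - G x) \<le> \<bar>K\<bar> * h\<^sup>2 * sobolev_norm 3 \<Omega> v" .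
  have sN: "square_integrable N (\<lambda>x. (weak_grad N v x - G x) $ j)" for j
    unfolding vector_minus_component weak_grad_nth G_def
    by (intro square_integrable_diff N.gradient_square_integrable vN1 ppr_gradient_square_integrable M oN NM)
  have sD: "square_integrable D (\<lambda>x. (weak_grad D u x - F x) $ j)" for j
    unfolding vector_minus_component weak_grad_nth F_def
    by (intro square_integrable_diff D.gradient_square_integrable uD1 ppr_gradient_square_integrable M D(1)
        order_trans[OF DN NM])
  have sND: "square_integrable D (\<lambda>x. (weak_grad N v x - G x) $ j)"
    "nsq D (\<lambda>x. (weak_grad N v x - G x) $ j) \<le> nsq N (\<lambda>x. (weak_grad N v x - G x) $ j)" for j
    using square_integrable_mono[OF D.opn_lebesgue N.opn_lebesgue DN sN] by blast+
  \<comment> \<open>On D, u equals v + p almost everywhere, and D lies in the union of M, where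
    quadratics are reproduced; p therefore cancels.\<close>
  have eq: "nsq D (\<lambda>x. (weak_grad D u x - F x) $ j) = nsq D (\<lambda>x. (weak_grad N v x - G x) $ j)" for j
  proof (rule nsq_cong_AE)
    show "(\<lambda>x. (weak_grad D u x - F x) $ j) \<in> borel_measurable (lebesgue_on D)"
      "(\<lambda>x. (weak_grad N v x - G x) $ j) \<in> borel_measurable (lebesgue_on D)"
      using sD sND(1) square_integrable_measurable by blast+
    have ps: "smooth p" by (rule smooth_quadratics[OF p])
    have vD: "square_integrable D v"
      by (rule square_integrable_mono(1)[OF D.opn_lebesgue N.opn_lebesgue DN N.sobolev_square_integrable[OF vN]])
    have pD: "square_integrable D p" by (rule D.smooth_square_integrable[OF ps])
    have "has_weak_partial D (shift j (0, 0)) (\<lambda>x. 1 * v x + 1 * p x)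
        (\<lambda>x. 1 * weak_partial N (shift j (0, 0)) v x + 1 * multi_partial (shift j (0, 0)) p x)"
      by (intro D.has_weak_partial_lincomb vD pD D.smooth_has_weak_partial ps
          N.has_weak_partial_mono[OF D(1) DN] N.has_weak_gradient vN1)
    then have "has_weak_partial D (shift j (0, 0)) (\<lambda>x. v x + p x)
        (\<lambda>x. weak_partial N (shift j (0, 0)) v x + partial j p x)"
      using partial_multi_partial[OF ps, of j "(0, 0)"] by simp
    then have "has_weak_partial D (shift j (0, 0)) u
        (\<lambda>x. weak_partial N (shift j (0, 0)) v x + partial j p x)"
    proof (rule D.has_weak_partial_cong_AE[rotated 3])
      show "square_integrable D (\<lambda>x. v x + p x)" by (rule square_integrable_add[OF vD pD])
      show "square_integrable D u" by (rule D.sobolev_square_integrable[OF u])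
      show "AE x in lebesgue_on D. v x + p x = u x" using uvp by eventually_elim simp
    qed
    from D.weak_partial_eq(2)[OF this]
    have "AE x in lebesgue_on D. weak_partial D (shift j (0, 0)) u x
        = weak_partial N (shift j (0, 0)) v x + partial j p x" .
    moreover have "AE x in lebesgue_on D. x \<in> D" by (rule AE_I2) simp
    ultimately show "AE x in lebesgue_on D. (weak_grad D u x - F x) $ j = (weak_grad N v x - G x) $ j"
    proof eventually_elim
      case (elim x)
      have "x \<in> \<Union>M" using elim(2) DN NM by blast
      from ppr_gradient_add_quadratic[OF M P(1)[folded M_def] p this, of v j] elim(1)
      show ?case by (simp add: weak_grad_nth F_def G_def)
    qed
  qed
  have "(L2_norm_on D (\<lambda>x. weak_grad D u x - F x))\<^sup>2 \<le> (L2_norm_on N (\<lambda>x. weak_grad N v x - G x))\<^sup>2"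
    unfolding L2_norm_on_vec[OF sD] L2_norm_on_vec[OF sN] eq by (intro sum_mono sND(2))
  then have "L2_norm_on D (\<lambda>x. weak_grad D u x - F x) \<le> L2_norm_on N (\<lambda>x. weak_grad N v x - G x)"
    by (rule power2_le_imp_le) (simp add: L2_norm_on_def)
  with est show ?thesis unfolding F_def M_def by simp
qed

theorem theorem4p1:
  fixes \<Omega> \<Gamma> \<Omega>1 \<Omega>2 :: "(real^2) set"
  assumes "polygonal_lipschitz_domain \<Omega>"
    and "interface \<Omega> \<Gamma> \<Omega>1 \<Omega>2"
    and "\<exists>E1. extension_operator \<Omega> \<Omega>1 E1"
    and "\<exists>E2. extension_operator \<Omega> \<Omega>2 E2"
  shows "\<exists>E1 E2. extension_operator \<Omega> \<Omega>1 E1 \<and> extension_operator \<Omega> \<Omega>2 E2 \<and>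
    (\<forall>\<sigma>0 K. \<exists>C>0. \<forall>\<T> P1 P2. admissible_mesh \<Omega> \<Gamma> \<Omega>1 \<Omega>2 \<sigma>0 K \<T> P1 P2 \<longrightarrow>
      (\<forall>u \<in> broken_sobolev 3 \<Omega>1 \<Omega>2.
         L2_pair_dist \<Omega>1 \<Omega>2 (broken_grad \<Omega>1 \<Omega>2 u)
             (unfitted_ppr \<Omega>1 \<Omega>2 \<T> P1 P2 (unfitted_interp \<Omega>1 \<Omega>2 \<T> E1 E2 u))
           \<le> C * (mesh_size \<T>)\<^sup>2 * broken_seminorm 3 \<Omega>1 \<Omega>2 u))"
proof -
  have \<Omega>: "bounded_open \<Omega>" "interior (closure \<Omega>) = \<Omega>"
    using assms(1) lipschitz_domain_interior_closure
    by (auto simp: polygonal_lipschitz_domain_def bounded_open_def)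
  have D1: "open \<Omega>1" "connected \<Omega>1" "\<Omega>1 \<noteq> {}" "\<Omega>1 \<subseteq> \<Omega>"
    and D2: "open \<Omega>2" "connected \<Omega>2" "\<Omega>2 \<noteq> {}" "\<Omega>2 \<subseteq> \<Omega>"
    using assms(2) by (auto simp: interface_def)
  show ?thesis
  \<comment> \<open>Tightness of \<Omega> is derived from the triangles of a mesh. If no
    triangulation exists, no mesh is admissible and the given operators serve with the constant
    1.\<close>
  proof (cases "\<exists>\<T>. triangulation_of \<Omega> \<T>")
    case False
    then have "\<not> admissible_mesh \<Omega> \<Gamma> \<Omega>1 \<Omega>2 \<sigma>0 K \<T> P1 P2" for \<sigma>0 K \<T> P1 P2
      by (simp add: admissible_mesh_def)
    then show ?thesis using assms(3,4) zero_less_one by blast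
  next
    case True
    then have tight: "tight \<eta> \<Omega>" if "\<eta> > 0" for \<eta> using tight_triangulated[OF \<Omega> _ that] by blast
    from assms(3) obtain E1 C1 where E1: "extension_operator \<Omega> \<Omega>1 E1" "C1 \<ge> 0"
      "\<And>w. w \<in> sobolev 3 \<Omega>1 \<Longrightarrow> \<exists>p v. p \<in> quadratics \<and> v \<in> sobolev 3 \<Omega> \<and> continuous_on (closure \<Omega>) v \<and>
       E1 w = (\<lambda>x. v x + p x) \<and> (AE x in lebesgue_on \<Omega>1. w x = v x + p x) \<and>
       sobolev_norm 3 \<Omega> v \<le> C1 * sobolev_seminorm 3 \<Omega>1 w"
      using quadratic_preserving_extension[OF \<Omega>(1) tight D1] by blast
    from assms(4) obtain E2 C2 where E2: "extension_operator \<Omega> \<Omega>2 E2" "C2 \<ge> 0"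
      "\<And>w. w \<in> sobolev 3 \<Omega>2 \<Longrightarrow> \<exists>p v. p \<in> quadratics \<and> v \<in> sobolev 3 \<Omega> \<and> continuous_on (closure \<Omega>) v \<and>
       E2 w = (\<lambda>x. v x + p x) \<and> (AE x in lebesgue_on \<Omega>2. w x = v x + p x) \<and>
       sobolev_norm 3 \<Omega> v \<le> C2 * sobolev_seminorm 3 \<Omega>2 w"
      using quadratic_preserving_extension[OF \<Omega>(1) tight D2] by blast
    \<comment> \<open>C' comes from the extension and is independent of the mesh; h enters only
      through the recovery estimate. Both subdomains are instances.\<close>
    have part: "L2_norm_on D (\<lambda>x. weak_grad D u x -
          ppr_gradient (submesh D \<T>) P (nodal_interp (submesh D \<T>) (E u)) x)
        \<le> C * h\<^sup>2 * sobolev_seminorm 3 D u"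
      if "open D" "D \<subseteq> \<Omega>" "triangulation_of \<Omega> \<T>" "ppr_patches (submesh D \<T>) P"
        "ppr_estimates K h (submesh D \<T>) P" "u \<in> sobolev 3 D"
        and ex: "\<exists>p v. p \<in> quadratics \<and> v \<in> sobolev 3 \<Omega> \<and> continuous_on (closure \<Omega>) v \<and>
          E u = (\<lambda>x. v x + p x) \<and> (AE x in lebesgue_on D. u x = v x + p x) \<and>
          sobolev_norm 3 \<Omega> v \<le> C' * sobolev_seminorm 3 D u"
        and C: "\<bar>K\<bar> * C' \<le> C"
      for D \<T> P E u K h C C'
    proof -
      obtain p v where pv: "p \<in> quadratics" "v \<in> sobolev 3 \<Omega>" "continuous_on (closure \<Omega>) v"
        "E u = (\<lambda>x. v x + p x)" "AE x in lebesgue_on D. u x = v x + p x"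
        "sobolev_norm 3 \<Omega> v \<le> C' * sobolev_seminorm 3 D u" using ex by blast
      have "L2_norm_on D (\<lambda>x. weak_grad D u x -
          ppr_gradient (submesh D \<T>) P (nodal_interp (submesh D \<T>) (E u)) x)
        \<le> \<bar>K\<bar> * h\<^sup>2 * sobolev_norm 3 \<Omega> v"
        unfolding pv(4) by (rule recovery_error_subdomain[OF \<Omega> that(3,1,2,4,5,6) pv(1,2,3,5)])
      also have "\<dots> \<le> \<bar>K\<bar> * h\<^sup>2 * (C' * sobolev_seminorm 3 D u)"
        using pv(6) by (intro mult_left_mono) auto
      also have "\<dots> = (\<bar>K\<bar> * C') * (h\<^sup>2 * sobolev_seminorm 3 D u)" by simp
      also have "\<dots> \<le> C * (h\<^sup>2 * sobolev_seminorm 3 D u)"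
        using C sobolev_norm_nonneg(2)[of 3 D u] by (intro mult_right_mono) auto
      finally show ?thesis by (simp add: mult.assoc)
    qed
    show ?thesis
    proof (rule exI[of _ E1], rule exI[of _ E2], intro conjI allI E1(1) E2(1))
      fix \<sigma>0 K :: real
      \<comment> \<open>C1 and C2 were fixed together with the operators, so neither mesh nor u
        enters; the + 1 makes C strictly positive.\<close>
      define C where "C = \<bar>K\<bar> * (C1 + C2) + 1"
      have C: "C > 0" "\<bar>K\<bar> * C1 \<le> C" "\<bar>K\<bar> * C2 \<le> C"
        unfolding C_def using E1(2) E2(2) by (auto simp: distrib_left add_nonneg_pos)
      show "\<exists>C>0. \<forall>\<T> P1 P2. admissible_mesh \<Omega> \<Gamma> \<Omega>1 \<Omega>2 \<sigma>0 K \<T> P1 P2 \<longrightarrow>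
        (\<forall>u \<in> broken_sobolev 3 \<Omega>1 \<Omega>2.
         L2_pair_dist \<Omega>1 \<Omega>2 (broken_grad \<Omega>1 \<Omega>2 u)
             (unfitted_ppr \<Omega>1 \<Omega>2 \<T> P1 P2 (unfitted_interp \<Omega>1 \<Omega>2 \<T> E1 E2 u))
           \<le> C * (mesh_size \<T>)\<^sup>2 * broken_seminorm 3 \<Omega>1 \<Omega>2 u)"
      proof (intro exI[of _ C] conjI allI impI ballI C(1))
        fix \<T> P1 P2 u
        assume adm: "admissible_mesh \<Omega> \<Gamma> \<Omega>1 \<Omega>2 \<sigma>0 K \<T> P1 P2" and "u \<in> broken_sobolev 3 \<Omega>1 \<Omega>2"
        then have u: "u \<in> sobolev 3 \<Omega>1" "u \<in> sobolev 3 \<Omega>2" by (auto simp: broken_sobolev_def)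
        define h where "h = mesh_size \<T>"
        have tr: "triangulation_of \<Omega> \<T>"
          and P: "ppr_patches (submesh \<Omega>1 \<T>) P1" "ppr_estimates K h (submesh \<Omega>1 \<T>) P1"
            "ppr_patches (submesh \<Omega>2 \<T>) P2" "ppr_estimates K h (submesh \<Omega>2 \<T>) P2"
          using adm by (auto simp: admissible_mesh_def h_def)
        define e1 where "e1 = L2_norm_on \<Omega>1 (\<lambda>x. weak_grad \<Omega>1 u x -
          ppr_gradient (submesh \<Omega>1 \<T>) P1 (nodal_interp (submesh \<Omega>1 \<T>) (E1 u)) x)"
        define e2 where "e2 = L2_norm_on \<Omega>2 (\<lambda>x. weak_grad \<Omega>2 u x -
          ppr_gradient (submesh \<Omega>2 \<T>) P2 (nodal_interp (submesh \<Omega>2 \<T>) (E2 u)) x)"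
        have e1: "e1 \<le> C * h\<^sup>2 * sobolev_seminorm 3 \<Omega>1 u"
          unfolding e1_def by (rule part[where E=E1, OF D1(1,4) tr P(1,2) u(1) E1(3)[OF u(1)] C(2)])
        have e2: "e2 \<le> C * h\<^sup>2 * sobolev_seminorm 3 \<Omega>2 u"
          unfolding e2_def by (rule part[where E=E2, OF D2(1,4) tr P(3,4) u(2) E2(3)[OF u(2)] C(3)])
        have e0: "0 \<le> e1" "0 \<le> e2" by (auto simp: e1_def e2_def L2_norm_on_def)
        have "sqrt (e1\<^sup>2 + e2\<^sup>2) \<le> sqrt ((C * h\<^sup>2 * sobolev_seminorm 3 \<Omega>1 u)\<^sup>2 + (C * h\<^sup>2 * sobolev_seminorm 3 \<Omega>2 u)\<^sup>2)"
          using e0 e1 e2 by (intro real_sqrt_le_mono add_mono power_mono)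
        also have "\<dots> = sqrt ((C * h\<^sup>2)\<^sup>2 * ((sobolev_seminorm 3 \<Omega>1 u)\<^sup>2 + (sobolev_seminorm 3 \<Omega>2 u)\<^sup>2))"
          by (simp add: power_mult_distrib distrib_left)
        also have "\<dots> = C * h\<^sup>2 * broken_seminorm 3 \<Omega>1 \<Omega>2 u"
          using C(1) by (simp add: real_sqrt_mult broken_seminorm_def)
        finally show "L2_pair_dist \<Omega>1 \<Omega>2 (broken_grad \<Omega>1 \<Omega>2 u)
             (unfitted_ppr \<Omega>1 \<Omega>2 \<T> P1 P2 (unfitted_interp \<Omega>1 \<Omega>2 \<T> E1 E2 u))
           \<le> C * (mesh_size \<T>)\<^sup>2 * broken_seminorm 3 \<Omega>1 \<Omega>2 u"
          by (simp add: L2_pair_dist_def broken_grad_def unfitted_ppr_def unfitted_interp_def e1_def e2_def h_def)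
      qed
    qed
  qed
qed

end
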